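(* Let $k\in\{1,2,3,\dots\}\cup\{\infty\}$, let $\psi:M\to N$ be a $C^k$-map between Banach $C^k$-manifolds, let $q\in N$, $S:=\psi^{-1}(q)$, and let $X$ be a Banach space. Assume that (1) $q$ is a regular value in the sense that for each $p\in S$ the differential $d\psi(p):T_p(M)\to T_q(N)$ is surjective; and (2) for every $p\in S$ there exist an open $0$-neighborhood $U_p\subseteq X$ and a $C^k$-map $\phi_p:U_p\to S\subseteq M$ such that $\phi_p(0)=p$, $d\phi_p(0)$ is injective, and $\operatorname{im}(d\phi_p(0))=\ker(d\psi(p))$. Then $S$ carries the structure of a Banach $C^k$-manifold modeled on $X$.
   Context: $C^k$ is meant in the sense of Fréchet differentiability between Banach spaces. That $\phi_p:U_p\to S\subseteq M$ is a $C^k$-map means that it is $C^k$ as a map into $M$ and takes its values in $S$. A Banach $C^k$-manifold modeled on $X$ is one with a $C^k$-atlas whose charts take values in open subsets of $X$. The kernels $\ker(d\psi(p))$ are not assumed to be complemented in $T_p(M)$. *)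

theory Defs
  imports "HOL-Analysis.Analysis" "HOL-Library.Extended_Nat"
begin

section \<open>\<open>C\<^sup>k\<close>-maps in the sense of Frechet\<close>

text \<open>
  A Banach space is represented by a closed linear subspace \<open>E\<close> of a type of class \<open>banach\<close>, so
  that the charts of one manifold may be modeled on different Banach spaces: any family of Banach
  spaces embeds isometrically into its \<open>\<ell>\<^sup>1\<close>-sum, and a Banach space that is a type is
  \<open>UNIV\<close>.

  The library predicate \<open>has_derivative\<close> at \<open>x within E\<close> is not usable for proper subspaces: it
  demands a bounded linear map on the whole type, and a bounded linear map on \<open>E\<close> need not have
  a bounded linear extension if \<open>E\<close> is not complemented.
\<close>

definition banach_subspace :: "'e::banach set \<Rightarrow> bool" where
  "banach_subspace E \<longleftrightarrow> subspace E \<and> closed E"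

definition bounded_linear_on ::
  "'e::real_normed_vector set \<Rightarrow> ('e \<Rightarrow> 'f::real_normed_vector) \<Rightarrow> bool" where
  "bounded_linear_on E L \<longleftrightarrow>
     (\<forall>u\<in>E. \<forall>v\<in>E. \<forall>a b. L (a *\<^sub>R u + b *\<^sub>R v) = a *\<^sub>R L u + b *\<^sub>R L v) \<and>
     (\<exists>K. \<forall>v\<in>E. norm (L v) \<le> K * norm v)"

text \<open>
  The derivative in \<open>E\<close> at a point of a relatively open subset \<open>U\<close> of \<open>E\<close>; the filter only sees
  arguments in \<open>U\<close>.
\<close>

definition has_derivative_in ::
  "'e::real_normed_vector set \<Rightarrow> ('e \<Rightarrow> 'f::real_normed_vector) \<Rightarrow> ('e \<Rightarrow> 'f) \<Rightarrow> 'e \<Rightarrow> bool" where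
  "has_derivative_in E f L x \<longleftrightarrow>
     bounded_linear_on E L \<and>
     ((\<lambda>h. norm (f (x + h) - f x - L h) / norm h) \<longlongrightarrow> 0) (at 0 within E)"

text \<open>Like \<open>frechet_derivative\<close>; the chosen map is uniquely determined on \<open>E\<close> only.\<close>

definition derivative_in ::
  "'e::real_normed_vector set \<Rightarrow> ('e \<Rightarrow> 'f::real_normed_vector) \<Rightarrow> 'e \<Rightarrow> 'e \<Rightarrow> 'f" where
  "derivative_in E f x = (SOME L. has_derivative_in E f L x)"

text \<open>A \<open>j\<close>-linear map on \<open>E\<close> takes its arguments as a list of length \<open>j\<close>.\<close>

definition bounded_multilinear_on ::
  "'e::real_normed_vector set \<Rightarrow> nat \<Rightarrow> ('e list \<Rightarrow> 'f::real_normed_vector) \<Rightarrow> bool" where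
  "bounded_multilinear_on E j A \<longleftrightarrow>
     (\<forall>vs i. length vs = j \<longrightarrow> set vs \<subseteq> E \<longrightarrow> i < j \<longrightarrow>
        (\<forall>u\<in>E. \<forall>v\<in>E. \<forall>a b.
           A (vs[i := a *\<^sub>R u + b *\<^sub>R v]) = a *\<^sub>R A (vs[i := u]) + b *\<^sub>R A (vs[i := v]))) \<and>
     (\<exists>K. \<forall>vs. length vs = j \<longrightarrow> set vs \<subseteq> E \<longrightarrow> norm (A vs) \<le> K * prod_list (map norm vs))"

definition multilinear_norm ::
  "'e::real_normed_vector set \<Rightarrow> nat \<Rightarrow> ('e list \<Rightarrow> 'f::real_normed_vector) \<Rightarrow> real" where
  "multilinear_norm E j A =
     Sup {norm (A vs) | vs. length vs = j \<and> set vs \<subseteq> E \<and> (\<forall>v\<in>set vs. norm v \<le> 1)}"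

text \<open>
  \<open>D j x\<close> is the \<open>j\<close>-th Frechet derivative of \<open>f\<close> at \<open>x\<close>, where
  \<open>L(E, L(E, \<dots>))\<close> is identified isometrically with the space of bounded \<open>j\<close>-linear maps
  under \<open>multilinear_norm\<close>: the type of an iterated \<open>blinfun\<close> would depend on \<open>j\<close>.
  To be used for \<open>U\<close> open in \<open>E\<close>.
\<close>

definition Ck_on ::
  "enat \<Rightarrow> 'e::banach set \<Rightarrow> 'e set \<Rightarrow> ('e \<Rightarrow> 'f::banach) \<Rightarrow> bool" where
  "Ck_on k E U f \<longleftrightarrow>
     (\<exists>D :: nat \<Rightarrow> 'e \<Rightarrow> 'e list \<Rightarrow> 'f.
        (\<forall>x\<in>U. D 0 x [] = f x) \<and>
        (\<forall>j. enat j \<le> k \<longrightarrow> (\<forall>x\<in>U. bounded_multilinear_on E j (D j x))) \<and>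
        (\<forall>j. enat j < k \<longrightarrow> (\<forall>x\<in>U.
           ((\<lambda>h. multilinear_norm E j (\<lambda>vs. D j (x + h) vs - D j x vs - D (Suc j) x (h # vs)) / norm h)
              \<longlongrightarrow> 0) (at 0 within E))) \<and>
        (\<forall>j. enat j \<le> k \<longrightarrow> (\<forall>x\<in>U.
           ((\<lambda>y. multilinear_norm E j (\<lambda>vs. D j y vs - D j x vs)) \<longlongrightarrow> 0) (at x within E))))"


section \<open>Banach manifolds\<close>

datatype ('m, 'e) chart =
  Chart (cdom: "'m set") (cmap: "'m \<Rightarrow> 'e") (cmodel: "'e set")

definition cinv :: "('m, 'e) chart \<Rightarrow> 'e \<Rightarrow> 'm" where
  "cinv c = inv_into (cdom c) (cmap c)"

definition chart_on :: "'m topology \<Rightarrow> ('m, 'e::banach) chart \<Rightarrow> bool" where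
  "chart_on M c \<longleftrightarrow>
     openin M (cdom c) \<and>
     banach_subspace (cmodel c) \<and>
     openin (top_of_set (cmodel c)) (cmap c ` cdom c) \<and>
     homeomorphic_map (subtopology M (cdom c)) (top_of_set (cmap c ` cdom c)) (cmap c)"

text \<open>
  A manifold is a topological space \<open>M\<close> with an atlas \<open>A\<close>, which need not be maximal.
  Hausdorffness is not part of the definition; where it is wanted, subspaces inherit it
  (\<open>Hausdorff_space_subtopology\<close>).
\<close>

definition banach_manifold ::
  "enat \<Rightarrow> 'm topology \<Rightarrow> ('m, 'e::banach) chart set \<Rightarrow> bool" where
  "banach_manifold k M A \<longleftrightarrow>
     (\<forall>c\<in>A. chart_on M c) \<and>
     (\<Union>c\<in>A. cdom c) = topspace M \<and>
     (\<forall>c\<in>A. \<forall>d\<in>A. Ck_on k (cmodel c) (cmap c ` (cdom c \<inter> cdom d)) (cmap d \<circ> cinv c))"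

definition modeled_on :: "('m, 'e) chart set \<Rightarrow> 'e set \<Rightarrow> bool" where
  "modeled_on A X \<longleftrightarrow> (\<forall>c\<in>A. cmodel c = X)"

definition Ck_map ::
  "enat \<Rightarrow> 'm topology \<Rightarrow> ('m, 'e::banach) chart set \<Rightarrow>
   'n topology \<Rightarrow> ('n, 'f::banach) chart set \<Rightarrow> ('m \<Rightarrow> 'n) \<Rightarrow> bool" where
  "Ck_map k M A N B f \<longleftrightarrow>
     continuous_map M N f \<and>
     (\<forall>c\<in>A. \<forall>d\<in>B.
        Ck_on k (cmodel c) (cmap c ` (cdom c \<inter> f -` cdom d)) (cmap d \<circ> f \<circ> cinv c))"

definition open_set_atlas :: "'x::banach set \<Rightarrow> ('x, 'x) chart set" where
  "open_set_atlas U = {Chart U id UNIV}"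


section \<open>Tangent spaces and differentials\<close>

text \<open>
  A tangent vector at \<open>p\<close> is an equivalence class of pairs of a chart around \<open>p\<close> and a vector of
  its model space, where \<open>(c, v)\<close> is equivalent to \<open>(d, w)\<close> if the derivative of the chart change
  from \<open>c\<close> to \<open>d\<close> maps \<open>v\<close> to \<open>w\<close>.
\<close>

definition tangent_vector ::
  "('m, 'e::banach) chart set \<Rightarrow> 'm \<Rightarrow> ('m, 'e) chart \<Rightarrow> 'e \<Rightarrow> (('m, 'e) chart \<times> 'e) set" where
  "tangent_vector A p c v =
     {(d, derivative_in (cmodel c) (cmap d \<circ> cinv c) (cmap c p) v) | d. d \<in> A \<and> p \<in> cdom d}"

definition tangent_space ::
  "('m, 'e::banach) chart set \<Rightarrow> 'm \<Rightarrow> (('m, 'e) chart \<times> 'e) set set" where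
  "tangent_space A p =
     {tangent_vector A p c v | c v. c \<in> A \<and> p \<in> cdom c \<and> v \<in> cmodel c}"

definition tangent_zero ::
  "('m, 'e::banach) chart set \<Rightarrow> 'm \<Rightarrow> (('m, 'e) chart \<times> 'e) set" where
  "tangent_zero A p = {(c, 0) | c. c \<in> A \<and> p \<in> cdom c}"

text \<open>All representatives \<open>(c, v)\<close> of \<open>\<xi>\<close> contribute the same pairs.\<close>

definition differential ::
  "('m, 'e::banach) chart set \<Rightarrow> ('n, 'f::banach) chart set \<Rightarrow> ('m \<Rightarrow> 'n) \<Rightarrow> 'm \<Rightarrow>
   (('m, 'e) chart \<times> 'e) set \<Rightarrow> (('n, 'f) chart \<times> 'f) set" where
  "differential A B f p \<xi> =
     {(d, derivative_in (cmodel c) (cmap d \<circ> f \<circ> cinv c) (cmap c p) v) | c v d.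
        (c, v) \<in> \<xi> \<and> d \<in> B \<and> f p \<in> cdom d}"

definition differential_kernel ::
  "('m, 'e::banach) chart set \<Rightarrow> ('n, 'f::banach) chart set \<Rightarrow> ('m \<Rightarrow> 'n) \<Rightarrow> 'm \<Rightarrow>
   (('m, 'e) chart \<times> 'e) set set" where
  "differential_kernel A B f p =
     {\<xi> \<in> tangent_space A p. differential A B f p \<xi> = tangent_zero B (f p)}"

end

theory Submission
  imports Defs
begin

text \<open>
  In a chart of \<open>M\<close> around \<open>p \<in> S\<close> and a chart of \<open>N\<close> around \<open>q\<close>, the parametrization
  \<open>\<phi>\<close> becomes a map \<open>f\<close> from an open subset of \<open>X\<close> to a Banach space \<open>E\<close>, and \<open>\<psi>\<close> becomes a map
  \<open>R\<close> on an open subset of \<open>E\<close>. With \<open>T = Df(0)\<close> and \<open>Q = DR(f(0))\<close> the hypotheses say that \<open>Q\<close> is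
  onto, \<open>T\<close> is injective and \<open>range T = ker Q\<close>. As \<open>ker Q\<close> need not have a closed complement, no
  inverse or implicit function theorem applies to \<open>f\<close> or \<open>R\<close>. Two arguments replace it.

  \<^emph>\<open>\<phi> covers a neighbourhood of p in S.\<close> Let \<open>y\<close> be a point of \<open>S\<close> in the chart and \<open>w = y - f x\<close>.
  Since \<open>R\<close> takes the same value at \<open>y\<close> and \<open>f x\<close>, we have \<open>Q w = o(w)\<close>. By the open mapping
  theorem \<open>w\<close> is within \<open>o(w)\<close> of \<open>ker Q = range T\<close>, so \<open>w = T h + o(w)\<close> with
  \<open>norm h \<le> C * norm w\<close>. Passing from \<open>x\<close> to \<open>x + h\<close> therefore halves the error, and the iteration
  converges to a solution of \<open>f x = y\<close> (\<open>solve_by_approximate_corrections\<close>,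
  \<open>level_set_parametrized\<close>). The open mapping theorem also bounds \<open>T\<close> from below, hence
  \<open>K * norm (x - y) \<le> norm (f x - f y)\<close> near \<open>0\<close>. So \<open>\<phi>\<close> is a homeomorphism from a neighbourhood
  of \<open>0\<close> to a neighbourhood of \<open>p\<close> in \<open>S\<close>, and its inverse is a chart (\<open>level_set_chart\<close>).

  \<^emph>\<open>Chart changes are as smooth as the parametrizations.\<close> Let \<open>f\<^sub>1\<close>, \<open>f\<^sub>2\<close> represent two parametrizations in one chart of \<open>M\<close>,
  and let \<open>f\<^sub>2 \<circ> g = f\<^sub>1\<close>, with \<open>f\<^sub>2\<close> bounded from below as above. Then \<open>g\<close> is Lipschitz at every
  point and \<open>Df\<^sub>2(g x) (g (x + h) - g x) = Df\<^sub>1(x) h + o(h)\<close>. Thus \<open>Df\<^sub>1(x) h\<close> is a limit of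
  points of the range of \<open>Df\<^sub>2(g x)\<close>, which is closed since \<open>Df\<^sub>2(g x)\<close> is bounded from below. So
  \<open>Df\<^sub>1(x) h = Df\<^sub>2(g x) k\<close> for a unique \<open>k\<close>, and \<open>k\<close> is the derivative of \<open>g\<close> in direction \<open>h\<close>
  (\<open>mderiv_lift\<close>). For the higher derivatives, a solution \<open>u\<close> of \<open>P(x) (u(x)) = R(x)\<close> with \<open>P(x)\<close>
  bounded from below is as smooth as \<open>P\<close> and \<open>R\<close>: by the same limit argument \<open>u\<close> is
  differentiable, and \<open>u'\<close> solves an equation with the same \<open>P\<close> and the right-hand side
  \<open>R' - P' u\<close> (\<open>smooth_divide\<close>). Applied to \<open>Df\<^sub>2(g x) (Dg(x)) = Df\<^sub>1(x)\<close>, this makes \<open>g\<close> a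
  \<open>C\<^sup>k\<close>-map (\<open>Ck_on_lift_immersion\<close>).

  The inclusion of \<open>S\<close> into \<open>M\<close> is represented by \<open>f\<close> in these charts, so at \<open>p\<close> its differential
  has the injectivity and the range that are assumed of the differential of \<open>\<phi>\<close> at \<open>0\<close>.
\<close>

abbreviation norms :: "'x::real_normed_vector list \<Rightarrow> real" where
  "norms vs \<equiv> prod_list (map norm vs)"

section \<open>Differentiable maps into spaces of multilinear maps\<close>

definition mbound :: "nat \<Rightarrow> ('x::real_normed_vector list \<Rightarrow> 'y::real_normed_vector) \<Rightarrow> real \<Rightarrow> bool" where
  "mbound n A K \<longleftrightarrow> (\<forall>vs. length vs = n \<longrightarrow> norm (A vs) \<le> K * norms vs)"

text \<open>
  Linearity is required at every split of the argument list, because the arguments of a derivative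
  arise by inserting vectors into lists. Together with the bound this is \<open>bounded_multilinear_on\<close>
  on the whole space, see \<open>mlin_iff_bounded_multilinear_on\<close>.
\<close>

definition mlin :: "nat \<Rightarrow> ('x::real_normed_vector list \<Rightarrow> 'y::real_normed_vector) \<Rightarrow> bool" where
  "mlin n A \<longleftrightarrow>
     (\<forall>xs ys. Suc (length xs + length ys) = n \<longrightarrow> linear (\<lambda>h. A (xs @ h # ys))) \<and>
     (\<exists>K. mbound n A K)"

text \<open>
  In \<open>mcont\<close> and \<open>mderiv\<close> the operator norm of the error is dominated by a function \<open>\<rho>\<close> that tends
  to \<open>0\<close>, so that estimates can be combined by the limit rules. The filter includes \<open>h = 0\<close>:
  increments \<open>g (x + h) - g x\<close>, which may vanish, can be substituted for \<open>h\<close>.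
\<close>

definition mcont :: "nat \<Rightarrow> ('x::real_normed_vector \<Rightarrow> 'x list \<Rightarrow> 'y::real_normed_vector) \<Rightarrow> 'x \<Rightarrow> bool" where
  "mcont n F x \<longleftrightarrow>
     (\<exists>\<rho>. (\<rho> \<longlongrightarrow> 0) (nhds 0) \<and> (\<forall>\<^sub>F h in nhds 0. mbound n (\<lambda>vs. F (x + h) vs - F x vs) (\<rho> h)))"

definition mderiv ::
  "nat \<Rightarrow> ('x::real_normed_vector \<Rightarrow> 'x list \<Rightarrow> 'y::real_normed_vector) \<Rightarrow> ('x list \<Rightarrow> 'y) \<Rightarrow> 'x \<Rightarrow> bool" where
  "mderiv n F F' x \<longleftrightarrow>
     (\<exists>\<rho>. (\<rho> \<longlongrightarrow> 0) (nhds 0) \<and>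
       (\<forall>\<^sub>F h in nhds 0. mbound n (\<lambda>vs. F (x + h) vs - F x vs - F' (h # vs)) (\<rho> h * norm h)))"

text \<open>
  \<open>F\<close> is a \<open>C\<^sup>k\<close>-map from \<open>U\<close> to the Banach space of bounded \<open>n\<close>-linear maps. A derivative takes
  one more argument, at the head of the list; so all orders of differentiation live in one type and
  statements about them can be proved by induction on \<open>k\<close>.
\<close>

fun smooth ::
  "nat \<Rightarrow> nat \<Rightarrow> 'x::real_normed_vector set \<Rightarrow> ('x \<Rightarrow> 'x list \<Rightarrow> 'y::real_normed_vector) \<Rightarrow> bool" where
  "smooth 0 n U F \<longleftrightarrow> (\<forall>x\<in>U. mlin n (F x) \<and> mcont n F x)"
| "smooth (Suc k) n U F \<longleftrightarrow> (\<forall>x\<in>U. mlin n (F x)) \<and>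
     (\<exists>F'. (\<forall>x\<in>U. mderiv n F (F' x) x) \<and> smooth k (Suc n) U F')"

lemma prod_list_norm_nonneg [simp]: "0 \<le> norms vs"
  by (induction vs) auto

lemma mboundD: "mbound n A K \<Longrightarrow> length vs = n \<Longrightarrow> norm (A vs) \<le> K * norms vs"
  by (simp add: mbound_def)

lemma mbound_mono: "mbound n A K \<Longrightarrow> K \<le> L \<Longrightarrow> mbound n A L"
  unfolding mbound_def by (auto intro: order_trans[OF _ mult_right_mono])

lemma mbound_add: "mbound n A K \<Longrightarrow> mbound n B L \<Longrightarrow> mbound n (\<lambda>vs. A vs + B vs) (K + L)"
  unfolding mbound_def by (auto simp: distrib_right intro: norm_triangle_mono)

lemma mbound_scaleR: "mbound n A K \<Longrightarrow> mbound n (\<lambda>vs. c *\<^sub>R A vs) (\<bar>c\<bar> * K)"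
  unfolding mbound_def by (auto simp: mult.assoc mult_left_mono)

lemma mbound_cong: "(\<And>vs. length vs = n \<Longrightarrow> A vs = B vs) \<Longrightarrow> mbound n A K \<longleftrightarrow> mbound n B K"
  by (auto simp: mbound_def)

lemma mbound_Cons: "mbound (Suc n) A K \<Longrightarrow> mbound n (\<lambda>vs. A (h # vs)) (K * norm h)"
  unfolding mbound_def
proof (intro allI impI)
  fix vs :: "'a list"
  assume "\<forall>vs. length vs = Suc n \<longrightarrow> norm (A vs) \<le> K * norms vs" "length vs = n"
  then show "norm (A (h # vs)) \<le> K * norm h * norms vs"
    by (auto simp: mult.assoc dest: spec[of _ "h # vs"])
qed

lemma mlin_slot: "mlin n A \<Longrightarrow> Suc (length xs + length ys) = n \<Longrightarrow> linear (\<lambda>h. A (xs @ h # ys))"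
  by (simp add: mlin_def)

lemma mlin_head: "mlin (Suc n) A \<Longrightarrow> length vs = n \<Longrightarrow> linear (\<lambda>h. A (h # vs))"
  using mlin_slot[of "Suc n" A "[]" vs] by simp

lemma mlin_bound:
  assumes "mlin n A" obtains K where "K > 0" "mbound n A K"
proof -
  obtain K where "mbound n A K" using assms by (auto simp: mlin_def)
  then have "mbound n A (max K 1)" by (rule mbound_mono) simp
  then show thesis by (rule that[rotated]) simp
qed

lemma mlin_cong:
  assumes "\<And>vs. length vs = n \<Longrightarrow> A vs = B vs" and "mlin n A" shows "mlin n B"
proof -
  have "linear (\<lambda>h. B (xs @ h # ys))" if "Suc (length xs + length ys) = n" for xs ys
  proof -
    have "(\<lambda>h. B (xs @ h # ys)) = (\<lambda>h. A (xs @ h # ys))"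
      using assms(1) that by (intro ext) simp
    then show ?thesis using mlin_slot[OF assms(2) that] by simp
  qed
  then show ?thesis using assms mbound_cong[of n A B] unfolding mlin_def by blast
qed

lemma mlin_add_scaleR:
  assumes "mlin n A" "mlin n B" shows "mlin n (\<lambda>vs. A vs + c *\<^sub>R B vs)"
proof -
  obtain K L where KL: "mbound n A K" "mbound n B L" using assms by (auto simp: mlin_def)
  have "mbound n (\<lambda>vs. A vs + c *\<^sub>R B vs) (K + \<bar>c\<bar> * L)"
    by (intro mbound_add mbound_scaleR KL)
  moreover have "linear (\<lambda>h. A (xs @ h # ys) + c *\<^sub>R B (xs @ h # ys))"
    if "Suc (length xs + length ys) = n" for xs ys
    by (intro linear_compose_add linear_compose_scale_right mlin_slot[OF assms(1) that] mlin_slot[OF assms(2) that])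
  ultimately show ?thesis unfolding mlin_def by blast
qed

lemma mcontI:
  assumes "(\<rho> \<longlongrightarrow> 0) (nhds 0)" "\<forall>\<^sub>F h in nhds 0. mbound n (\<lambda>vs. F (x + h) vs - F x vs) (\<rho> h)"
  shows "mcont n F x"
  using assms unfolding mcont_def by blast

lemma mderivI:
  assumes "(\<rho> \<longlongrightarrow> 0) (nhds 0)"
    "\<forall>\<^sub>F h in nhds 0. mbound n (\<lambda>vs. F (x + h) vs - F x vs - F' (h # vs)) (\<rho> h * norm h)"
  shows "mderiv n F F' x"
  using assms unfolding mderiv_def by blast

lemma mcontE:
  assumes "mcont n F x"
  obtains \<rho> where "(\<rho> \<longlongrightarrow> 0) (nhds 0)" "\<forall>h. 0 \<le> \<rho> h"
    "\<forall>\<^sub>F h in nhds 0. mbound n (\<lambda>vs. F (x + h) vs - F x vs) (\<rho> h)"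
proof -
  obtain \<rho> where \<rho>: "(\<rho> \<longlongrightarrow> 0) (nhds 0)" "\<forall>\<^sub>F h in nhds 0. mbound n (\<lambda>vs. F (x + h) vs - F x vs) (\<rho> h)"
    using assms unfolding mcont_def by blast
  show thesis
  proof (rule that[of "\<lambda>h. \<bar>\<rho> h\<bar>"])
    show "((\<lambda>h. \<bar>\<rho> h\<bar>) \<longlongrightarrow> 0) (nhds 0)" using \<rho>(1) by (rule tendsto_rabs_zero)
    show "\<forall>\<^sub>F h in nhds 0. mbound n (\<lambda>vs. F (x + h) vs - F x vs) \<bar>\<rho> h\<bar>"
      using \<rho>(2) by eventually_elim (auto elim: mbound_mono)
  qed simp
qed

lemma mderivE:
  assumes "mderiv n F F' x"
  obtains \<rho> where "(\<rho> \<longlongrightarrow> 0) (nhds 0)" "\<forall>h. 0 \<le> \<rho> h"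
    "\<forall>\<^sub>F h in nhds 0. mbound n (\<lambda>vs. F (x + h) vs - F x vs - F' (h # vs)) (\<rho> h * norm h)"
proof -
  obtain \<rho> where \<rho>: "(\<rho> \<longlongrightarrow> 0) (nhds 0)"
    "\<forall>\<^sub>F h in nhds 0. mbound n (\<lambda>vs. F (x + h) vs - F x vs - F' (h # vs)) (\<rho> h * norm h)"
    using assms unfolding mderiv_def by blast
  show thesis
  proof (rule that[of "\<lambda>h. \<bar>\<rho> h\<bar>"])
    show "((\<lambda>h. \<bar>\<rho> h\<bar>) \<longlongrightarrow> 0) (nhds 0)" using \<rho>(1) by (rule tendsto_rabs_zero)
    show "\<forall>\<^sub>F h in nhds 0. mbound n (\<lambda>vs. F (x + h) vs - F x vs - F' (h # vs)) (\<bar>\<rho> h\<bar> * norm h)"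
      using \<rho>(2) by eventually_elim (auto elim!: mbound_mono intro: mult_right_mono)
  qed simp
qed

lemma norm_tendsto_nhds_0: "(norm \<longlongrightarrow> 0) (nhds (0::'x::real_normed_vector))"
  using filterlim_ident[of "nhds (0::'x)"] by (rule tendsto_norm_zero)

lemma eventually_shift_in_open:
  fixes x :: "'x::real_normed_vector"
  assumes "open U" "x \<in> U" shows "\<forall>\<^sub>F h in nhds 0. x + h \<in> U"
proof -
  have "((\<lambda>h. x + h) \<longlongrightarrow> x + 0) (nhds 0)" by (intro tendsto_intros filterlim_ident)
  then show ?thesis using assms by (simp add: tendsto_def)
qed

lemma mderiv_imp_increment_bound:
  assumes "mderiv n F F' x" "mlin (Suc n) F'"
  obtains \<sigma> K where "(\<sigma> \<longlongrightarrow> K) (nhds 0)" "\<forall>h. 0 \<le> \<sigma> h"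
    "\<forall>\<^sub>F h in nhds 0. mbound n (\<lambda>vs. F (x + h) vs - F x vs) (\<sigma> h * norm h)"
proof -
  obtain \<rho> where \<rho>: "(\<rho> \<longlongrightarrow> 0) (nhds 0)" "\<forall>h. 0 \<le> \<rho> h"
    "\<forall>\<^sub>F h in nhds 0. mbound n (\<lambda>vs. F (x + h) vs - F x vs - F' (h # vs)) (\<rho> h * norm h)"
    by (rule mderivE[OF assms(1)])
  obtain K where K: "K > 0" "mbound (Suc n) F' K" by (rule mlin_bound[OF assms(2)])
  show thesis
  proof (rule that[of "\<lambda>h. \<rho> h + K" K])
    show "((\<lambda>h. \<rho> h + K) \<longlongrightarrow> K) (nhds 0)" using \<rho>(1) by (auto intro!: tendsto_eq_intros)
    show "\<forall>h. 0 \<le> \<rho> h + K" using \<rho>(2) K by (simp add: add_nonneg_nonneg less_imp_le)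
    show "\<forall>\<^sub>F h in nhds 0. mbound n (\<lambda>vs. F (x + h) vs - F x vs) ((\<rho> h + K) * norm h)"
      using \<rho>(3)
    proof eventually_elim
      case (elim h)
      show ?case using mbound_add[OF elim mbound_Cons[OF K(2), of h]] by (simp add: distrib_right)
    qed
  qed
qed

lemma mderiv_imp_mcont:
  assumes "mderiv n F F' x" "mlin (Suc n) F'" shows "mcont n F x"
proof -
  obtain \<sigma> K where \<sigma>: "(\<sigma> \<longlongrightarrow> K) (nhds 0)" "\<forall>h. 0 \<le> \<sigma> h"
    "\<forall>\<^sub>F h in nhds 0. mbound n (\<lambda>vs. F (x + h) vs - F x vs) (\<sigma> h * norm h)"
    by (rule mderiv_imp_increment_bound[OF assms])
  show ?thesis
    by (rule mcontI[OF _ \<sigma>(3)]) (use tendsto_mult[OF \<sigma>(1) norm_tendsto_nhds_0] in simp)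
qed

lemma smooth_mlin: "smooth k n U F \<Longrightarrow> x \<in> U \<Longrightarrow> mlin n (F x)"
  by (cases k) auto

lemma smooth_Suc_imp: "smooth (Suc k) n U F \<Longrightarrow> smooth k n U F"
proof (induction k arbitrary: n F)
  case 0
  then show ?case using mderiv_imp_mcont by fastforce
next
  case (Suc k)
  obtain F' where F': "\<forall>x\<in>U. mderiv n F (F' x) x" "smooth (Suc k) (Suc n) U F'" "\<forall>x\<in>U. mlin n (F x)"
    using Suc.prems unfolding smooth.simps(2)[of "Suc k"] by blast
  show ?case unfolding smooth.simps(2)[of k] using F' Suc.IH by blast
qed

lemma smooth_antimono: "smooth k n U F \<Longrightarrow> j \<le> k \<Longrightarrow> smooth j n U F"
proof (induction k)
  case (Suc k)
  then show ?case by (metis le_SucE smooth_Suc_imp)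
qed simp

lemma smooth_mcont: "smooth k n U F \<Longrightarrow> x \<in> U \<Longrightarrow> mcont n F x"
  using smooth_antimono[of k n U F 0] by simp

lemma mderiv_cong:
  assumes "open U" "x \<in> U" "\<And>y vs. y \<in> U \<Longrightarrow> length vs = n \<Longrightarrow> F y vs = G y vs"
    "\<And>ws. length ws = Suc n \<Longrightarrow> F' ws = G' ws" "mderiv n F F' x"
  shows "mderiv n G G' x"
proof -
  obtain \<rho> where \<rho>: "(\<rho> \<longlongrightarrow> 0) (nhds 0)"
    "\<forall>\<^sub>F h in nhds 0. mbound n (\<lambda>vs. F (x + h) vs - F x vs - F' (h # vs)) (\<rho> h * norm h)"
    using assms(5) unfolding mderiv_def by blast
  show ?thesis
  proof (rule mderivI[OF \<rho>(1)])
    show "\<forall>\<^sub>F h in nhds 0. mbound n (\<lambda>vs. G (x + h) vs - G x vs - G' (h # vs)) (\<rho> h * norm h)"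
      using \<rho>(2) eventually_shift_in_open[OF assms(1,2)]
      by eventually_elim (use assms(2-4) in \<open>auto simp: mbound_def\<close>)
  qed
qed

lemma mcont_cong:
  assumes "open U" "x \<in> U" "\<And>y vs. y \<in> U \<Longrightarrow> length vs = n \<Longrightarrow> F y vs = G y vs" "mcont n F x"
  shows "mcont n G x"
proof -
  obtain \<rho> where \<rho>: "(\<rho> \<longlongrightarrow> 0) (nhds 0)"
    "\<forall>\<^sub>F h in nhds 0. mbound n (\<lambda>vs. F (x + h) vs - F x vs) (\<rho> h)"
    using assms(4) unfolding mcont_def by blast
  show ?thesis
  proof (rule mcontI[OF \<rho>(1)])
    show "\<forall>\<^sub>F h in nhds 0. mbound n (\<lambda>vs. G (x + h) vs - G x vs) (\<rho> h)"
      using \<rho>(2) eventually_shift_in_open[OF assms(1,2)]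
      by eventually_elim (use assms(2-3) in \<open>auto simp: mbound_def\<close>)
  qed
qed

lemma smooth_cong:
  assumes "open U" "\<And>x vs. x \<in> U \<Longrightarrow> length vs = n \<Longrightarrow> F x vs = G x vs" "smooth k n U F"
  shows "smooth k n U G"
proof (cases k)
  case 0
  have "mlin n (G x) \<and> mcont n G x" if "x \<in> U" for x
  proof
    show "mlin n (G x)" by (rule mlin_cong[of n "F x"]) (use assms that 0 in auto)
    show "mcont n G x" by (rule mcont_cong[of U x n F]) (use assms that 0 in auto)
  qed
  then show ?thesis using 0 by simp
next
  case (Suc j)
  obtain F' where F': "\<forall>x\<in>U. mderiv n F (F' x) x" "smooth j (Suc n) U F'" using assms(3) Suc by auto
  have "mlin n (G x) \<and> mderiv n G (F' x) x" if "x \<in> U" for x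
  proof
    show "mlin n (G x)" by (rule mlin_cong[of n "F x"]) (use assms that Suc in auto)
    show "mderiv n G (F' x) x" by (rule mderiv_cong[of U x n F]) (use assms that F' in auto)
  qed
  then show ?thesis using Suc F' by auto
qed

lemma smooth_add_scaleR:
  "smooth k n U F \<Longrightarrow> smooth k n U G \<Longrightarrow> smooth k n U (\<lambda>x vs. F x vs + c *\<^sub>R G x vs)"
proof (induction k arbitrary: n F G)
  case 0
  have F0: "mcont n F x" and G0: "mcont n G x" if "x \<in> U" for x using 0 that by auto
  have "mcont n (\<lambda>x vs. F x vs + c *\<^sub>R G x vs) x" if xU: "x \<in> U" for x
  proof -
    obtain \<rho> where \<rho>: "(\<rho> \<longlongrightarrow> 0) (nhds 0)" "\<forall>\<^sub>F h in nhds 0. mbound n (\<lambda>vs. F (x + h) vs - F x vs) (\<rho> h)"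
      using F0[OF xU] unfolding mcont_def by blast
    obtain \<sigma> where \<sigma>: "(\<sigma> \<longlongrightarrow> 0) (nhds 0)" "\<forall>\<^sub>F h in nhds 0. mbound n (\<lambda>vs. G (x + h) vs - G x vs) (\<sigma> h)"
      using G0[OF xU] unfolding mcont_def by blast
    show ?thesis
    proof (rule mcontI[of "\<lambda>h. \<rho> h + \<bar>c\<bar> * \<sigma> h"])
      show "((\<lambda>h. \<rho> h + \<bar>c\<bar> * \<sigma> h) \<longlongrightarrow> 0) (nhds 0)" using \<rho>(1) \<sigma>(1) by (auto intro!: tendsto_eq_intros)
      show "\<forall>\<^sub>F h in nhds 0. mbound n (\<lambda>vs. F (x + h) vs + c *\<^sub>R G (x + h) vs - (F x vs + c *\<^sub>R G x vs)) (\<rho> h + \<bar>c\<bar> * \<sigma> h)"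
        using \<rho>(2) \<sigma>(2)
      proof eventually_elim
        case (elim h)
        show ?case using mbound_add[OF elim(1) mbound_scaleR[OF elim(2), of c]]
          by (simp add: algebra_simps)
      qed
    qed
  qed
  then show ?case using 0 by (simp add: mlin_add_scaleR)
next
  case (Suc k)
  obtain F' G' where F': "\<forall>x\<in>U. mderiv n F (F' x) x" "smooth k (Suc n) U F'"
    and G': "\<forall>x\<in>U. mderiv n G (G' x) x" "smooth k (Suc n) U G'" using Suc.prems by auto
  have "mderiv n (\<lambda>x vs. F x vs + c *\<^sub>R G x vs) (\<lambda>vs. F' x vs + c *\<^sub>R G' x vs) x" if xU: "x \<in> U" for x
  proof -
    obtain \<rho> where \<rho>: "(\<rho> \<longlongrightarrow> 0) (nhds 0)" "\<forall>\<^sub>F h in nhds 0. mbound n (\<lambda>vs. F (x + h) vs - F x vs - F' x (h # vs)) (\<rho> h * norm h)"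
      using bspec[OF F'(1) xU] unfolding mderiv_def by blast
    obtain \<sigma> where \<sigma>: "(\<sigma> \<longlongrightarrow> 0) (nhds 0)" "\<forall>\<^sub>F h in nhds 0. mbound n (\<lambda>vs. G (x + h) vs - G x vs - G' x (h # vs)) (\<sigma> h * norm h)"
      using bspec[OF G'(1) xU] unfolding mderiv_def by blast
    show ?thesis
    proof (rule mderivI[of "\<lambda>h. \<rho> h + \<bar>c\<bar> * \<sigma> h"])
      show "((\<lambda>h. \<rho> h + \<bar>c\<bar> * \<sigma> h) \<longlongrightarrow> 0) (nhds 0)" using \<rho>(1) \<sigma>(1) by (auto intro!: tendsto_eq_intros)
      show "\<forall>\<^sub>F h in nhds 0. mbound n (\<lambda>vs. F (x + h) vs + c *\<^sub>R G (x + h) vs - (F x vs + c *\<^sub>R G x vs)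
          - (F' x (h # vs) + c *\<^sub>R G' x (h # vs))) ((\<rho> h + \<bar>c\<bar> * \<sigma> h) * norm h)"
        using \<rho>(2) \<sigma>(2)
      proof eventually_elim
        case (elim h)
        show ?case using mbound_add[OF elim(1) mbound_scaleR[OF elim(2), of c]]
          by (simp add: algebra_simps)
      qed
    qed
  qed
  moreover have "smooth k (Suc n) U (\<lambda>x vs. F' x vs + c *\<^sub>R G' x vs)" using Suc.IH F' G' by blast
  ultimately show ?case using Suc.prems by (auto simp: mlin_add_scaleR intro!: exI[of _ "\<lambda>x vs. F' x vs + c *\<^sub>R G' x vs"])
qed

lemma smooth_add: "smooth k n U F \<Longrightarrow> smooth k n U G \<Longrightarrow> smooth k n U (\<lambda>x vs. F x vs + G x vs)"
  using smooth_add_scaleR[of k n U F G 1] by simp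

lemma smooth_diff: "smooth k n U F \<Longrightarrow> smooth k n U G \<Longrightarrow> smooth k n U (\<lambda>x vs. F x vs - G x vs)"
  using smooth_add_scaleR[of k n U F G "-1"] by simp

section \<open>The product rule for contractions\<close>

text \<open>
  The only product needed is the insertion of the value of a multilinear map \<open>u\<close> into an argument
  place of a multilinear map \<open>P\<close>. A word of slots says for each argument whether it goes to \<open>u\<close>, or
  to \<open>P\<close> before or after the value of \<open>u\<close>. Differentiation prepends a direction to the arguments of
  \<open>P\<close> or of \<open>u\<close>, that is, the letter \<open>Before\<close> or \<open>Inner\<close> to the word. Hence the product rule does
  not leave this format and no arguments have to be permuted.
\<close>

datatype slot = Before | Inner | After

fun sel :: "slot \<Rightarrow> slot list \<Rightarrow> 'a list \<Rightarrow> 'a list" where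
  "sel c (a # m) (v # vs) = (if a = c then v # sel c m vs else sel c m vs)"
| "sel c _ _ = []"

definition contract :: "slot list \<Rightarrow> ('x list \<Rightarrow> 'y) \<Rightarrow> ('x list \<Rightarrow> 'x) \<Rightarrow> 'x list \<Rightarrow> 'y" where
  "contract m P u vs = P (sel Before m vs @ u (sel Inner m vs) # sel After m vs)"

abbreviation outer :: "slot list \<Rightarrow> nat" where
  "outer m \<equiv> count_list m Before + count_list m After"

abbreviation inner_arity :: "slot list \<Rightarrow> nat" where
  "inner_arity m \<equiv> count_list m Inner"

lemma length_sel: "length m = length vs \<Longrightarrow> length (sel c m vs) = count_list m c"
  by (induction m vs rule: list_induct2) auto

lemma prod_list_sel:
  "length m = length vs \<Longrightarrow> norms vs =
     norms (sel Before m vs) * norms (sel Inner m vs) * norms (sel After m vs)"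
proof (induction m vs rule: list_induct2)
  case (Cons a m v vs)
  then show ?case by (cases a) auto
qed simp

lemma sel_append: "length m = length vs \<Longrightarrow> sel c (m @ m') (vs @ ws) = sel c m vs @ sel c m' ws"
  by (induction m vs rule: list_induct2) auto

lemma sel_replicate: "length vs = n \<Longrightarrow> sel c (replicate n d) vs = (if c = d then vs else [])"
  by (induction vs arbitrary: n) auto

lemma count_list_replicate: "count_list (replicate n a) b = (if a = b then n else 0)"
  by (induction n) auto

lemma mbound_contract:
  assumes P: "mbound (Suc (outer m)) P K" and u: "mbound (inner_arity m) u L" and "K \<ge> 0"
  shows "mbound (length m) (contract m P u) (K * L)"
  unfolding mbound_def
proof (intro allI impI)
  fix vs :: "'a list" assume l: "length vs = length m"
  let ?p = "\<lambda>c. norms (sel c m vs)"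
  have "norm (contract m P u vs) \<le> K * (?p Before * (norm (u (sel Inner m vs)) * ?p After))"
    using mboundD[OF P, of "sel Before m vs @ u (sel Inner m vs) # sel After m vs"] l
    by (simp add: contract_def length_sel)
  also have "\<dots> \<le> K * (?p Before * ((L * ?p Inner) * ?p After))"
    using mboundD[OF u, of "sel Inner m vs"] l assms(3)
    by (intro mult_left_mono mult_right_mono) (auto simp: length_sel)
  also have "\<dots> = K * L * norms vs" using l by (simp add: prod_list_sel[of m vs])
  finally show "norm (contract m P u vs) \<le> K * L * norms vs" .
qed

lemma mlin_contract:
  assumes P: "mlin (Suc (outer m)) P" and u: "mlin (inner_arity m) u"
  shows "mlin (length m) (contract m P u)"
  unfolding mlin_def
proof (intro conjI allI impI)
  obtain K where "K > 0" "mbound (Suc (outer m)) P K" by (rule mlin_bound[OF P])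
  moreover obtain L where "mbound (inner_arity m) u L" using u by (auto simp: mlin_def)
  ultimately show "\<exists>K. mbound (length m) (contract m P u) K" using mbound_contract[of m P K u L] by auto
next
  fix xs ys :: "'a list" assume l: "Suc (length xs + length ys) = length m"
  define m1 a m2 where "m1 = take (length xs) m" and "a = m ! length xs" and "m2 = drop (Suc (length xs)) m"
  have m: "m = m1 @ a # m2" using l unfolding m1_def a_def m2_def by (simp add: id_take_nth_drop)
  have l1: "length m1 = length xs" "length m2 = length ys" using l unfolding m1_def m2_def by auto
  note s = m contract_def sel_append[OF l1(1)] sel_append[OF l1(1), of _ _ "_ # _"]
  note ls = length_sel[OF l1(1)] length_sel[OF l1(2)]
  show "linear (\<lambda>h. contract m P u (xs @ h # ys))"
  proof (cases a)
    case Before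
    then show ?thesis
      using mlin_slot[OF P, of "sel Before m1 xs" "sel Before m2 ys @ u (sel Inner m1 xs @ sel Inner m2 ys) # sel After m1 xs @ sel After m2 ys"]
      by (simp add: s ls)
  next
    case Inner
    have 1: "linear (\<lambda>h. u (sel Inner m1 xs @ h # sel Inner m2 ys))"
      using Inner by (intro mlin_slot[OF u]) (simp add: s ls)
    have 2: "linear (\<lambda>h. P ((sel Before m1 xs @ sel Before m2 ys) @ h # sel After m1 xs @ sel After m2 ys))"
      using Inner by (intro mlin_slot[OF P]) (simp add: s ls)
    show ?thesis using linear_compose[OF 1 2] Inner by (simp add: s o_def)
  next
    case After
    then show ?thesis
      using mlin_slot[OF P, of "sel Before m1 xs @ sel Before m2 ys @ u (sel Inner m1 xs @ sel Inner m2 ys) # sel After m1 xs" "sel After m2 ys"]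
      by (simp add: s ls)
  qed
qed

lemma contract_diff_right:
  assumes "mlin (Suc (outer m)) P" "length vs = length m"
  shows "contract m P (\<lambda>ws. u ws - v ws) vs = contract m P u vs - contract m P v vs"
  unfolding contract_def
  by (rule linear_diff, rule mlin_slot[OF assms(1)]) (use assms(2) in \<open>simp add: length_sel\<close>)

lemma contract_Before_Cons: "contract (Before # m) P u (h # vs) = contract m (\<lambda>ws. P (h # ws)) u vs"
  by (simp add: contract_def)

lemma contract_Inner_Cons: "contract (Inner # m) P u (h # vs) = contract m P (\<lambda>ws. u (h # ws)) vs"
  by (simp add: contract_def)

lemma mcont_bound:
  assumes "mcont n u x" "mlin n (u x)"
  obtains \<tau> L where "(\<tau> \<longlongrightarrow> L) (nhds 0)" "\<forall>h. 0 \<le> \<tau> h" "\<forall>\<^sub>F h in nhds 0. mbound n (u (x + h)) (\<tau> h)"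
proof -
  obtain \<sigma> where \<sigma>: "(\<sigma> \<longlongrightarrow> 0) (nhds 0)" "\<forall>h. 0 \<le> \<sigma> h" "\<forall>\<^sub>F h in nhds 0. mbound n (\<lambda>vs. u (x + h) vs - u x vs) (\<sigma> h)"
    by (rule mcontE[OF assms(1)])
  obtain L where L: "L > 0" "mbound n (u x) L" by (rule mlin_bound[OF assms(2)])
  show thesis
  proof (rule that[of "\<lambda>h. \<sigma> h + L" L])
    show "((\<lambda>h. \<sigma> h + L) \<longlongrightarrow> L) (nhds 0)" using \<sigma>(1) by (auto intro!: tendsto_eq_intros)
    show "\<forall>h. 0 \<le> \<sigma> h + L" using \<sigma>(2) L by (simp add: add_nonneg_nonneg less_imp_le)
    show "\<forall>\<^sub>F h in nhds 0. mbound n (u (x + h)) (\<sigma> h + L)"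
      using \<sigma>(3)
    proof eventually_elim
      case (elim h)
      show ?case using mbound_add[OF elim L(2)] by simp
    qed
  qed
qed

lemma mcont_contract:
  assumes P: "mlin (Suc (outer m)) (P x)" "mcont (Suc (outer m)) P x"
    and u: "mlin (inner_arity m) (u x)" "mcont (inner_arity m) u x"
  shows "mcont (length m) (\<lambda>x. contract m (P x) (u x)) x"
proof -
  obtain \<rho> where \<rho>: "(\<rho> \<longlongrightarrow> 0) (nhds 0)" "\<forall>h. 0 \<le> \<rho> h"
    "\<forall>\<^sub>F h in nhds 0. mbound (Suc (outer m)) (\<lambda>vs. P (x + h) vs - P x vs) (\<rho> h)"
    by (rule mcontE[OF P(2)])
  obtain \<sigma> where \<sigma>: "(\<sigma> \<longlongrightarrow> 0) (nhds 0)" "\<forall>h. 0 \<le> \<sigma> h"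
    "\<forall>\<^sub>F h in nhds 0. mbound (inner_arity m) (\<lambda>vs. u (x + h) vs - u x vs) (\<sigma> h)"
    by (rule mcontE[OF u(2)])
  obtain \<tau> L where \<tau>: "(\<tau> \<longlongrightarrow> L) (nhds 0)" "\<forall>h. 0 \<le> \<tau> h" "\<forall>\<^sub>F h in nhds 0. mbound (inner_arity m) (u (x + h)) (\<tau> h)"
    by (rule mcont_bound[OF u(2,1)])
  obtain K where K: "K > 0" "mbound (Suc (outer m)) (P x) K" by (rule mlin_bound[OF P(1)])
  show ?thesis
  proof (rule mcontI[of "\<lambda>h. \<rho> h * \<tau> h + K * \<sigma> h"])
    show "((\<lambda>h. \<rho> h * \<tau> h + K * \<sigma> h) \<longlongrightarrow> 0) (nhds 0)" using \<rho>(1) \<sigma>(1) \<tau>(1) by (auto intro!: tendsto_eq_intros)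
    show "\<forall>\<^sub>F h in nhds 0. mbound (length m) (\<lambda>vs. contract m (P (x + h)) (u (x + h)) vs - contract m (P x) (u x) vs)
        (\<rho> h * \<tau> h + K * \<sigma> h)"
      using \<rho>(3) \<sigma>(3) \<tau>(3)
    proof eventually_elim
      case (elim h)
      have "mbound (length m) (\<lambda>vs. contract m (\<lambda>vs. P (x + h) vs - P x vs) (u (x + h)) vs
          + contract m (P x) (\<lambda>vs. u (x + h) vs - u x vs) vs) (\<rho> h * \<tau> h + K * \<sigma> h)"
        using elim K \<rho>(2) by (intro mbound_add mbound_contract) auto
      then show ?case
        by (rule mbound_cong[THEN iffD1, rotated])
          (simp_all only: contract_diff_right[OF P(1)], simp add: contract_def)
    qed
  qed
qed

text \<open>
  The increment of the product is split as
  \<open>(\<Delta>P - P' h)(u(x + h)) + (P' h)(\<Delta>u) + P(x)(\<Delta>u - u' h)\<close>, where each term is \<open>o(h)\<close>.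
\<close>

lemma mderiv_contract:
  assumes P: "mlin (Suc (outer m)) (P x)" "mderiv (Suc (outer m)) P P' x" "mlin (Suc (Suc (outer m))) P'"
    and u: "mlin (inner_arity m) (u x)" "mderiv (inner_arity m) u u' x" "mlin (Suc (inner_arity m)) u'"
  shows "mderiv (length m) (\<lambda>x. contract m (P x) (u x))
    (\<lambda>vs. contract (Before # m) P' (u x) vs + contract (Inner # m) (P x) u' vs) x"
proof -
  note uc = mderiv_imp_mcont[OF u(2,3)]
  obtain \<rho> where \<rho>: "(\<rho> \<longlongrightarrow> 0) (nhds 0)" "\<forall>h. 0 \<le> \<rho> h"
    "\<forall>\<^sub>F h in nhds 0. mbound (Suc (outer m)) (\<lambda>vs. P (x + h) vs - P x vs - P' (h # vs)) (\<rho> h * norm h)"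
    by (rule mderivE[OF P(2)])
  obtain \<sigma> where \<sigma>: "(\<sigma> \<longlongrightarrow> 0) (nhds 0)" "\<forall>h. 0 \<le> \<sigma> h"
    "\<forall>\<^sub>F h in nhds 0. mbound (inner_arity m) (\<lambda>vs. u (x + h) vs - u x vs) (\<sigma> h)"
    by (rule mcontE[OF uc])
  obtain \<tau> L where \<tau>: "(\<tau> \<longlongrightarrow> L) (nhds 0)" "\<forall>h. 0 \<le> \<tau> h" "\<forall>\<^sub>F h in nhds 0. mbound (inner_arity m) (u (x + h)) (\<tau> h)"
    by (rule mcont_bound[OF uc u(1)])
  obtain \<kappa> where \<kappa>: "(\<kappa> \<longlongrightarrow> 0) (nhds 0)" "\<forall>h. 0 \<le> \<kappa> h"
    "\<forall>\<^sub>F h in nhds 0. mbound (inner_arity m) (\<lambda>vs. u (x + h) vs - u x vs - u' (h # vs)) (\<kappa> h * norm h)"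
    by (rule mderivE[OF u(2)])
  obtain K where K: "K > 0" "mbound (Suc (outer m)) (P x) K" by (rule mlin_bound[OF P(1)])
  obtain K' where K': "K' > 0" "mbound (Suc (Suc (outer m))) P' K'" by (rule mlin_bound[OF P(3)])
  have P'lin: "mlin (Suc (outer m)) (\<lambda>ws. P' (h # ws))" for h
    using mlin_slot[OF P(3), of "h # _"] mbound_Cons[OF K'(2)] unfolding mlin_def by auto
  show ?thesis
  proof (rule mderivI[of "\<lambda>h. \<rho> h * \<tau> h + K' * \<sigma> h + K * \<kappa> h"])
    show "((\<lambda>h. \<rho> h * \<tau> h + K' * \<sigma> h + K * \<kappa> h) \<longlongrightarrow> 0) (nhds 0)"
      using \<rho>(1) \<sigma>(1) \<tau>(1) \<kappa>(1) by (auto intro!: tendsto_eq_intros)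
    show "\<forall>\<^sub>F h in nhds 0. mbound (length m) (\<lambda>vs. contract m (P (x + h)) (u (x + h)) vs - contract m (P x) (u x) vs
         - (contract (Before # m) P' (u x) (h # vs) + contract (Inner # m) (P x) u' (h # vs)))
        ((\<rho> h * \<tau> h + K' * \<sigma> h + K * \<kappa> h) * norm h)"
      using \<rho>(3) \<sigma>(3) \<tau>(3) \<kappa>(3)
    proof eventually_elim
      case (elim h)
      have bd: "mbound (length m) (\<lambda>vs. contract m (\<lambda>vs. P (x + h) vs - P x vs - P' (h # vs)) (u (x + h)) vs
          + contract m (\<lambda>vs. P' (h # vs)) (\<lambda>vs. u (x + h) vs - u x vs) vs
          + contract m (P x) (\<lambda>vs. u (x + h) vs - u x vs - u' (h # vs)) vs)
          ((\<rho> h * norm h) * \<tau> h + (K' * norm h) * \<sigma> h + K * (\<kappa> h * norm h))"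
        using elim K K' \<rho>(2) mbound_Cons[OF K'(2), of h] by (intro mbound_add mbound_contract) auto
      have eq: "(\<rho> h * norm h) * \<tau> h + (K' * norm h) * \<sigma> h + K * (\<kappa> h * norm h)
        = (\<rho> h * \<tau> h + K' * \<sigma> h + K * \<kappa> h) * norm h" by (simp add: algebra_simps)
      show ?case using bd unfolding eq
        by (rule mbound_cong[THEN iffD1, rotated])
          (simp_all only: contract_diff_right[OF P(1)] contract_diff_right[OF P'lin] contract_Before_Cons contract_Inner_Cons, simp add: contract_def)
    qed
  qed
qed

text \<open>
  Both terms of the derivative are contractions again, with one order of differentiability less.
\<close>

lemma smooth_contract:
  "smooth k (Suc (outer m)) U P \<Longrightarrow> smooth k (inner_arity m) U u \<Longrightarrow> 
   smooth k (length m) U (\<lambda>x. contract m (P x) (u x))"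
proof (induction k arbitrary: m P u)
  case 0
  then show ?case by (simp add: mlin_contract mcont_contract)
next
  case (Suc k)
  obtain P' u' where P': "\<forall>x\<in>U. mderiv (Suc (outer m)) P (P' x) x" "smooth k (Suc (Suc (outer m))) U P'"
    and u': "\<forall>x\<in>U. mderiv (inner_arity m) u (u' x) x" "smooth k (Suc (inner_arity m)) U u'"
    using Suc.prems by auto
  have "smooth k (length (Before # m)) U (\<lambda>x. contract (Before # m) (P' x) (u x))"
    using P'(2) smooth_Suc_imp[OF Suc.prems(2)] by (intro Suc.IH) auto
  moreover have "smooth k (length (Inner # m)) U (\<lambda>x. contract (Inner # m) (P x) (u' x))"
    using u'(2) smooth_Suc_imp[OF Suc.prems(1)] by (intro Suc.IH) auto
  ultimately have "smooth k (Suc (length m)) U (\<lambda>x vs. contract (Before # m) (P' x) (u x) vs + contract (Inner # m) (P x) (u' x) vs)"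
    using smooth_add by fastforce
  moreover have "mderiv (length m) (\<lambda>x. contract m (P x) (u x))
    (\<lambda>vs. contract (Before # m) (P' x) (u x) vs + contract (Inner # m) (P x) (u' x) vs) x" if "x \<in> U" for x
    using that P' u' Suc.prems smooth_mlin[OF P'(2)] smooth_mlin[OF u'(2)] by (intro mderiv_contract) auto
  moreover have "mlin (length m) (contract m (P x) (u x))" if "x \<in> U" for x
    using that Suc.prems by (intro mlin_contract) auto
  ultimately show ?case unfolding smooth.simps(2)
    by (intro conjI ballI exI[of _ "\<lambda>x vs. contract (Before # m) (P' x) (u x) vs + contract (Inner # m) (P x) (u' x) vs"])
qed

section \<open>Composition\<close>

lemma filterlim_mcont_increment:
  fixes g :: "'x::real_normed_vector \<Rightarrow> 'y::real_normed_vector"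
  assumes "mcont 0 (\<lambda>x _. g x) x"
  shows "((\<lambda>h. g (x + h) - g x) \<longlongrightarrow> 0) (nhds 0)"
proof -
  obtain \<rho> where \<rho>: "(\<rho> \<longlongrightarrow> 0) (nhds 0)" "\<forall>h. 0 \<le> \<rho> h"
    "\<forall>\<^sub>F h in nhds 0. mbound 0 (\<lambda>vs :: 'x list. g (x + h) - g x) (\<rho> h)"
    by (rule mcontE[OF assms])
  have "\<forall>\<^sub>F h in nhds 0. norm (g (x + h) - g x) \<le> \<rho> h"
    using \<rho>(3) by eventually_elim (simp add: mbound_def)
  then show ?thesis using \<rho>(1) by (rule Lim_null_comparison)
qed

lemma mcont_compose:
  assumes A: "mcont n A (g x)" and g: "mcont 0 (\<lambda>x _. g x) x"
  shows "mcont n (\<lambda>x. A (g x)) x"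
proof -
  note gl = filterlim_mcont_increment[OF g]
  obtain \<rho> where \<rho>: "(\<rho> \<longlongrightarrow> 0) (nhds 0)" "\<forall>h. 0 \<le> \<rho> h"
    "\<forall>\<^sub>F k in nhds 0. mbound n (\<lambda>vs. A (g x + k) vs - A (g x) vs) (\<rho> k)"
    by (rule mcontE[OF A])
  show ?thesis
  proof (rule mcontI)
    show "((\<lambda>h. \<rho> (g (x + h) - g x)) \<longlongrightarrow> 0) (nhds 0)" by (rule filterlim_compose[OF \<rho>(1) gl])
    show "\<forall>\<^sub>F h in nhds 0. mbound n (\<lambda>vs. A (g (x + h)) vs - A (g x) vs) (\<rho> (g (x + h) - g x))"
      using eventually_compose_filterlim[OF \<rho>(3) gl] by simp
  qed
qed

lemma mderiv_compose:
  fixes g :: "'x::real_normed_vector \<Rightarrow> 'x"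
  assumes A: "mderiv n A A' (g x)" "mlin (Suc n) A'"
    and g: "mderiv 0 (\<lambda>x _. g x) g' x" "mlin 1 g'"
  shows "mderiv n (\<lambda>x. A (g x)) (\<lambda>vs. contract (Inner # replicate n After) A' g' vs) x"
proof -
  have gl: "((\<lambda>h. g (x + h) - g x) \<longlongrightarrow> 0) (nhds 0)"
    using g by (intro filterlim_mcont_increment mderiv_imp_mcont) auto
  obtain \<rho> where \<rho>: "(\<rho> \<longlongrightarrow> 0) (nhds 0)" "\<forall>h. 0 \<le> \<rho> h"
    "\<forall>\<^sub>F k in nhds 0. mbound n (\<lambda>vs. A (g x + k) vs - A (g x) vs - A' (k # vs)) (\<rho> k * norm k)"
    by (rule mderivE[OF A(1)])
  obtain \<sigma> where \<sigma>: "(\<sigma> \<longlongrightarrow> 0) (nhds 0)" "\<forall>h. 0 \<le> \<sigma> h"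
    "\<forall>\<^sub>F h in nhds 0. mbound 0 (\<lambda>vs :: 'x list. g (x + h) - g x - g' (h # vs)) (\<sigma> h * norm h)"
    by (rule mderivE[OF g(1)])
  obtain \<tau> L where \<tau>: "(\<tau> \<longlongrightarrow> L) (nhds 0)" "\<forall>h. 0 \<le> \<tau> h"
    "\<forall>\<^sub>F h in nhds 0. mbound 0 (\<lambda>vs :: 'x list. g (x + h) - g x) (\<tau> h * norm h)"
    by (rule mderiv_imp_increment_bound[OF g(1) g(2)[unfolded One_nat_def]])
  obtain K where K: "K > 0" "mbound (Suc n) A' K" by (rule mlin_bound[OF A(2)])
  let ?k = "\<lambda>h. g (x + h) - g x"
  show ?thesis
  proof (rule mderivI)
    have "((\<lambda>h. \<rho> (?k h)) \<longlongrightarrow> 0) (nhds 0)" by (rule filterlim_compose[OF \<rho>(1) gl])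
    then show "((\<lambda>h. \<rho> (?k h) * \<tau> h + K * \<sigma> h) \<longlongrightarrow> 0) (nhds 0)"
      using \<tau>(1) \<sigma>(1) by (auto intro!: tendsto_eq_intros)
    show "\<forall>\<^sub>F h in nhds 0. mbound n (\<lambda>vs. A (g (x + h)) vs - A (g x) vs
        - contract (Inner # replicate n After) A' g' (h # vs)) ((\<rho> (?k h) * \<tau> h + K * \<sigma> h) * norm h)"
      using eventually_compose_filterlim[OF \<rho>(3) gl] \<sigma>(3) \<tau>(3)
    proof eventually_elim
      case (elim h)
      have k1: "norm (?k h) \<le> \<tau> h * norm h" and k2: "norm (?k h - g' [h]) \<le> \<sigma> h * norm h"
        using elim(2,3) by (simp_all add: mbound_def)
      have "mbound n (\<lambda>vs. (A (g x + ?k h) vs - A (g x) vs - A' (?k h # vs)) + A' ((?k h - g' [h]) # vs))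
        (\<rho> (?k h) * norm (?k h) + K * norm (?k h - g' [h]))"
        by (intro mbound_add elim(1) mbound_Cons K(2))
      then have 1: "mbound n (\<lambda>vs. A (g (x + h)) vs - A (g x) vs - A' (g' [h] # vs))
        (\<rho> (?k h) * norm (?k h) + K * norm (?k h - g' [h]))"
        by (rule mbound_cong[THEN iffD1, rotated]) (simp add: linear_diff[OF mlin_head[OF A(2)]])
      have "\<rho> (?k h) * norm (?k h) + K * norm (?k h - g' [h]) \<le> \<rho> (?k h) * (\<tau> h * norm h) + K * (\<sigma> h * norm h)"
        using k1 k2 K(1) \<rho>(2) by (intro add_mono mult_left_mono) auto
      then have "mbound n (\<lambda>vs. A (g (x + h)) vs - A (g x) vs - A' (g' [h] # vs))
        ((\<rho> (?k h) * \<tau> h + K * \<sigma> h) * norm h)"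
        by (intro mbound_mono[OF 1]) (simp add: algebra_simps)
      then show ?case
        by (rule mbound_cong[THEN iffD1, rotated]) (simp add: contract_def sel_replicate)
    qed
  qed
qed

text \<open>
  The derivative of \<open>A \<circ> g\<close> is \<open>A' \<circ> g\<close> contracted with \<open>g'\<close> in its first argument, so the
  induction step is an instance of \<open>smooth_contract\<close>.
\<close>

lemma smooth_compose:
  "smooth k n V A \<Longrightarrow> smooth k 0 U (\<lambda>x _. g x) \<Longrightarrow> g ` U \<subseteq> V \<Longrightarrow> smooth k n U (\<lambda>x. A (g x))"
proof (induction k arbitrary: n A)
  case 0
  then show ?case using mcont_compose[of n A g] by (auto simp: image_subset_iff)
next
  case (Suc k)
  obtain A' where A': "\<forall>x\<in>V. mderiv n A (A' x) x" "smooth k (Suc n) V A'" using Suc.prems by auto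
  obtain g' where g': "\<forall>x\<in>U. mderiv 0 (\<lambda>x _. g x) (g' x) x" "smooth k 1 U g'" using Suc.prems by auto
  let ?m = "Inner # replicate n After"
  have c: "outer ?m = n" "inner_arity ?m = 1" "length ?m = Suc n" by (simp_all add: count_list_replicate)
  have "smooth k (Suc n) U (\<lambda>x. A' (g x))"
    using Suc.IH[OF A'(2) smooth_Suc_imp[OF Suc.prems(2)] Suc.prems(3)] .
  then have "smooth k (length ?m) U (\<lambda>x. contract ?m (A' (g x)) (g' x))"
    using g'(2) by (intro smooth_contract) (simp_all only: c)
  moreover have "mderiv n (\<lambda>x. A (g x)) (\<lambda>vs. contract ?m (A' (g x)) (g' x) vs) x" if "x \<in> U" for x
    using that A' g' Suc.prems(3) smooth_mlin[OF A'(2)] smooth_mlin[OF g'(2)]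
    by (intro mderiv_compose) auto
  moreover have "mlin n (A (g x))" if "x \<in> U" for x
    using smooth_mlin[OF Suc.prems(1)] Suc.prems(3) that by auto
  ultimately show ?case unfolding smooth.simps(2) c
    by (intro conjI ballI exI[of _ "\<lambda>x. contract ?m (A' (g x)) (g' x)"])
qed

section \<open>Equations with an injective operator of closed range\<close>

lemma closed_range_bounded_below:
  fixes P :: "'x::banach \<Rightarrow> 'y::real_normed_vector"
  assumes "bounded_linear P" "c > 0" "\<And>v. c * norm v \<le> norm (P v)"
  shows "closed (range P)"
  using complete_isometric_image[of c UNIV P] assms by (simp add: complete_imp_closed complete_UNIV)

lemma tendsto_scaled_nhds_0:
  fixes h :: "'x::real_normed_vector"
  shows "filterlim (\<lambda>t::real. t *\<^sub>R h) (nhds 0) (at_right 0)"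
proof -
  have "((\<lambda>t::real. t *\<^sub>R h) \<longlongrightarrow> 0 *\<^sub>R h) (at_right 0)" by (intro tendsto_intros)
  then show ?thesis by simp
qed

text \<open>
  If \<open>P (\<Delta> h)\<close> is differentiable at \<open>h = 0\<close> with derivative \<open>R\<close>, then so is \<open>\<Delta>\<close>, although \<open>P\<close> has no
  continuous linear left inverse in general: \<open>R\<close> is a limit of the quotients \<open>P (\<Delta> (t h) / t)\<close>, so it
  takes its values in the range of \<open>P\<close>, which is closed. There \<open>P\<close> can be inverted, and the bound
  from below carries the error estimate over to \<open>\<Delta>\<close>.
\<close>

lemma mderiv_lift:
  fixes P :: "'x::banach \<Rightarrow> 'y::banach" and \<Delta> :: "'x \<Rightarrow> 'x list \<Rightarrow> 'x"
  assumes P: "bounded_linear P" and c: "c > 0" "\<And>v. c * norm v \<le> norm (P v)"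
    and R: "mlin (Suc n) R" and \<rho>: "(\<rho> \<longlongrightarrow> 0) (nhds 0)"
    and \<Delta>: "\<forall>\<^sub>F h in nhds 0. mbound n (\<lambda>vs. P (\<Delta> h vs) - R (h # vs)) (\<rho> h * norm h)"
  obtains Q where "mlin (Suc n) Q" "\<forall>vs. length vs = Suc n \<longrightarrow> P (Q vs) = R vs"
    "\<forall>\<^sub>F h in nhds 0. mbound n (\<lambda>vs. \<Delta> h vs - Q (h # vs)) (\<rho> h / c * norm h)"
proof -
  interpret P: bounded_linear P by fact
  have inj: "inj P"
  proof (rule injI)
    fix v w assume "P v = P w"
    then have "c * norm (v - w) \<le> 0" using c(2)[of "v - w"] by (simp add: P.diff)
    then show "v = w" using c(1) by (simp add: mult_le_0_iff)
  qed
  have range: "R (h # vs) \<in> range P" if l: "length vs = n" for h vs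
  proof (rule Lim_in_closed_set[OF closed_range_bounded_below[OF P c]])
    let ?f = "\<lambda>t. P ((1 / t) *\<^sub>R \<Delta> (t *\<^sub>R h) vs)"
    show "\<forall>\<^sub>F t in at_right 0. ?f t \<in> range P" by simp
    show "\<not> trivial_limit (at_right (0::real))" by simp
    have "\<forall>\<^sub>F t in at_right 0. norm (?f t - R (h # vs)) \<le> \<rho> (t *\<^sub>R h) * norm h * norms vs"
      using eventually_compose_filterlim[OF \<Delta> tendsto_scaled_nhds_0, of h] eventually_at_right_less[of 0]
    proof eventually_elim
      case (elim t)
      have "R (t *\<^sub>R h # vs) = t *\<^sub>R R (h # vs)" using linear_scale[OF mlin_head[OF R l]] by simp
      then have "?f t - R (h # vs) = (1 / t) *\<^sub>R (P (\<Delta> (t *\<^sub>R h) vs) - R (t *\<^sub>R h # vs))"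
        using elim(2) by (simp add: P.scaleR algebra_simps)
      also have "norm \<dots> \<le> (1 / t) * (\<rho> (t *\<^sub>R h) * norm (t *\<^sub>R h) * norms vs)"
        using mult_left_mono[OF mboundD[OF elim(1) l], of "1 / t"] elim(2) by simp
      also have "\<dots> = \<rho> (t *\<^sub>R h) * norm h * norms vs" using elim(2) by simp
      finally show ?case .
    qed
    moreover have "((\<lambda>t. \<rho> (t *\<^sub>R h) * norm h * norms vs) \<longlongrightarrow> 0) (at_right 0)"
      using filterlim_compose[OF \<rho> tendsto_scaled_nhds_0, of h] by (auto intro!: tendsto_eq_intros)
    ultimately show "(?f \<longlongrightarrow> R (h # vs)) (at_right 0)"
      by (subst Lim_null) (rule Lim_null_comparison)
  qed
  define Q where "Q vs = inv P (R vs)" for vs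
  have PQ: "P (Q vs) = R vs" if "length vs = Suc n" for vs
  proof (cases vs)
    case (Cons h ws)
    then show ?thesis using range[of ws h] that by (simp add: Q_def f_inv_into_f)
  qed (use that in simp)
  obtain K where K: "K > 0" "mbound (Suc n) R K" by (rule mlin_bound[OF R])
  have "mlin (Suc n) Q"
    unfolding mlin_def
  proof (intro conjI allI impI exI)
    fix xs ys :: "'x list" assume l: "Suc (length xs + length ys) = Suc n"
    note Rl = mlin_slot[OF R l]
    show "linear (\<lambda>h. Q (xs @ h # ys))"
      by (rule linearI; rule injD[OF inj])
        (use l in \<open>simp_all add: PQ P.add P.scaleR linear_add[OF Rl] linear_scale[OF Rl]\<close>)
  next
    show "mbound (Suc n) Q (K / c)"
      unfolding mbound_def
    proof (intro allI impI)
      fix vs :: "'x list" assume l: "length vs = Suc n"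
      have "c * norm (Q vs) \<le> K * norms vs"
        using c(2)[of "Q vs"] mboundD[OF K(2) l] PQ[OF l] by simp
      then show "norm (Q vs) \<le> K / c * norms vs" using c(1) by (simp add: field_simps)
    qed
  qed
  moreover have "\<forall>\<^sub>F h in nhds 0. mbound n (\<lambda>vs. \<Delta> h vs - Q (h # vs)) (\<rho> h / c * norm h)"
    using \<Delta>
  proof eventually_elim
    case (elim h)
    show ?case unfolding mbound_def
    proof (intro allI impI)
      fix vs :: "'x list" assume l: "length vs = n"
      have "c * norm (\<Delta> h vs - Q (h # vs)) \<le> \<rho> h * norm h * norms vs"
        using c(2)[of "\<Delta> h vs - Q (h # vs)"] mboundD[OF elim l] l by (simp add: P.diff PQ)
      then show "norm (\<Delta> h vs - Q (h # vs)) \<le> \<rho> h / c * norm h * norms vs"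
        using c(1) by (simp add: field_simps)
    qed
  qed
  ultimately show thesis using PQ that by blast
qed

lemma mlin_1_bounded_linear:
  assumes "mlin 1 A" shows "bounded_linear (\<lambda>v. A [v])"
proof -
  obtain K where "K > 0" "mbound 1 A K" by (rule mlin_bound[OF assms])
  then have "norm (A [v]) \<le> norm v * K" for v using mboundD[of 1 A K "[v]"] by (simp add: mult.commute)
  then show ?thesis
    using mlin_slot[OF assms, of "[]" "[]"] by (intro bounded_linear.intro bounded_linear_axioms.intro) auto
qed

lemma contract_replicate_Inner: "length vs = n \<Longrightarrow> contract (replicate n Inner) P u vs = P [u vs]"
  by (simp add: contract_def sel_replicate)

text \<open>
  Continuity follows from
  \<open>P(x + h) (u(x + h) - u(x)) = \<Delta>(P u) - (\<Delta>P) (u(x))\<close> and the lower bound of \<open>P(x + h)\<close>, which is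
  uniform in \<open>h\<close>.
\<close>

lemma mcont_divide:
  fixes u :: "'x::banach \<Rightarrow> 'x list \<Rightarrow> 'x" and P :: "'x \<Rightarrow> 'x list \<Rightarrow> 'y::banach"
  assumes U: "open U" "x \<in> U" and P: "\<And>x. x \<in> U \<Longrightarrow> mlin 1 (P x)" "mcont 1 P x"
    and c: "c > 0" "\<And>x v. x \<in> U \<Longrightarrow> c * norm v \<le> norm (P x [v])"
    and u: "mlin n (u x)" and R: "mcont n (\<lambda>x vs. P x [u x vs]) x"
  shows "mcont n u x"
proof -
  obtain \<rho> where \<rho>: "(\<rho> \<longlongrightarrow> 0) (nhds 0)" "\<forall>h. 0 \<le> \<rho> h"
    "\<forall>\<^sub>F h in nhds 0. mbound 1 (\<lambda>vs. P (x + h) vs - P x vs) (\<rho> h)"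
    by (rule mcontE[OF P(2)])
  obtain \<sigma> where \<sigma>: "(\<sigma> \<longlongrightarrow> 0) (nhds 0)" "\<forall>h. 0 \<le> \<sigma> h"
    "\<forall>\<^sub>F h in nhds 0. mbound n (\<lambda>vs. P (x + h) [u (x + h) vs] - P x [u x vs]) (\<sigma> h)"
    by (rule mcontE[OF R])
  obtain L where L: "L > 0" "mbound n (u x) L" by (rule mlin_bound[OF u])
  show ?thesis
  proof (rule mcontI[of "\<lambda>h. (\<sigma> h + \<rho> h * L) / c"])
    show "((\<lambda>h. (\<sigma> h + \<rho> h * L) / c) \<longlongrightarrow> 0) (nhds 0)"
      using \<rho>(1) \<sigma>(1) c(1) by (auto intro!: tendsto_eq_intros)
    show "\<forall>\<^sub>F h in nhds 0. mbound n (\<lambda>vs. u (x + h) vs - u x vs) ((\<sigma> h + \<rho> h * L) / c)"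
      using \<rho>(3) \<sigma>(3) eventually_shift_in_open[OF U]
    proof eventually_elim
      case (elim h)
      show ?case unfolding mbound_def
      proof (intro allI impI)
        fix vs :: "'x list" assume l: "length vs = n"
        interpret Ph: bounded_linear "\<lambda>v. P (x + h) [v]" by (rule mlin_1_bounded_linear[OF P(1)[OF elim(3)]])
        let ?p = "norms vs"
        have "c * norm (u (x + h) vs - u x vs) \<le> norm (P (x + h) [u (x + h) vs - u x vs])"
          using c(2)[OF elim(3)] .
        also have "P (x + h) [u (x + h) vs - u x vs] =
          (P (x + h) [u (x + h) vs] - P x [u x vs]) - (P (x + h) [u x vs] - P x [u x vs])"
          by (simp add: Ph.diff)
        also have "norm \<dots> \<le> \<sigma> h * ?p + \<rho> h * norm (u x vs)"
          using mboundD[OF elim(2) l] mboundD[OF elim(1), of "[u x vs]"]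
          by (intro order_trans[OF norm_triangle_ineq4 add_mono]) auto
        also have "\<dots> \<le> \<sigma> h * ?p + \<rho> h * (L * ?p)"
          using mboundD[OF L(2) l] \<rho>(2) by (intro add_left_mono mult_left_mono) auto
        finally show "norm (u (x + h) vs - u x vs) \<le> (\<sigma> h + \<rho> h * L) / c * ?p"
          using c(1) by (simp add: field_simps)
      qed
    qed
  qed
qed

text \<open>
  By induction on \<open>k\<close>. From
  \<open>P(x) (\<Delta>u) = \<Delta>(P u) - (\<Delta>P) (u(x + h))\<close> and \<open>mderiv_lift\<close>, \<open>u\<close> has a derivative \<open>u'\<close> with
  \<open>P(x) u'(x) = (P u)'(x) - P'(x) u(x)\<close>. The right-hand side has one order of differentiability less,
  so the induction hypothesis applies to \<open>u'\<close>.
\<close>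

lemma smooth_divide:
  fixes u :: "'x::banach \<Rightarrow> 'x list \<Rightarrow> 'x" and P :: "'x \<Rightarrow> 'x list \<Rightarrow> 'y::banach"
  assumes U: "open U" and c: "c > 0" "\<And>x v. x \<in> U \<Longrightarrow> c * norm v \<le> norm (P x [v])"
  shows "smooth k 1 U P \<Longrightarrow> (\<And>x. x \<in> U \<Longrightarrow> mlin n (u x)) \<Longrightarrow>
    smooth k n U (\<lambda>x vs. P x [u x vs]) \<Longrightarrow> smooth k n U u"
proof (induction k arbitrary: n u)
  case 0
  have "mcont n u x" if "x \<in> U" for x
    by (rule mcont_divide[OF U that _ _ c]) (use 0 that in auto)
  then show ?case using 0 by simp
next
  case (Suc k)
  let ?m = "Before # replicate n Inner"
  have m: "outer ?m = 1" "inner_arity ?m = n" "length ?m = Suc n" by (simp_all add: count_list_replicate)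
  obtain P' where P': "\<forall>x\<in>U. mderiv 1 P (P' x) x" "smooth k 2 U P'"
    using Suc.prems(1) by (auto simp: numeral_2_eq_2)
  obtain R' where R': "\<forall>x\<in>U. mderiv n (\<lambda>x vs. P x [u x vs]) (R' x) x" "smooth k (Suc n) U R'"
    using Suc.prems(3) by auto
  have us: "smooth k n U u"
    by (rule Suc.IH[OF smooth_Suc_imp[OF Suc.prems(1)] Suc.prems(2) smooth_Suc_imp[OF Suc.prems(3)]])
  \<comment> \<open>The right-hand side of the equation for the derivative of \<open>u\<close>; the word \<open>Before\<close> followed by
      \<open>Inner\<close>s puts the direction into \<open>P'\<close> and all other arguments into \<open>u\<close>.\<close>
  define T where "T x vs = R' x vs - contract ?m (P' x) (u x) vs" for x vs
  have T: "smooth k (Suc n) U T"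
  proof -
    have "smooth k (length ?m) U (\<lambda>x. contract ?m (P' x) (u x))"
      by (rule smooth_contract) (use P'(2) us in \<open>simp_all only: m numeral_2_eq_2 One_nat_def\<close>)
    then show ?thesis unfolding T_def using smooth_diff[OF R'(2)] by (simp only: m)
  qed
  have ex: "\<exists>Q. mlin (Suc n) Q \<and> (\<forall>vs. length vs = Suc n \<longrightarrow> P x [Q vs] = T x vs) \<and> mderiv n u Q x"
    if x: "x \<in> U" for x
  proof -
    note Plin = smooth_mlin[OF Suc.prems(1) x]
    interpret Px: bounded_linear "\<lambda>v. P x [v]" by (rule mlin_1_bounded_linear[OF Plin])
    obtain \<rho> where \<rho>: "(\<rho> \<longlongrightarrow> 0) (nhds 0)" "\<forall>h. 0 \<le> \<rho> h"
      "\<forall>\<^sub>F h in nhds 0. mbound 1 (\<lambda>vs. P (x + h) vs - P x vs - P' x (h # vs)) (\<rho> h * norm h)"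
      by (rule mderivE[OF bspec[OF P'(1) x]])
    obtain \<sigma> where \<sigma>: "(\<sigma> \<longlongrightarrow> 0) (nhds 0)" "\<forall>h. 0 \<le> \<sigma> h"
      "\<forall>\<^sub>F h in nhds 0. mbound n (\<lambda>vs. P (x + h) [u (x + h) vs] - P x [u x vs] - R' x (h # vs)) (\<sigma> h * norm h)"
      by (rule mderivE[OF bspec[OF R'(1) x]])
    obtain \<kappa> where \<kappa>: "(\<kappa> \<longlongrightarrow> 0) (nhds 0)" "\<forall>h. 0 \<le> \<kappa> h"
      "\<forall>\<^sub>F h in nhds 0. mbound n (\<lambda>vs. u (x + h) vs - u x vs) (\<kappa> h)"
      by (rule mcontE[OF smooth_mcont[OF us x]])
    obtain \<tau> L where \<tau>: "(\<tau> \<longlongrightarrow> L) (nhds 0)" "\<forall>h. 0 \<le> \<tau> h" "\<forall>\<^sub>F h in nhds 0. mbound n (u (x + h)) (\<tau> h)"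
      by (rule mcont_bound[OF smooth_mcont[OF us x] Suc.prems(2)[OF x]])
    obtain K where K: "K > 0" "mbound 2 (P' x) K" by (rule mlin_bound[OF smooth_mlin[OF P'(2) x]])
    define \<eta> where "\<eta> h = \<sigma> h + \<rho> h * \<tau> h + K * \<kappa> h" for h
    have \<eta>: "(\<eta> \<longlongrightarrow> 0) (nhds 0)"
      unfolding \<eta>_def using \<rho>(1) \<sigma>(1) \<tau>(1) \<kappa>(1) by (auto intro!: tendsto_eq_intros)
    have "\<forall>\<^sub>F h in nhds 0. mbound n (\<lambda>vs. P x [u (x + h) vs - u x vs] - T x (h # vs)) (\<eta> h * norm h)"
      using \<rho>(3) \<sigma>(3) \<tau>(3) \<kappa>(3)
    proof eventually_elim
      case (elim h)
      show ?case unfolding mbound_def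
      proof (intro allI impI)
        fix vs :: "'x list" assume l: "length vs = n"
        let ?p = "norms vs" and ?d = "u (x + h) vs - u x vs"
        have lin: "linear (\<lambda>v. P' x [h, v])"
          using mlin_slot[OF smooth_mlin[OF P'(2) x], of "[h]" "[]"] by simp
        have "P x [?d] - T x (h # vs) =
          (P (x + h) [u (x + h) vs] - P x [u x vs] - R' x (h # vs))
          - (P (x + h) [u (x + h) vs] - P x [u (x + h) vs] - P' x [h, u (x + h) vs]) - P' x [h, ?d]"
          using l by (simp add: T_def Px.diff linear_diff[OF lin] contract_Before_Cons contract_replicate_Inner)
        also have "norm \<dots> \<le> \<sigma> h * norm h * ?p + \<rho> h * norm h * norm (u (x + h) vs) + K * (norm h * norm ?d)"
          using mboundD[OF elim(2) l] mboundD[OF elim(1), of "[u (x + h) vs]"] mboundD[OF K(2), of "[h, ?d]"]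
          by (intro order_trans[OF norm_triangle_ineq4 add_mono[OF order_trans[OF norm_triangle_ineq4 add_mono]]]) auto
        also have "\<dots> \<le> \<sigma> h * norm h * ?p + \<rho> h * norm h * (\<tau> h * ?p) + K * (norm h * (\<kappa> h * ?p))"
          using mboundD[OF elim(3) l] mboundD[OF elim(4) l] \<rho>(2) \<sigma>(2) K(1)
          by (intro add_mono mult_left_mono) auto
        also have "\<dots> = \<eta> h * norm h * ?p" by (simp add: \<eta>_def algebra_simps)
        finally show "norm (P x [?d] - T x (h # vs)) \<le> \<eta> h * norm h * ?p" .
      qed
    qed
    from mderiv_lift[OF Px.bounded_linear_axioms c(1) c(2)[OF x] smooth_mlin[OF T x] \<eta> this]
    obtain Q where Q: "mlin (Suc n) Q" "\<forall>vs. length vs = Suc n \<longrightarrow> P x [Q vs] = T x vs"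
      "\<forall>\<^sub>F h in nhds 0. mbound n (\<lambda>vs. u (x + h) vs - u x vs - Q (h # vs)) (\<eta> h / c * norm h)" by blast
    have "mderiv n u Q x"
      by (rule mderivI[OF _ Q(3)]) (use tendsto_divide[OF \<eta> tendsto_const[of c]] c(1) in simp)
    then show ?thesis using Q by blast
  qed
  obtain u' where u': "\<And>x. x \<in> U \<Longrightarrow>
      mlin (Suc n) (u' x) \<and> (\<forall>vs. length vs = Suc n \<longrightarrow> P x [u' x vs] = T x vs) \<and> mderiv n u (u' x) x"
    using ex by metis
  have "smooth k (Suc n) U (\<lambda>x vs. P x [u' x vs])"
    by (rule smooth_cong[OF U _ T]) (use u' in simp)
  then have "smooth k (Suc n) U u'"
    using Suc.IH[OF smooth_Suc_imp[OF Suc.prems(1)]] u' by blast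
  then show ?case unfolding smooth.simps(2) using u' Suc.prems(2) by blast
qed

text \<open>
  The first derivative of \<open>g\<close> is obtained from \<open>mderiv_lift\<close>, as \<open>g\<close> is Lipschitz at each point.
  After that \<open>Dg\<close> is the solution of a linear equation whose operator is \<open>Df\<^sub>2 \<circ> g\<close>. If \<open>g\<close> is \<open>C\<^sup>i\<close>,
  so is this operator, and by \<open>smooth_divide\<close> also \<open>Dg\<close>; thus \<open>g\<close> is one order better.
\<close>

lemma smooth_lift_immersion:
  fixes g :: "'x::banach \<Rightarrow> 'x" and f\<^sub>2 :: "'x \<Rightarrow> 'y::banach"
  assumes W: "open W" and V: "open V" and g: "g ` W \<subseteq> V"
    and c: "c > 0" "\<And>x y. x \<in> V \<Longrightarrow> y \<in> V \<Longrightarrow> c * norm (x - y) \<le> norm (f\<^sub>2 x - f\<^sub>2 y)"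
    and f\<^sub>2: "smooth (Suc K) 0 V (\<lambda>x _. f\<^sub>2 x)" and f\<^sub>1: "smooth (Suc K) 0 W (\<lambda>x _. f\<^sub>2 (g x))"
  shows "smooth (Suc K) 0 W (\<lambda>x _. g x)"
proof -
  obtain A where A: "\<forall>x\<in>V. mderiv 0 (\<lambda>x _. f\<^sub>2 x) (A x) x" "smooth K 1 V A" using f\<^sub>2 by auto
  obtain R where R: "\<forall>x\<in>W. mderiv 0 (\<lambda>x _. f\<^sub>2 (g x)) (R x) x" "smooth K 1 W R" using f\<^sub>1 by auto
  \<comment> \<open>The lower bound of \<open>f\<^sub>2\<close> passes to its derivative in the limit of difference quotients.\<close>
  have below: "c * norm v \<le> norm (A y [v])" if y: "y \<in> V" for y v
  proof -
    interpret Ay: bounded_linear "\<lambda>v. A y [v]" by (rule mlin_1_bounded_linear[OF smooth_mlin[OF A(2) y]])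
    obtain \<rho> where \<rho>: "(\<rho> \<longlongrightarrow> 0) (nhds 0)" "\<forall>h. 0 \<le> \<rho> h"
      "\<forall>\<^sub>F h in nhds 0. mbound 0 (\<lambda>vs :: 'x list. f\<^sub>2 (y + h) - f\<^sub>2 y - A y (h # vs)) (\<rho> h * norm h)"
      by (rule mderivE[OF bspec[OF A(1) y]])
    have ev: "\<forall>\<^sub>F t in at_right 0. c * norm v \<le> norm (A y [v]) + \<rho> (t *\<^sub>R v) * norm v"
      using eventually_compose_filterlim[OF \<rho>(3) tendsto_scaled_nhds_0, of v] eventually_at_right_less[of 0]
        eventually_compose_filterlim[OF eventually_shift_in_open[OF V y] tendsto_scaled_nhds_0, of v]
    proof eventually_elim
      case (elim t)
      have "t * (c * norm v) \<le> norm (f\<^sub>2 (y + t *\<^sub>R v) - f\<^sub>2 y)"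
        using c(2)[OF elim(3) y] elim(2) by (simp add: mult.left_commute)
      also have "\<dots> \<le> norm (A y [t *\<^sub>R v]) + norm (f\<^sub>2 (y + t *\<^sub>R v) - f\<^sub>2 y - A y [t *\<^sub>R v])"
        by (metis add_diff_cancel_left' diff_add_cancel norm_triangle_ineq add.commute)
      also have "\<dots> \<le> t * norm (A y [v]) + \<rho> (t *\<^sub>R v) * (t * norm v)"
        using mboundD[OF elim(1), of "[]"] elim(2) by (simp add: Ay.scaleR)
      also have "\<dots> = t * (norm (A y [v]) + \<rho> (t *\<^sub>R v) * norm v)" by (simp add: algebra_simps)
      finally show ?case using elim(2) by simp
    qed
    have "((\<lambda>t. norm (A y [v]) + \<rho> (t *\<^sub>R v) * norm v) \<longlongrightarrow> norm (A y [v])) (at_right 0)"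
      using filterlim_compose[OF \<rho>(1) tendsto_scaled_nhds_0, of v] by (auto intro!: tendsto_eq_intros)
    then show ?thesis by (rule tendsto_lowerbound[OF _ ev]) simp
  qed
  have ex: "\<exists>Q. mlin 1 Q \<and> (\<forall>vs. length vs = 1 \<longrightarrow> A (g x) [Q vs] = R x vs) \<and> mderiv 0 (\<lambda>x _. g x) Q x"
    if x: "x \<in> W" for x
  proof -
    have gx: "g x \<in> V" using g x by auto
    note Rlin = smooth_mlin[OF R(2) x]
    interpret Ax: bounded_linear "\<lambda>v. A (g x) [v]" by (rule mlin_1_bounded_linear[OF smooth_mlin[OF A(2) gx]])
    obtain \<rho> where \<rho>: "(\<rho> \<longlongrightarrow> 0) (nhds 0)" "\<forall>h. 0 \<le> \<rho> h"
      "\<forall>\<^sub>F k in nhds 0. mbound 0 (\<lambda>vs :: 'x list. f\<^sub>2 (g x + k) - f\<^sub>2 (g x) - A (g x) (k # vs)) (\<rho> k * norm k)"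
      by (rule mderivE[OF bspec[OF A(1) gx]])
    obtain \<sigma> where \<sigma>: "(\<sigma> \<longlongrightarrow> 0) (nhds 0)" "\<forall>h. 0 \<le> \<sigma> h"
      "\<forall>\<^sub>F h in nhds 0. mbound 0 (\<lambda>vs :: 'x list. f\<^sub>2 (g (x + h)) - f\<^sub>2 (g x) - R x (h # vs)) (\<sigma> h * norm h)"
      by (rule mderivE[OF bspec[OF R(1) x]])
    obtain \<tau> L where \<tau>: "(\<tau> \<longlongrightarrow> L) (nhds 0)" "\<forall>h. 0 \<le> \<tau> h"
      "\<forall>\<^sub>F h in nhds 0. mbound 0 (\<lambda>vs :: 'x list. f\<^sub>2 (g (x + h)) - f\<^sub>2 (g x)) (\<tau> h * norm h)"
      by (rule mderiv_imp_increment_bound[OF bspec[OF R(1) x] Rlin[unfolded One_nat_def]])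
    let ?k = "\<lambda>h. g (x + h) - g x"
    have lip: "\<forall>\<^sub>F h in nhds 0. norm (?k h) \<le> \<tau> h * norm h / c"
      using \<tau>(3) eventually_shift_in_open[OF W x]
    proof eventually_elim
      case (elim h)
      have "c * norm (?k h) \<le> \<tau> h * norm h"
        using c(2)[of "g (x + h)" "g x"] mboundD[OF elim(1), of "[]"] g elim(2) gx by auto
      then show ?case using c(1) by (simp add: field_simps)
    qed
    have gl: "(?k \<longlongrightarrow> 0) (nhds 0)"
    proof (rule Lim_null_comparison[OF lip])
      show "((\<lambda>h. \<tau> h * norm h / c) \<longlongrightarrow> 0) (nhds 0)"
        using tendsto_divide[OF tendsto_mult[OF \<tau>(1) norm_tendsto_nhds_0] tendsto_const[of c]] c(1) by simp
    qed
    define \<eta> where "\<eta> h = \<rho> (?k h) * \<tau> h / c + \<sigma> h" for h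
    have \<eta>: "(\<eta> \<longlongrightarrow> 0) (nhds 0)"
      unfolding \<eta>_def using filterlim_compose[OF \<rho>(1) gl] \<sigma>(1) \<tau>(1) c(1) by (auto intro!: tendsto_eq_intros)
    have "\<forall>\<^sub>F h in nhds 0. mbound 0 (\<lambda>vs :: 'x list. A (g x) [?k h] - R x (h # vs)) (\<eta> h * norm h)"
      using eventually_compose_filterlim[OF \<rho>(3) gl] \<sigma>(3) lip
    proof eventually_elim
      case (elim h)
      have "A (g x) [?k h] - R x [h] = (f\<^sub>2 (g (x + h)) - f\<^sub>2 (g x) - R x [h])
          - (f\<^sub>2 (g x + ?k h) - f\<^sub>2 (g x) - A (g x) [?k h])" by simp
      also have "norm \<dots> \<le> \<sigma> h * norm h + \<rho> (?k h) * norm (?k h)"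
        using mboundD[OF elim(2), of "[]"] mboundD[OF elim(1), of "[]"]
        by (intro order_trans[OF norm_triangle_ineq4 add_mono]) auto
      also have "\<dots> \<le> \<sigma> h * norm h + \<rho> (?k h) * (\<tau> h * norm h / c)"
        using elim(3) \<rho>(2) \<sigma>(2) by (intro add_mono mult_left_mono) auto
      also have "\<dots> = \<eta> h * norm h" by (simp add: \<eta>_def algebra_simps)
      finally show ?case by (simp add: mbound_def)
    qed
    from mderiv_lift[OF Ax.bounded_linear_axioms c(1) below[OF gx] Rlin[unfolded One_nat_def] \<eta> this]
    obtain Q where Q: "mlin 1 Q" "\<forall>vs. length vs = 1 \<longrightarrow> A (g x) [Q vs] = R x vs"
      "\<forall>\<^sub>F h in nhds 0. mbound 0 (\<lambda>vs :: 'x list. ?k h - Q (h # vs)) (\<eta> h / c * norm h)" by auto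
    have "mderiv 0 (\<lambda>x _. g x) Q x"
      by (rule mderivI[OF _ Q(3)]) (use tendsto_divide[OF \<eta> tendsto_const[of c]] c(1) in simp)
    then show ?thesis using Q by blast
  qed
  obtain g' where g': "\<And>x. x \<in> W \<Longrightarrow>
      mlin 1 (g' x) \<and> (\<forall>vs. length vs = 1 \<longrightarrow> A (g x) [g' x vs] = R x vs) \<and> mderiv 0 (\<lambda>x _. g x) (g' x) x"
    using ex by metis
  have lin0: "mlin 0 (\<lambda>_ :: 'x list. g x)" for x by (auto simp: mlin_def mbound_def)
  have "smooth i 0 W (\<lambda>x _. g x)" if "i \<le> Suc K" for i
    using that
  proof (induction i)
    case 0
    have "mcont 0 (\<lambda>x _. g x) x" if "x \<in> W" for x
      using g'[OF that] by (intro mderiv_imp_mcont[of _ _ "g' x"]) auto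
    then show ?case using lin0 by simp
  next
    case (Suc i)
    have "smooth i 1 W (\<lambda>x. A (g x))"
      by (rule smooth_compose[OF smooth_antimono[OF A(2)] Suc.IH g]) (use Suc.prems in simp_all)
    moreover have "smooth i 1 W (\<lambda>x vs. A (g x) [g' x vs])"
      by (rule smooth_cong[OF W _ smooth_antimono[OF R(2)]]) (use g' Suc in simp_all)
    ultimately have "smooth i 1 W g'"
      by (intro smooth_divide[OF W c(1), where P = "\<lambda>x. A (g x)"]) (use g' below g in blast)+
    then show ?case unfolding smooth.simps(2) using g' lin0 by auto
  qed
  then show ?thesis by blast
qed

section \<open>Relation to \<open>Ck_on\<close>\<close>

lemma bounded_multilinear_on_slot_iff:
  "bounded_multilinear_on E j A \<longleftrightarrow>
     (\<forall>xs ys u v a b. Suc (length xs + length ys) = j \<longrightarrow> set xs \<subseteq> E \<longrightarrow> set ys \<subseteq> E \<longrightarrow> u \<in> E \<longrightarrow> v \<in> E \<longrightarrow>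
        A (xs @ (a *\<^sub>R u + b *\<^sub>R v) # ys) = a *\<^sub>R A (xs @ u # ys) + b *\<^sub>R A (xs @ v # ys)) \<and>
     (\<exists>K. \<forall>vs. length vs = j \<longrightarrow> set vs \<subseteq> E \<longrightarrow> norm (A vs) \<le> K * norms vs)"
  (is "_ \<longleftrightarrow> ?slot \<and> ?bound")
proof
  assume L: "bounded_multilinear_on E j A"
  have ?slot
  proof (intro allI impI)
    fix xs ys u v and a b :: real
    assume "Suc (length xs + length ys) = j" "set xs \<subseteq> E" "set ys \<subseteq> E" "u \<in> E" "v \<in> E"
    moreover have "A ((xs @ u # ys)[length xs := a *\<^sub>R u + b *\<^sub>R v])
      = a *\<^sub>R A ((xs @ u # ys)[length xs := u]) + b *\<^sub>R A ((xs @ u # ys)[length xs := v])"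
      using conjunct1[OF L[unfolded bounded_multilinear_on_def], rule_format, of "xs @ u # ys" "length xs" u v a b] calculation
      by auto
    ultimately show "A (xs @ (a *\<^sub>R u + b *\<^sub>R v) # ys) = a *\<^sub>R A (xs @ u # ys) + b *\<^sub>R A (xs @ v # ys)" by simp
  qed
  then show "?slot \<and> ?bound" using L unfolding bounded_multilinear_on_def by blast
next
  assume R: "?slot \<and> ?bound"
  show "bounded_multilinear_on E j A"
    unfolding bounded_multilinear_on_def
  proof (intro conjI allI impI ballI)
    fix vs i u v and a b :: real
    assume "length vs = j" "set vs \<subseteq> E" "i < j" "u \<in> E" "v \<in> E"
    moreover have "set (take i vs) \<subseteq> E" "set (drop (Suc i) vs) \<subseteq> E"
      using \<open>set vs \<subseteq> E\<close> set_take_subset set_drop_subset by fastforce+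
    ultimately show "A (vs[i := a *\<^sub>R u + b *\<^sub>R v]) = a *\<^sub>R A (vs[i := u]) + b *\<^sub>R A (vs[i := v])"
      using R by (simp add: upd_conv_take_nth_drop)
  qed (use R in blast)
qed

lemma bounded_multilinear_on_bound:
  assumes "bounded_multilinear_on E j A"
  obtains K where "\<forall>vs. length vs = j \<longrightarrow> set vs \<subseteq> E \<longrightarrow> norm (A vs) \<le> K * norms vs"
  using conjunct2[OF assms[unfolded bounded_multilinear_on_def]] by (rule exE)

lemma linear_iff_combination:
  "linear f \<longleftrightarrow> (\<forall>u v a b. f (a *\<^sub>R u + b *\<^sub>R v) = a *\<^sub>R f u + b *\<^sub>R f v)"
proof
  assume *: "\<forall>u v a b. f (a *\<^sub>R u + b *\<^sub>R v) = a *\<^sub>R f u + b *\<^sub>R f v"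
  have "f (u + v) = f u + f v" for u v using *[rule_format, of 1 u 1 v] by simp
  moreover have "f (a *\<^sub>R u) = a *\<^sub>R f u" for a u using *[rule_format, of a u 0 u] by simp
  ultimately show "linear f" by (rule linearI)
qed (auto simp: linear_add linear_scale)

lemma mlin_iff_bounded_multilinear_on: "mlin n A \<longleftrightarrow> bounded_multilinear_on UNIV n A"
  unfolding mlin_def mbound_def bounded_multilinear_on_slot_iff linear_iff_combination by auto

lemma prod_list_norm_le_1: "\<forall>v\<in>set vs. norm v \<le> 1 \<Longrightarrow> norms vs \<le> 1"
  by (induction vs) (auto intro: mult_le_one)

lemma multilinear_norm_le:
  assumes "0 \<in> E" "K \<ge> 0" "\<And>vs. length vs = j \<Longrightarrow> set vs \<subseteq> E \<Longrightarrow> norm (A vs) \<le> K * norms vs"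
  shows "0 \<le> multilinear_norm E j A" "multilinear_norm E j A \<le> K"
proof -
  let ?S = "{norm (A vs) | vs. length vs = j \<and> set vs \<subseteq> E \<and> (\<forall>v\<in>set vs. norm v \<le> 1)}"
  have K: "x \<le> K" if x: "x \<in> ?S" for x
  proof -
    obtain vs where "x = norm (A vs)" "length vs = j" "set vs \<subseteq> E" "\<forall>v\<in>set vs. norm v \<le> 1" using x by blast
    then show ?thesis
      using assms(3)[of vs] mult_left_mono[OF prod_list_norm_le_1[of vs] assms(2)] by simp
  qed
  have ne: "norm (A (replicate j 0)) \<in> ?S" using assms(1) by fastforce
  then show "multilinear_norm E j A \<le> K" unfolding multilinear_norm_def using K by (intro cSup_least) blast+
  have "norm (A (replicate j 0)) \<le> multilinear_norm E j A"
    unfolding multilinear_norm_def using ne K by (intro cSup_upper) (auto intro!: bdd_aboveI)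
  then show "0 \<le> multilinear_norm E j A" by (meson norm_ge_zero order_trans)
qed

lemma multilinear_norm_0: "multilinear_norm E 0 A = norm (A [])"
proof -
  have "{norm (A vs) | vs. length vs = 0 \<and> set vs \<subseteq> E \<and> (\<forall>v\<in>set vs. norm v \<le> 1)} = {norm (A [])}" by auto
  then show ?thesis by (simp add: multilinear_norm_def)
qed

lemma multilinear_norm_zero:
  fixes E :: "'e::real_normed_vector set"
  shows "0 \<in> E \<Longrightarrow> multilinear_norm E j (\<lambda>vs. 0 :: 'f::real_normed_vector) = 0"
  using multilinear_norm_le[of E 0 j "\<lambda>vs. 0 :: 'f"] by (simp add: order_antisym)

lemma bounded_multilinear_on_scale_all:
  assumes A: "bounded_multilinear_on E j A"
  shows "length xs + length ys = j \<Longrightarrow> set xs \<subseteq> E \<Longrightarrow> set ys \<subseteq> E \<Longrightarrow> (\<And>v. v \<in> E \<Longrightarrow> c v *\<^sub>R v \<in> E) \<Longrightarrow>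
    A (xs @ map (\<lambda>v. c v *\<^sub>R v) ys) = prod_list (map c ys) *\<^sub>R A (xs @ ys)"
proof (induction ys arbitrary: xs)
  case (Cons y ys)
  have "A ((xs @ [c y *\<^sub>R y]) @ map (\<lambda>v. c v *\<^sub>R v) ys) = prod_list (map c ys) *\<^sub>R A ((xs @ [c y *\<^sub>R y]) @ ys)"
    by (rule Cons.IH) (use Cons.prems in auto)
  moreover have "A (xs @ (c y *\<^sub>R y + 0 *\<^sub>R y) # ys) = c y *\<^sub>R A (xs @ y # ys) + 0 *\<^sub>R A (xs @ y # ys)"
    using conjunct1[OF A[unfolded bounded_multilinear_on_slot_iff], rule_format, of xs ys y y "c y" 0] Cons.prems
    by simp
  ultimately show ?case by (simp add: mult.commute)
qed simp

text \<open>
  Normalise all arguments and use homogeneity in each of them; if some argument is \<open>0\<close>, then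
  \<open>A vs = 0\<close> because \<open>A\<close> is bounded.
\<close>

lemma multilinear_norm_bound:
  assumes E: "subspace E" and A: "bounded_multilinear_on E j A" and vs: "length vs = j" "set vs \<subseteq> E"
  shows "norm (A vs) \<le> multilinear_norm E j A * norms vs"
proof -
  obtain K where K: "\<forall>vs. length vs = j \<longrightarrow> set vs \<subseteq> E \<longrightarrow> norm (A vs) \<le> K * norms vs"
    by (rule bounded_multilinear_on_bound[OF A])
  have "norms vs \<noteq> 0 \<or> A vs = 0" using K[rule_format, OF vs] by auto
  moreover have ?thesis if "norms vs \<noteq> 0"
  proof -
    let ?n = "\<lambda>v. (1 / norm v) *\<^sub>R v"
    have v0: "\<forall>v\<in>set vs. v \<noteq> 0" using that by (auto simp: prod_list_zero_iff)
    have "norm (A (map ?n vs)) \<le> multilinear_norm E j A"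
      unfolding multilinear_norm_def
    proof (rule cSup_upper)
      show "norm (A (map ?n vs)) \<in> {norm (A vs) |vs. length vs = j \<and> set vs \<subseteq> E \<and> (\<forall>v\<in>set vs. norm v \<le> 1)}"
        using vs v0 E by (intro CollectI exI[of _ "map ?n vs"]) (auto simp: subspace_scale)
      show "bdd_above {norm (A vs) |vs. length vs = j \<and> set vs \<subseteq> E \<and> (\<forall>v\<in>set vs. norm v \<le> 1)}"
      proof (rule bdd_aboveI[of _ "\<bar>K\<bar>"])
        fix x assume "x \<in> {norm (A vs) |vs. length vs = j \<and> set vs \<subseteq> E \<and> (\<forall>v\<in>set vs. norm v \<le> 1)}"
        then obtain ws where ws: "x = norm (A ws)" "length ws = j" "set ws \<subseteq> E" "\<forall>v\<in>set ws. norm v \<le> 1" by blast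
        have "K * norms ws \<le> \<bar>K\<bar> * 1"
          using prod_list_norm_le_1[OF ws(4)] by (intro mult_mono) auto
        then show "x \<le> \<bar>K\<bar>" using K[rule_format, OF ws(2,3)] ws(1) by simp
      qed
    qed
    moreover have "A ([] @ map ?n vs) = prod_list (map (\<lambda>v. 1 / norm v) vs) *\<^sub>R A ([] @ vs)"
      by (rule bounded_multilinear_on_scale_all[OF A]) (use vs E in \<open>auto simp: subspace_scale\<close>)
    moreover have "prod_list (map (\<lambda>v. 1 / norm v) vs) = 1 / norms vs"
      by (induction vs) auto
    moreover have "norms vs > 0" using that prod_list_norm_nonneg[of vs] by linarith
    ultimately show ?thesis by (simp add: field_simps)
  qed
  ultimately show ?thesis
  proof (elim disjE)
    assume "A vs = 0"
    then show ?thesis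
      by (cases "norms vs = 0")
        (use \<open>norms vs \<noteq> 0 \<Longrightarrow> ?thesis\<close> in auto)
  qed
qed

lemma bounded_multilinear_on_diff:
  assumes "bounded_multilinear_on E j A" "bounded_multilinear_on E j B"
  shows "bounded_multilinear_on E j (\<lambda>vs. A vs - B vs)"
proof -
  obtain K where K: "\<forall>vs. length vs = j \<longrightarrow> set vs \<subseteq> E \<longrightarrow> norm (A vs) \<le> K * norms vs"
    by (rule bounded_multilinear_on_bound[OF assms(1)])
  obtain L where L: "\<forall>vs. length vs = j \<longrightarrow> set vs \<subseteq> E \<longrightarrow> norm (B vs) \<le> L * norms vs"
    by (rule bounded_multilinear_on_bound[OF assms(2)])
  show ?thesis
    unfolding bounded_multilinear_on_slot_iff
  proof (intro conjI allI impI)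
    fix xs ys u v and a b :: real
    assume "Suc (length xs + length ys) = j" "set xs \<subseteq> E" "set ys \<subseteq> E" "u \<in> E" "v \<in> E"
    then have "A (xs @ (a *\<^sub>R u + b *\<^sub>R v) # ys) = a *\<^sub>R A (xs @ u # ys) + b *\<^sub>R A (xs @ v # ys)"
      "B (xs @ (a *\<^sub>R u + b *\<^sub>R v) # ys) = a *\<^sub>R B (xs @ u # ys) + b *\<^sub>R B (xs @ v # ys)"
      using assms unfolding bounded_multilinear_on_slot_iff by blast+
    then show "A (xs @ (a *\<^sub>R u + b *\<^sub>R v) # ys) - B (xs @ (a *\<^sub>R u + b *\<^sub>R v) # ys)
      = a *\<^sub>R (A (xs @ u # ys) - B (xs @ u # ys)) + b *\<^sub>R (A (xs @ v # ys) - B (xs @ v # ys))"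
      by (simp add: algebra_simps)
  next
    have "norm (A vs - B vs) \<le> (K + L) * norms vs" if "length vs = j" "set vs \<subseteq> E" for vs
      unfolding distrib_right
      by (rule order_trans[OF norm_triangle_ineq4 add_mono[OF K[rule_format, OF that] L[rule_format, OF that]]])
    then show "\<exists>K. \<forall>vs. length vs = j \<longrightarrow> set vs \<subseteq> E \<longrightarrow> norm (A vs - B vs) \<le> K * norms vs"
      by blast
  qed
qed

lemma bounded_multilinear_on_Cons:
  assumes "bounded_multilinear_on E (Suc j) A" "h \<in> E"
  shows "bounded_multilinear_on E j (\<lambda>vs. A (h # vs))"
  unfolding bounded_multilinear_on_slot_iff
proof (intro conjI allI impI)
  fix xs ys u v and a b :: real
  assume "Suc (length xs + length ys) = j" "set xs \<subseteq> E" "set ys \<subseteq> E" "u \<in> E" "v \<in> E"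
  then show "A (h # xs @ (a *\<^sub>R u + b *\<^sub>R v) # ys) = a *\<^sub>R A (h # xs @ u # ys) + b *\<^sub>R A (h # xs @ v # ys)"
    using conjunct1[OF assms(1)[unfolded bounded_multilinear_on_slot_iff], rule_format, of "h # xs" ys u v a b] assms(2)
    by simp
next
  obtain K where K: "\<forall>vs. length vs = Suc j \<longrightarrow> set vs \<subseteq> E \<longrightarrow> norm (A vs) \<le> K * norms vs"
    by (rule bounded_multilinear_on_bound[OF assms(1)])
  have "norm (A (h # vs)) \<le> (K * norm h) * norms vs" if "length vs = j" "set vs \<subseteq> E" for vs
    using K[rule_format, of "h # vs"] that assms(2) by (simp add: mult.assoc)
  then show "\<exists>K. \<forall>vs. length vs = j \<longrightarrow> set vs \<subseteq> E \<longrightarrow> norm (A (h # vs)) \<le> K * norms vs" by blast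
qed

lemma mbound_multilinear_norm:
  "bounded_multilinear_on UNIV n A \<Longrightarrow> mbound n A (multilinear_norm UNIV n A)"
  unfolding mbound_def using multilinear_norm_bound[of UNIV n A] by simp

lemma multilinear_norm_le_mbound:
  assumes "mbound n A K" "K \<ge> 0"
  shows "0 \<le> multilinear_norm UNIV n A" "multilinear_norm UNIV n A \<le> K"
  using multilinear_norm_le[of UNIV K n A] assms by (auto simp: mbound_def)

text \<open>
  The condition on the sequence of derivatives in \<open>Ck_on\<close>, apart from its relation to the function.
\<close>

definition successive_derivatives ::
  "enat \<Rightarrow> 'e::banach set \<Rightarrow> 'e set \<Rightarrow> (nat \<Rightarrow> 'e \<Rightarrow> 'e list \<Rightarrow> 'f::banach) \<Rightarrow> bool" where
  "successive_derivatives k E U D \<longleftrightarrow>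
     (\<forall>j. enat j \<le> k \<longrightarrow> (\<forall>x\<in>U. bounded_multilinear_on E j (D j x))) \<and>
     (\<forall>j. enat j < k \<longrightarrow> (\<forall>x\<in>U.
        ((\<lambda>h. multilinear_norm E j (\<lambda>vs. D j (x + h) vs - D j x vs - D (Suc j) x (h # vs)) / norm h)
           \<longlongrightarrow> 0) (at 0 within E))) \<and>
     (\<forall>j. enat j \<le> k \<longrightarrow> (\<forall>x\<in>U.
        ((\<lambda>y. multilinear_norm E j (\<lambda>vs. D j y vs - D j x vs)) \<longlongrightarrow> 0) (at x within E)))"

lemma Ck_on_iff_successive_derivatives:
  "Ck_on k E U f \<longleftrightarrow> (\<exists>D. (\<forall>x\<in>U. D 0 x [] = f x) \<and> successive_derivatives k E U D)"
  unfolding Ck_on_def successive_derivatives_def ..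

lemma Ck_on_subset_cong:
  assumes "Ck_on k E U f" "V \<subseteq> U" "\<And>x. x \<in> V \<Longrightarrow> f x = g x"
  shows "Ck_on k E V g"
proof -
  obtain D where D: "\<forall>x\<in>U. D 0 x [] = f x" "successive_derivatives k E U D"
    using assms(1) unfolding Ck_on_iff_successive_derivatives by (elim exE conjE) (rule that)
  have "successive_derivatives k E V D"
    using D(2) assms(2) unfolding successive_derivatives_def by (auto simp: subset_iff)
  moreover have "\<forall>x\<in>V. D 0 x [] = g x" using D(1) assms(2,3) by auto
  ultimately show ?thesis unfolding Ck_on_iff_successive_derivatives by (intro exI conjI)
qed

text \<open>
  By induction on \<open>i\<close>, for all members \<open>D j\<close> of the sequence of derivatives at once.
\<close>

lemma Ck_on_imp_smooth:
  assumes "Ck_on k UNIV U f" "open U" "enat i \<le> k"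
  shows "smooth i 0 U (\<lambda>x _. f x)"
proof -
  obtain D where D0: "\<forall>x\<in>U. D 0 x [] = f x" and D: "successive_derivatives k UNIV U D"
    using assms(1) unfolding Ck_on_iff_successive_derivatives by (elim exE conjE) (rule that)
  note Dlin = conjunct1[OF D[unfolded successive_derivatives_def], rule_format]
    and Dder = conjunct1[OF conjunct2[OF D[unfolded successive_derivatives_def]], rule_format]
    and Dcont = conjunct2[OF conjunct2[OF D[unfolded successive_derivatives_def]], rule_format]
  have cont: "mcont j (D j) x" if j: "enat j \<le> k" and x: "x \<in> U" for j x
  proof (rule mcontI)
    let ?\<rho> = "\<lambda>h. multilinear_norm UNIV j (\<lambda>vs. D j (x + h) vs - D j x vs)"
    have "?\<rho> 0 = 0" by (simp add: multilinear_norm_zero)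
    moreover have "(?\<rho> \<longlongrightarrow> 0) (at 0)" using LIM_offset_zero[OF Dcont[OF j x]] by simp
    ultimately show "(?\<rho> \<longlongrightarrow> 0) (nhds 0)" using tendsto_at_iff_tendsto_nhds[of ?\<rho> 0] by simp
    show "\<forall>\<^sub>F h in nhds 0. mbound j (\<lambda>vs. D j (x + h) vs - D j x vs) (?\<rho> h)"
      using eventually_shift_in_open[OF assms(2) x]
      by eventually_elim (intro mbound_multilinear_norm bounded_multilinear_on_diff Dlin j x)
  qed
  have der: "mderiv j (D j) (D (Suc j) x) x" if j: "enat (Suc j) \<le> k" and x: "x \<in> U" for j x
  proof (rule mderivI)
    let ?\<rho> = "\<lambda>h. multilinear_norm UNIV j (\<lambda>vs. D j (x + h) vs - D j x vs - D (Suc j) x (h # vs)) / norm h"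
    have j': "enat j < k" "enat j \<le> k" using j by (auto simp: Suc_ile_eq)
    show "(?\<rho> \<longlongrightarrow> 0) (nhds 0)" using Dder[OF j'(1) x] tendsto_at_iff_tendsto_nhds[of ?\<rho> 0] by simp
    show "\<forall>\<^sub>F h in nhds 0. mbound j (\<lambda>vs. D j (x + h) vs - D j x vs - D (Suc j) x (h # vs)) (?\<rho> h * norm h)"
      using eventually_shift_in_open[OF assms(2) x]
    proof eventually_elim
      case (elim h)
      show ?case
      proof (cases "h = 0")
        case True
        have "D (Suc j) x (0 # vs) = 0" if "length vs = j" for vs
          using linear_0[OF mlin_head[of j "D (Suc j) x" vs]] Dlin[OF j x] that
          by (simp add: mlin_iff_bounded_multilinear_on)
        then show ?thesis using True by (simp add: mbound_def)
      next
        case False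
        then show ?thesis
          using mbound_multilinear_norm[OF bounded_multilinear_on_diff[OF bounded_multilinear_on_diff[OF
                Dlin[OF j'(2) elim] Dlin[OF j'(2) x]] bounded_multilinear_on_Cons[OF Dlin[OF j x] UNIV_I]], of h]
          by simp
      qed
    qed
  qed
  have "enat (i + j) \<le> k \<Longrightarrow> smooth i j U (D j)" for j
  proof (induction i arbitrary: j)
    case 0
    then show ?case using cont Dlin by (simp add: mlin_iff_bounded_multilinear_on)
  next
    case (Suc i)
    have le: "enat (Suc j) \<le> k" "enat j \<le> k"
      by (rule order_trans[OF _ Suc.prems], simp)+
    have "smooth i (Suc j) U (D (Suc j))" using Suc.IH[of "Suc j"] Suc.prems by simp
    then show ?case using der[OF le(1)] Dlin[OF le(2)] by (auto simp: mlin_iff_bounded_multilinear_on)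
  qed
  from this[of 0] have "smooth i 0 U (D 0)" using assms(3) by simp
  then show ?thesis by (rule smooth_cong[OF assms(2), rotated]) (simp add: D0)
qed

lemma mderiv_unique:
  assumes A: "mlin (Suc n) A" "mderiv n F A x" and B: "mlin (Suc n) B" "mderiv n F B x"
    and "length ws = Suc n"
  shows "A ws = B ws"
proof -
  obtain h vs where ws: "ws = h # vs" "length vs = n" using assms(5) by (cases ws) auto
  obtain \<rho> where \<rho>: "(\<rho> \<longlongrightarrow> 0) (nhds 0)" "\<forall>h. 0 \<le> \<rho> h"
    "\<forall>\<^sub>F h in nhds 0. mbound n (\<lambda>vs. F (x + h) vs - F x vs - A (h # vs)) (\<rho> h * norm h)"
    by (rule mderivE[OF A(2)])
  obtain \<sigma> where \<sigma>: "(\<sigma> \<longlongrightarrow> 0) (nhds 0)" "\<forall>h. 0 \<le> \<sigma> h"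
    "\<forall>\<^sub>F h in nhds 0. mbound n (\<lambda>vs. F (x + h) vs - F x vs - B (h # vs)) (\<sigma> h * norm h)"
    by (rule mderivE[OF B(2)])
  let ?K = "norm h * norms vs"
  have "\<forall>\<^sub>F t in at_right 0. norm (A ws - B ws) \<le> (\<rho> (t *\<^sub>R h) + \<sigma> (t *\<^sub>R h)) * ?K"
    using eventually_compose_filterlim[OF \<rho>(3) tendsto_scaled_nhds_0, of h]
      eventually_compose_filterlim[OF \<sigma>(3) tendsto_scaled_nhds_0, of h] eventually_at_right_less[of 0]
  proof eventually_elim
    case (elim t)
    have "t * norm (A ws - B ws) = norm (A (t *\<^sub>R h # vs) - B (t *\<^sub>R h # vs))"
      using elim(3) linear_scale[OF mlin_head[OF A(1) ws(2)], of t h] linear_scale[OF mlin_head[OF B(1) ws(2)], of t h]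
      by (simp add: ws(1) flip: scaleR_diff_right)
    also have "A (t *\<^sub>R h # vs) - B (t *\<^sub>R h # vs) =
      (F (x + t *\<^sub>R h) vs - F x vs - B (t *\<^sub>R h # vs)) - (F (x + t *\<^sub>R h) vs - F x vs - A (t *\<^sub>R h # vs))" by simp
    also have "norm \<dots> \<le> \<sigma> (t *\<^sub>R h) * norm (t *\<^sub>R h) * norms vs + \<rho> (t *\<^sub>R h) * norm (t *\<^sub>R h) * norms vs"
      by (rule order_trans[OF norm_triangle_ineq4 add_mono[OF mboundD[OF elim(2) ws(2)] mboundD[OF elim(1) ws(2)]]])
    also have "\<dots> = t * ((\<rho> (t *\<^sub>R h) + \<sigma> (t *\<^sub>R h)) * ?K)" using elim(3) by (simp add: algebra_simps)
    finally show ?case using elim(3) by simp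
  qed
  moreover have "((\<lambda>t. (\<rho> (t *\<^sub>R h) + \<sigma> (t *\<^sub>R h)) * ?K) \<longlongrightarrow> 0) (at_right 0)"
    using filterlim_compose[OF \<rho>(1) tendsto_scaled_nhds_0, of h] filterlim_compose[OF \<sigma>(1) tendsto_scaled_nhds_0, of h]
    by (auto intro!: tendsto_eq_intros)
  ultimately have "norm (A ws - B ws) \<le> 0"
    by (intro tendsto_lowerbound) auto
  then show ?thesis by simp
qed

text \<open>
  For \<open>k = \<infinity>\<close> one sequence of derivatives is needed, whereas the statements \<open>smooth i\<close> for
  different \<open>i\<close> come with unrelated ones. Since derivatives are unique, this choice
  agrees with all of them.
\<close>

definition next_deriv ::
  "nat \<Rightarrow> ('x::real_normed_vector \<Rightarrow> 'x list \<Rightarrow> 'y::real_normed_vector) \<Rightarrow> 'x \<Rightarrow> 'x list \<Rightarrow> 'y" where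
  "next_deriv n F x = (SOME F'. mlin (Suc n) F' \<and> mderiv n F F' x)"

lemma smooth_next_deriv:
  assumes "open U" "smooth (Suc i) n U F"
  shows "smooth i (Suc n) U (next_deriv n F)" "\<And>x. x \<in> U \<Longrightarrow> mderiv n F (next_deriv n F x) x"
proof -
  obtain F' where F': "\<forall>x\<in>U. mderiv n F (F' x) x" "smooth i (Suc n) U F'" using assms(2) by auto
  have *: "mlin (Suc n) (next_deriv n F x) \<and> mderiv n F (next_deriv n F x) x" if "x \<in> U" for x
    unfolding next_deriv_def
    by (rule someI[of _ "F' x"]) (use F' smooth_mlin[OF F'(2)] that in auto)
  show "smooth i (Suc n) U (next_deriv n F)"
    by (rule smooth_cong[OF assms(1) _ F'(2)])
      (use F'(1) smooth_mlin[OF F'(2)] * mderiv_unique in blast)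
  show "\<And>x. x \<in> U \<Longrightarrow> mderiv n F (next_deriv n F x) x" using * by blast
qed

lemma smooth_imp_Ck_on:
  fixes f :: "'x::banach \<Rightarrow> 'y::banach"
  assumes U: "open U" and f: "\<And>i. enat i \<le> k \<Longrightarrow> smooth i 0 U (\<lambda>x _. f x)"
  shows "Ck_on k UNIV U f"
proof -
  define D where "D = rec_nat (\<lambda>x _. f x) next_deriv"
  have D0: "D 0 = (\<lambda>x _. f x)" and DSuc: "D (Suc j) = next_deriv j (D j)" for j
    unfolding D_def by simp_all
  have D: "enat (i + j) \<le> k \<Longrightarrow> smooth i j U (D j)" for i j
  proof (induction j arbitrary: i)
    case 0
    then show ?case using f by (simp add: D0)
  next
    case (Suc j)
    have "smooth (Suc i) j U (D j)" using Suc.IH[of "Suc i"] Suc.prems by (simp only: add_Suc add_Suc_right)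
    then show ?case unfolding DSuc by (rule smooth_next_deriv(1)[OF U])
  qed
  show ?thesis
    unfolding Ck_on_def
  proof (intro exI[of _ D] conjI allI impI ballI)
    fix x j assume "x \<in> U" "enat j \<le> k"
    then have s: "smooth 0 j U (D j)" using D[of 0 j] by simp
    then show "bounded_multilinear_on UNIV j (D j x)"
      using \<open>x \<in> U\<close> by (simp add: mlin_iff_bounded_multilinear_on)
    obtain \<rho> where \<rho>: "(\<rho> \<longlongrightarrow> 0) (nhds 0)" "\<forall>h. 0 \<le> \<rho> h"
      "\<forall>\<^sub>F h in nhds 0. mbound j (\<lambda>vs. D j (x + h) vs - D j x vs) (\<rho> h)"
      by (rule mcontE[OF smooth_mcont[OF s \<open>x \<in> U\<close>]])
    let ?m = "\<lambda>h. multilinear_norm UNIV j (\<lambda>vs. D j (x + h) vs - D j x vs)"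
    have "\<forall>\<^sub>F h in nhds 0. norm (?m h) \<le> \<rho> h"
      using \<rho>(3) by eventually_elim (use multilinear_norm_le_mbound \<rho>(2) in force)
    then have "(?m \<longlongrightarrow> 0) (nhds 0)" using \<rho>(1) by (rule Lim_null_comparison)
    then have "(?m \<longlongrightarrow> 0) (at 0)" by (rule tendsto_mono[OF at_within_le_nhds])
    from LIM_offset_zero_cancel[of "\<lambda>y. multilinear_norm UNIV j (\<lambda>vs. D j y vs - D j x vs)" x, OF this]
    show "((\<lambda>y. multilinear_norm UNIV j (\<lambda>vs. D j y vs - D j x vs)) \<longlongrightarrow> 0) (at x)" .
  next
    fix x j assume "x \<in> U" "enat j < k"
    then have s: "smooth (Suc 0) j U (D j)" using D[of 1 j] by (simp add: Suc_ile_eq)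
    obtain \<rho> where \<rho>: "(\<rho> \<longlongrightarrow> 0) (nhds 0)" "\<forall>h. 0 \<le> \<rho> h"
      "\<forall>\<^sub>F h in nhds 0. mbound j (\<lambda>vs. D j (x + h) vs - D j x vs - next_deriv j (D j) x (h # vs)) (\<rho> h * norm h)"
      by (rule mderivE[OF smooth_next_deriv(2)[OF U s \<open>x \<in> U\<close>]])
    let ?m = "\<lambda>h. multilinear_norm UNIV j (\<lambda>vs. D j (x + h) vs - D j x vs - D (Suc j) x (h # vs)) / norm h"
    have "\<forall>\<^sub>F h in nhds 0. norm (?m h) \<le> \<rho> h"
      using \<rho>(3)
    proof eventually_elim
      case (elim h)
      show ?case
      proof (cases "h = 0")
        case False
        then show ?thesis using multilinear_norm_le_mbound[OF elim] \<rho>(2) by (simp add: DSuc pos_divide_le_eq)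
      qed (use \<rho>(2) in simp)
    qed
    then have "(?m \<longlongrightarrow> 0) (nhds 0)" using \<rho>(1) by (rule Lim_null_comparison)
    then show "(?m \<longlongrightarrow> 0) (at 0)" by (rule tendsto_mono[OF at_within_le_nhds])
  qed (simp add: D0)
qed

text \<open>
  The lower bound makes \<open>f\<^sub>2\<close> an immersion: it passes to the derivatives, whose ranges are therefore
  closed, though possibly not complemented.
\<close>

lemma Ck_on_lift_immersion:
  fixes g :: "'x::banach \<Rightarrow> 'x" and f\<^sub>2 :: "'x \<Rightarrow> 'y::banach"
  assumes k: "1 \<le> k" and W: "open W" and V: "open V" and g: "g ` W \<subseteq> V"
    and c: "c > 0" "\<And>x y. x \<in> V \<Longrightarrow> y \<in> V \<Longrightarrow> c * norm (x - y) \<le> norm (f\<^sub>2 x - f\<^sub>2 y)"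
    and f\<^sub>2: "Ck_on k UNIV V f\<^sub>2" and f\<^sub>1: "Ck_on k UNIV W (\<lambda>x. f\<^sub>2 (g x))"
  shows "Ck_on k UNIV W g"
proof (rule smooth_imp_Ck_on[OF W])
  have *: "smooth (Suc i) 0 W (\<lambda>x _. g x)" if "enat (Suc i) \<le> k" for i
    by (rule smooth_lift_immersion[OF W V g c])
      (use Ck_on_imp_smooth[OF f\<^sub>2 V that] Ck_on_imp_smooth[OF f\<^sub>1 W that] in auto)
  fix i assume i: "enat i \<le> k"
  show "smooth i 0 W (\<lambda>x _. g x)"
  proof (cases i)
    case 0
    have "enat (Suc 0) \<le> k" using k by (simp add: one_enat_def)
    then show ?thesis using smooth_Suc_imp[OF *[of 0]] 0 by simp
  qed (use * i in simp)
qed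

lemma Ck_on_ident: "Ck_on k UNIV U (\<lambda>x::'x::banach. x)"
proof -
  define D :: "nat \<Rightarrow> 'x \<Rightarrow> 'x list \<Rightarrow> 'x" where
    "D j x vs = (if j = 0 then x else if j = 1 then hd vs else 0)" for j x vs
  have lin: "bounded_multilinear_on UNIV j (D j x)" for j x
  proof -
    have "norm (D j x vs) \<le> (norm x + 1) * norms vs" if "length vs = j" for vs
      using that by (cases vs; cases "tl vs") (auto simp: D_def algebra_simps)
    moreover have "D j x (xs @ (a *\<^sub>R u + b *\<^sub>R v) # ys) = a *\<^sub>R D j x (xs @ u # ys) + b *\<^sub>R D j x (xs @ v # ys)"
      if "Suc (length xs + length ys) = j" for xs ys u v a b
      using that by (auto simp: D_def)
    ultimately show ?thesis unfolding bounded_multilinear_on_slot_iff by blast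
  qed
  have der: "multilinear_norm UNIV j (\<lambda>vs. D j (x + h) vs - D j x vs - D (Suc j) x (h # vs)) = 0" for j x h
    by (cases "j = 0") (simp_all add: D_def multilinear_norm_zero)
  have cont: "((\<lambda>y. multilinear_norm UNIV j (\<lambda>vs. D j y vs - D j x vs)) \<longlongrightarrow> 0) (at x)" for j x
  proof (cases "j = 0")
    case True
    have "((\<lambda>y. norm (y - x)) \<longlongrightarrow> norm (x - x)) (at x)" by (intro tendsto_intros)
    then show ?thesis using True by (simp add: D_def multilinear_norm_0)
  qed (simp add: D_def multilinear_norm_zero)
  show ?thesis unfolding Ck_on_def using lin der cont
    by (intro exI[of _ D]) (simp, simp add: D_def)
qed

lemma eventually_shift_in_openin:
  fixes E :: "'e::real_normed_vector set"
  assumes E: "subspace E" and U: "openin (top_of_set E) U" "x \<in> U"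
  shows "\<forall>\<^sub>F h in at 0 within E. x + h \<in> U"
proof -
  obtain e where e: "e > 0" "ball x e \<inter> E \<subseteq> U" using U by (auto simp: openin_contains_ball)
  have "x \<in> E" using U openin_imp_subset by blast
  then show ?thesis unfolding eventually_at
    by (intro exI[of _ e]) (use e E in \<open>auto simp: dist_norm subspace_add\<close>)
qed

lemma Ck_on_derivative:
  fixes f :: "'e::banach \<Rightarrow> 'f::banach"
  assumes f: "Ck_on k E U f" and k: "1 \<le> k" and E: "subspace E" and U: "openin (top_of_set E) U"
  obtains L where "\<forall>x\<in>U. has_derivative_in E f (L x) x"
    "\<forall>x\<in>U. \<forall>e>0. \<forall>\<^sub>F y in at x within E. \<forall>v\<in>E. norm (L y v - L x v) \<le> e * norm v"
proof -
  have k': "enat 0 < k" "enat (Suc 0) \<le> k" using k by (simp_all add: one_enat_def Suc_ile_eq)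
  obtain D where D0: "\<forall>x\<in>U. D 0 x [] = f x" and D: "successive_derivatives k E U D"
    using f unfolding Ck_on_iff_successive_derivatives by (elim exE conjE) (rule that)
  note Dlin = conjunct1[OF D[unfolded successive_derivatives_def], rule_format, OF k'(2), folded One_nat_def]
    and Dder = conjunct1[OF conjunct2[OF D[unfolded successive_derivatives_def]], rule_format, OF k'(1), folded One_nat_def]
    and Dcont = conjunct2[OF conjunct2[OF D[unfolded successive_derivatives_def]], rule_format, OF k'(2), folded One_nat_def]
  have lin: "D 1 x [a *\<^sub>R u + b *\<^sub>R v] = a *\<^sub>R D 1 x [u] + b *\<^sub>R D 1 x [v]"
    if "x \<in> U" "u \<in> E" "v \<in> E" for x u v a b
    using conjunct1[OF Dlin[OF that(1), unfolded bounded_multilinear_on_slot_iff], rule_format, of "[]" "[]" u v a b] that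
    by simp
  have bnd: "\<exists>K. \<forall>v\<in>E. norm (D 1 x [v]) \<le> K * norm v" if x: "x \<in> U" for x
  proof -
    obtain K where K: "\<forall>vs. length vs = 1 \<longrightarrow> set vs \<subseteq> E \<longrightarrow> norm (D 1 x vs) \<le> K * norms vs"
      by (rule bounded_multilinear_on_bound[OF Dlin[OF x]])
    show ?thesis using K[rule_format, of "[_]"] by (intro exI[of _ K]) auto
  qed
  show thesis
  proof (rule that[of "\<lambda>x v. D 1 x [v]"]; intro ballI allI impI)
    fix x assume x: "x \<in> U"
    have "\<forall>\<^sub>F h in at 0 within E.
      multilinear_norm E 0 (\<lambda>vs. D 0 (x + h) vs - D 0 x vs - D 1 x (h # vs)) / norm h = norm (f (x + h) - f x - D 1 x [h]) / norm h"
      using eventually_shift_in_openin[OF E U x] by eventually_elim (simp add: multilinear_norm_0 D0 x)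
    then have "((\<lambda>h. norm (f (x + h) - f x - D 1 x [h]) / norm h) \<longlongrightarrow> 0) (at 0 within E)"
      using Dder[OF x] by (rule Lim_transform_eventually[rotated])
    then show "has_derivative_in E f (\<lambda>v. D 1 x [v]) x"
      unfolding has_derivative_in_def bounded_linear_on_def using lin[OF x] bnd[OF x] by blast
  next
    fix x and e :: real assume x: "x \<in> U" and e: "e > 0"
    obtain d where d: "d > 0" "ball x d \<inter> E \<subseteq> U" using U x by (auto simp: openin_contains_ball)
    have "\<forall>\<^sub>F y in at x within E. y \<in> U"
      unfolding eventually_at by (intro exI[of _ d]) (use d in \<open>auto simp: dist_commute\<close>)
    moreover have "\<forall>\<^sub>F y in at x within E. multilinear_norm E 1 (\<lambda>vs. D 1 y vs - D 1 x vs) < e"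
      using Dcont[OF x] e by (rule order_tendstoD)
    ultimately show "\<forall>\<^sub>F y in at x within E. \<forall>v\<in>E. norm (D 1 y [v] - D 1 x [v]) \<le> e * norm v"
    proof eventually_elim
      case (elim y)
      show ?case
      proof
        fix v assume "v \<in> E"
        then have "norm (D 1 y [v] - D 1 x [v]) \<le> multilinear_norm E 1 (\<lambda>vs. D 1 y vs - D 1 x vs) * norm v"
          using multilinear_norm_bound[OF E bounded_multilinear_on_diff[OF Dlin[OF elim(1)] Dlin[OF x]], of "[v]"] by simp
        also have "\<dots> \<le> e * norm v" using elim(2) by (intro mult_right_mono) auto
        finally show "norm (D 1 y [v] - D 1 x [v]) \<le> e * norm v" .
      qed
    qed
  qed
qed

section \<open>First derivatives on closed subspaces\<close>

lemma bounded_linear_on_diff: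
  "bounded_linear_on E L \<Longrightarrow> u \<in> E \<Longrightarrow> v \<in> E \<Longrightarrow> L (u - v) = L u - L v"
  unfolding bounded_linear_on_def by (drule conjunct1, drule bspec[of _ _ u], assumption, drule bspec[of _ _ v], assumption)
    (drule spec[of _ 1], drule spec[of _ "-1"], simp)

lemma bounded_linear_on_scale:
  "bounded_linear_on E L \<Longrightarrow> u \<in> E \<Longrightarrow> L (a *\<^sub>R u) = a *\<^sub>R L u"
  unfolding bounded_linear_on_def by (drule conjunct1, drule bspec[of _ _ u], assumption, drule bspec[of _ _ u], assumption)
    (drule spec[of _ a], drule spec[of _ 0], simp)

lemma bounded_linear_on_bound:
  assumes "bounded_linear_on E L"
  obtains K where "K > 0" "\<forall>v\<in>E. norm (L v) \<le> K * norm v"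
proof -
  obtain K where K: "\<forall>v\<in>E. norm (L v) \<le> K * norm v" using assms unfolding bounded_linear_on_def by blast
  show thesis
  proof (rule that[of "max K 1"])
    show "\<forall>v\<in>E. norm (L v) \<le> max K 1 * norm v"
      using K by (meson max.cobounded1 mult_right_mono norm_ge_zero order_trans)
  qed simp
qed

lemma bounded_linear_on_UNIV: "bounded_linear_on UNIV L \<longleftrightarrow> bounded_linear L"
proof
  assume L: "bounded_linear_on UNIV L"
  then obtain K where "\<forall>v. norm (L v) \<le> K * norm v" by (rule bounded_linear_on_bound) simp
  moreover have "linear L" using L unfolding linear_iff_combination bounded_linear_on_def by blast
  ultimately show "bounded_linear L"
    by (intro bounded_linear.intro bounded_linear_axioms.intro) (auto simp: mult.commute)
next
  assume L: "bounded_linear L"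
  then obtain K where "\<And>v. norm (L v) \<le> norm v * K" by (metis bounded_linear.bounded)
  then have "\<exists>K. \<forall>v. norm (L v) \<le> K * norm v" by (metis mult.commute)
  moreover have "\<forall>u v a b. L (a *\<^sub>R u + b *\<^sub>R v) = a *\<^sub>R L u + b *\<^sub>R L v"
    using bounded_linear.linear[OF L] linear_iff_combination by blast
  ultimately show "bounded_linear_on UNIV L" unfolding bounded_linear_on_def by blast
qed

lemma has_derivative_in_iff:
  "has_derivative_in E f L x \<longleftrightarrow> bounded_linear_on E L \<and>
     (\<forall>e>0. \<exists>d>0. \<forall>h\<in>E. norm h < d \<longrightarrow> norm (f (x + h) - f x - L h) \<le> e * norm h)"
  (is "_ \<longleftrightarrow> ?lin \<and> ?lim")
proof -
  have "((\<lambda>h. norm (f (x + h) - f x - L h) / norm h) \<longlongrightarrow> 0) (at 0 within E) \<longleftrightarrow> ?lim" (is "?tends \<longleftrightarrow> _") if L: ?lin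
  proof
    assume ?tends
    show ?lim
    proof (intro allI impI)
      fix e :: real assume "e > 0"
      with order_tendstoD(2)[OF \<open>?tends\<close>]
      have "\<forall>\<^sub>F h in at 0 within E. norm (f (x + h) - f x - L h) / norm h < e" .
      then obtain d where d: "d > 0"
        "\<And>h. h \<in> E \<Longrightarrow> h \<noteq> 0 \<Longrightarrow> norm h < d \<Longrightarrow> norm (f (x + h) - f x - L h) / norm h < e"
        unfolding eventually_at by auto
      have "norm (f (x + h) - f x - L h) \<le> e * norm h" if "h \<in> E" "norm h < d" for h
      proof (cases "h = 0")
        case True
        then show ?thesis using bounded_linear_on_diff[OF L that(1) that(1)] by simp
      next
        case False
        then show ?thesis using d(2)[OF that(1) False that(2)] by (simp add: pos_divide_less_eq)
      qed
      then show "\<exists>d>0. \<forall>h\<in>E. norm h < d \<longrightarrow> norm (f (x + h) - f x - L h) \<le> e * norm h"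
        using d(1) by blast
    qed
  next
    assume R: ?lim
    show ?tends
      unfolding tendsto_iff eventually_at
    proof (intro allI impI)
      fix e :: real assume "e > 0"
      then obtain d where d: "d > 0" "\<And>h. h \<in> E \<Longrightarrow> norm h < d \<Longrightarrow> norm (f (x + h) - f x - L h) \<le> e / 2 * norm h"
        using R[rule_format, of "e / 2"] by auto
      have "norm (f (x + h) - f x - L h) / norm h < e" if "h \<in> E" "h \<noteq> 0" "norm h < d" for h
      proof -
        have "norm (f (x + h) - f x - L h) / norm h \<le> e / 2"
          using d(2)[of h] that by (simp add: pos_divide_le_eq)
        also have "\<dots> < e" using \<open>e > 0\<close> by simp
        finally show ?thesis .
      qed
      then show "\<exists>d>0. \<forall>h\<in>E. h \<noteq> 0 \<and> dist h 0 < d \<longrightarrow> dist (norm (f (x + h) - f x - L h) / norm h) 0 < e"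
        using d(1) by auto
    qed
  qed
  then show ?thesis unfolding has_derivative_in_def by blast
qed

lemma has_derivative_in_unique:
  fixes E :: "'e::real_normed_vector set"
  assumes E: "subspace E" and L: "has_derivative_in E f L x" and L': "has_derivative_in E f L' x" and v: "v \<in> E"
  shows "L v = L' v"
proof (rule ccontr)
  assume ne: "L v \<noteq> L' v"
  have lin: "bounded_linear_on E L" "bounded_linear_on E L'" using L L' by (auto simp: has_derivative_in_def)
  have v0: "v \<noteq> 0"
    using ne bounded_linear_on_diff[OF lin(1) v v] bounded_linear_on_diff[OF lin(2) v v] by auto
  define e where "e = norm (L v - L' v) / (3 * norm v)"
  have e: "e > 0" using ne v0 by (simp add: e_def)
  obtain d1 where d1: "d1 > 0" "\<And>h. h \<in> E \<Longrightarrow> norm h < d1 \<Longrightarrow> norm (f (x + h) - f x - L h) \<le> e * norm h"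
    using L e unfolding has_derivative_in_iff by blast
  obtain d2 where d2: "d2 > 0" "\<And>h. h \<in> E \<Longrightarrow> norm h < d2 \<Longrightarrow> norm (f (x + h) - f x - L' h) \<le> e * norm h"
    using L' e unfolding has_derivative_in_iff by blast
  define t where "t = min d1 d2 / (2 * norm v)"
  have t: "t > 0" "norm (t *\<^sub>R v) < d1" "norm (t *\<^sub>R v) < d2" using d1(1) d2(1) v0 by (auto simp: t_def min_def)
  have tv: "t *\<^sub>R v \<in> E" using E v by (rule subspace_scale)
  have "t * norm (L v - L' v) = norm (L (t *\<^sub>R v) - L' (t *\<^sub>R v))"
    using t(1) by (simp add: bounded_linear_on_scale[OF lin(1) v] bounded_linear_on_scale[OF lin(2) v] flip: scaleR_diff_right)
  also have "L (t *\<^sub>R v) - L' (t *\<^sub>R v) = (f (x + t *\<^sub>R v) - f x - L' (t *\<^sub>R v)) - (f (x + t *\<^sub>R v) - f x - L (t *\<^sub>R v))" by simp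
  also have "norm \<dots> \<le> e * norm (t *\<^sub>R v) + e * norm (t *\<^sub>R v)"
    by (rule order_trans[OF norm_triangle_ineq4 add_mono[OF d2(2)[OF tv t(3)] d1(2)[OF tv t(2)]]])
  also have "\<dots> = t * (2 / 3 * norm (L v - L' v))" using v0 t(1) by (simp add: e_def field_simps)
  finally show False using t(1) ne by simp
qed

lemma derivative_in_eq:
  assumes "subspace E" "has_derivative_in E f L x" "v \<in> E"
  shows "derivative_in E f x v = L v"
  unfolding derivative_in_def
  by (rule has_derivative_in_unique[OF assms(1) someI[of "\<lambda>L. has_derivative_in E f L x"] assms(2,3)]) (rule assms(2))

lemma has_derivative_in_transform:
  fixes E :: "'e::real_normed_vector set"
  assumes E: "subspace E" and U: "openin (top_of_set E) U" "x \<in> U" and fg: "\<And>y. y \<in> U \<Longrightarrow> f y = g y"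
    and L: "has_derivative_in E f L x"
  shows "has_derivative_in E g L x"
proof -
  have "\<forall>\<^sub>F h in at 0 within E. norm (f (x + h) - f x - L h) / norm h = norm (g (x + h) - g x - L h) / norm h"
    using eventually_shift_in_openin[OF E U] by eventually_elim (simp add: fg U(2))
  with L have "((\<lambda>h. norm (g (x + h) - g x - L h) / norm h) \<longlongrightarrow> 0) (at 0 within E)"
    unfolding has_derivative_in_def by (elim conjE) (rule Lim_transform_eventually)
  then show ?thesis using L unfolding has_derivative_in_def by simp
qed

text \<open>
  \<open>L'\<close> is bounded and linear on \<open>F\<close> only, so \<open>L\<close> has to map into \<open>F\<close>. It does so because \<open>L v\<close> is a limit
  of difference quotients, which lie in the closed subspace \<open>F\<close>.
\<close>

lemma has_derivative_in_chain:
  fixes f :: "'e::real_normed_vector \<Rightarrow> 'f::real_normed_vector" and g :: "'f \<Rightarrow> 'g::real_normed_vector"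
  assumes E: "subspace E" and F: "subspace F" "closed F"
    and U: "openin (top_of_set E) U" "x \<in> U" "f ` U \<subseteq> F"
    and L: "has_derivative_in E f L x" and L': "has_derivative_in F g L' (f x)"
  shows "has_derivative_in E (g \<circ> f) (L' \<circ> L) x" "L ` E \<subseteq> F"
proof -
  have lin: "bounded_linear_on E L" "bounded_linear_on F L'" using L L' by (auto simp: has_derivative_in_def)
  obtain d0 where d0: "d0 > 0" "ball x d0 \<inter> E \<subseteq> U" using U by (auto simp: openin_contains_ball)
  have xE: "x \<in> E" using U openin_imp_subset by blast
  have inF: "f (x + h) - f x \<in> F" if "h \<in> E" "norm h < d0" for h
  proof -
    have "x + h \<in> U" using d0(2) that xE E by (auto simp: dist_norm subspace_add)
    then show ?thesis using U F(1) by (auto intro!: subspace_diff)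
  qed
  show LF: "L ` E \<subseteq> F"
  proof
    fix w assume "w \<in> L ` E"
    then obtain v where v: "v \<in> E" "w = L v" by blast
    show "w \<in> F"
    proof (rule Lim_in_closed_set[OF F(2)])
      let ?q = "\<lambda>t. (1 / t) *\<^sub>R (f (x + t *\<^sub>R v) - f x)"
      have ev0: "\<forall>\<^sub>F t in at_right 0. norm (t *\<^sub>R v) < d" if "d > 0" for d
      proof -
        have "((\<lambda>t::real. norm (t *\<^sub>R v)) \<longlongrightarrow> norm (0 *\<^sub>R v)) (at_right 0)" by (intro tendsto_intros)
        then show ?thesis by (rule order_tendstoD) (simp add: that)
      qed
      show "\<forall>\<^sub>F t in at_right 0. ?q t \<in> F"
        using ev0[OF d0(1)] by eventually_elim (intro subspace_scale[OF F(1)] inF subspace_scale[OF E v(1)])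
      show "\<not> trivial_limit (at_right (0::real))" by simp
      show "(?q \<longlongrightarrow> w) (at_right 0)"
      proof (rule tendstoI)
        fix e :: real assume e: "e > 0"
        define e' where "e' = e / (2 * (norm v + 1))"
        have e': "e' > 0" using e by (simp add: e'_def add_nonneg_pos)
        then obtain d where d: "d > 0" "\<And>h. h \<in> E \<Longrightarrow> norm h < d \<Longrightarrow> norm (f (x + h) - f x - L h) \<le> e' * norm h"
          using L unfolding has_derivative_in_iff by blast
        show "\<forall>\<^sub>F t in at_right 0. dist (?q t) w < e"
          using ev0[OF d(1)] eventually_at_right_less[of 0]
        proof eventually_elim
          case (elim t)
          have tv: "t *\<^sub>R v \<in> E" using E v(1) by (rule subspace_scale)
          have "?q t - w = (1 / t) *\<^sub>R (f (x + t *\<^sub>R v) - f x - L (t *\<^sub>R v))"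
            using elim(2) bounded_linear_on_scale[OF lin(1) v(1), of t] v(2) by (simp add: algebra_simps)
          then have "norm (?q t - w) \<le> (1 / t) * (e' * norm (t *\<^sub>R v))"
            using mult_left_mono[OF d(2)[OF tv elim(1)], of "1 / t"] elim(2) by simp
          also have "\<dots> = e' * norm v" using elim(2) by simp
          also have "\<dots> \<le> e' * (norm v + 1)" using e' by simp
          also have "\<dots> = e / 2" by (simp add: e'_def field_simps add_nonneg_eq_0_iff)
          finally show ?case using e by (simp add: dist_norm)
        qed
      qed
    qed
  qed
  obtain K where K: "K > 0" "\<forall>v\<in>E. norm (L v) \<le> K * norm v" by (rule bounded_linear_on_bound[OF lin(1)])
  obtain K' where K': "K' > 0" "\<forall>v\<in>F. norm (L' v) \<le> K' * norm v" by (rule bounded_linear_on_bound[OF lin(2)])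
  have "bounded_linear_on E (L' \<circ> L)"
    unfolding bounded_linear_on_def
  proof (intro conjI ballI allI)
    fix u v and a b :: real assume "u \<in> E" "v \<in> E"
    then show "(L' \<circ> L) (a *\<^sub>R u + b *\<^sub>R v) = a *\<^sub>R (L' \<circ> L) u + b *\<^sub>R (L' \<circ> L) v"
      using lin LF unfolding bounded_linear_on_def by (auto simp: image_subset_iff)
  next
    have "norm ((L' \<circ> L) v) \<le> (K' * K) * norm v" if "v \<in> E" for v
    proof -
      have "norm (L' (L v)) \<le> K' * norm (L v)" using K'(2) LF that by auto
      also have "\<dots> \<le> K' * (K * norm v)" using K' K that by (intro mult_left_mono) auto
      finally show ?thesis by (simp add: mult.assoc)
    qed
    then show "\<exists>K. \<forall>v\<in>E. norm ((L' \<circ> L) v) \<le> K * norm v" by blast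
  qed
  moreover have "\<exists>d>0. \<forall>h\<in>E. norm h < d \<longrightarrow> norm ((g \<circ> f) (x + h) - (g \<circ> f) x - (L' \<circ> L) h) \<le> e * norm h" if e: "e > 0" for e :: real
  proof -
    \<comment> \<open>One half of \<open>e\<close> is for the error of \<open>f\<close> transported by \<open>L'\<close>, the other half for the error of \<open>g\<close>.\<close>
    define e1 where "e1 = min 1 (e / (2 * K'))"
    define e2 where "e2 = e / (2 * (K + 1))"
    have e12: "e1 > 0" "e2 > 0" "e1 \<le> 1" "K' * e1 \<le> e / 2" "e2 * (K + 1) = e / 2"
      using e K(1) K'(1) by (auto simp: e1_def e2_def min_def field_simps)
    obtain d1 where d1: "d1 > 0" "\<And>h. h \<in> E \<Longrightarrow> norm h < d1 \<Longrightarrow> norm (f (x + h) - f x - L h) \<le> e1 * norm h"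
      using L e12(1) unfolding has_derivative_in_iff by blast
    obtain d2 where d2: "d2 > 0" "\<And>k. k \<in> F \<Longrightarrow> norm k < d2 \<Longrightarrow> norm (g (f x + k) - g (f x) - L' k) \<le> e2 * norm k"
      using L' e12(2) unfolding has_derivative_in_iff by blast
    define d where "d = Min {d0, d1, d2 / (K + 1)}"
    have d: "d > 0" "d \<le> d0" "d \<le> d1" "d \<le> d2 / (K + 1)" using d0(1) d1(1) d2(1) K(1) by (auto simp: d_def)
    have "norm ((g \<circ> f) (x + h) - (g \<circ> f) x - (L' \<circ> L) h) \<le> e * norm h" if h: "h \<in> E" "norm h < d" for h
    proof -
      let ?k = "f (x + h) - f x"
      have kF: "?k \<in> F" using inF h d(2) by auto
      have LhF: "L h \<in> F" using LF h(1) by auto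
      have k1: "norm (?k - L h) \<le> e1 * norm h" using d1(2) h d(3) by auto
      have "norm ?k \<le> norm (?k - L h) + norm (L h)" by (metis diff_add_cancel norm_triangle_ineq)
      also have "\<dots> \<le> 1 * norm h + K * norm h"
        using k1 K(2) h(1) mult_right_mono[OF e12(3), of "norm h"] by (intro add_mono) auto
      finally have k2: "norm ?k \<le> (K + 1) * norm h" by (simp add: algebra_simps)
      also have "\<dots> < (K + 1) * (d2 / (K + 1))" using h(2) d(4) K(1) by (intro mult_strict_left_mono) auto
      finally have "norm ?k < d2" using K(1) by simp
      then have g1: "norm (g (f x + ?k) - g (f x) - L' ?k) \<le> e2 * norm ?k" using d2(2) kF by blast
      have "(g \<circ> f) (x + h) - (g \<circ> f) x - (L' \<circ> L) h = (g (f x + ?k) - g (f x) - L' ?k) + L' (?k - L h)"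
        using bounded_linear_on_diff[OF lin(2) kF LhF] by simp
      also have "norm \<dots> \<le> e2 * norm ?k + K' * norm (?k - L h)"
        using g1 K'(2) subspace_diff[OF F(1) kF LhF] by (intro order_trans[OF norm_triangle_ineq] add_mono) auto
      also have "\<dots> \<le> e2 * ((K + 1) * norm h) + K' * (e1 * norm h)"
        using k1 k2 e12(2) K'(1) by (intro add_mono mult_left_mono) auto
      also have "\<dots> = (e2 * (K + 1) + K' * e1) * norm h" by (simp add: algebra_simps)
      also have "\<dots> \<le> e * norm h" using e12 by (intro mult_right_mono) auto
      finally show ?thesis .
    qed
    then show ?thesis using d(1) by blast
  qed
  ultimately show "has_derivative_in E (g \<circ> f) (L' \<circ> L) x" unfolding has_derivative_in_iff by blast
qed

text \<open>
  The mean value inequality on the segment from \<open>z\<close> to \<open>y\<close>. It is applied to a function of a real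
  parameter, since \<open>f\<close> is differentiable only in the directions of \<open>E\<close>.
\<close>

lemma strict_derivative:
  fixes f :: "'e::banach \<Rightarrow> 'f::banach"
  assumes E: "subspace E" and U: "openin (top_of_set E) U" "x \<in> U"
    and L: "\<forall>x\<in>U. has_derivative_in E f (L x) x"
    and cont: "\<forall>e>0. \<forall>\<^sub>F y in at x within E. \<forall>v\<in>E. norm (L y v - L x v) \<le> e * norm v" and e: "e > 0"
  shows "\<exists>d>0. \<forall>y\<in>E. \<forall>z\<in>E. norm (y - x) < d \<longrightarrow> norm (z - x) < d \<longrightarrow>
    norm (f y - f z - L x (y - z)) \<le> e * norm (y - z)"
proof -
  obtain d0 where d0: "d0 > 0" "ball x d0 \<inter> E \<subseteq> U" using U by (auto simp: openin_contains_ball)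
  have "\<forall>\<^sub>F y in at x within E. \<forall>v\<in>E. norm (L y v - L x v) \<le> e / 3 * norm v" using cont[rule_format, of "e / 3"] e by simp
  then obtain d1 where d1: "d1 > 0" "\<And>y. y \<in> E \<Longrightarrow> y \<noteq> x \<Longrightarrow> dist y x < d1 \<Longrightarrow> \<forall>v\<in>E. norm (L y v - L x v) \<le> e / 3 * norm v"
    unfolding eventually_at by blast
  have near: "norm (L y v - L x v) \<le> e / 3 * norm v" if "y \<in> E" "dist y x < d1" "v \<in> E" for y v
    using d1(2)[of y] that e by (cases "y = x") auto
  have "norm (f y - f z - L x (y - z)) \<le> e * norm (y - z)"
    if yz: "y \<in> E" "z \<in> E" "norm (y - x) < min d0 d1" "norm (z - x) < min d0 d1" for y z
  proof -
    let ?w = "y - z" and ?p = "\<lambda>t::real. z + t *\<^sub>R (y - z)"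
    have w: "?w \<in> E" using E yz by (simp add: subspace_diff)
    have p: "?p t \<in> E" "dist (?p t) x < min d0 d1" if "t \<in> {0..1}" for t
    proof -
      show "?p t \<in> E" using E w yz by (simp add: subspace_add subspace_scale)
      have "?p t \<in> ball x (min d0 d1)"
        using convexD[OF convex_ball[of x "min d0 d1"], of z y "1 - t" t] yz that
        by (simp add: dist_norm norm_minus_commute algebra_simps)
      then show "dist (?p t) x < min d0 d1" by (simp add: dist_commute)
    qed
    have pU: "?p t \<in> U" if "t \<in> {0..1}" for t using d0(2) p[OF that] by (auto simp: dist_commute)
    have der: "((\<lambda>t. f (?p t)) has_vector_derivative L (?p t) ?w) (at t within {0..1})" if t: "t \<in> {0..1}" for t
      unfolding has_vector_derivative_def has_derivative_within_alt
    proof (intro conjI allI impI)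
      show "bounded_linear (\<lambda>s. s *\<^sub>R L (?p t) ?w)" by (rule bounded_linear_scaleR_left)
      fix \<epsilon> :: real assume \<epsilon>: "\<epsilon> > 0"
      have w1: "norm ?w + 1 > 0" using norm_ge_zero[of ?w] by linarith
      define \<epsilon>' where "\<epsilon>' = \<epsilon> / (norm ?w + 1)"
      have \<epsilon>': "\<epsilon>' > 0" "\<epsilon>' * norm ?w \<le> \<epsilon>" using \<epsilon> w1 by (simp_all add: \<epsilon>'_def pos_divide_le_eq)
      have Lt: "has_derivative_in E f (L (?p t)) (?p t)" using L pU[OF t] by blast
      obtain d where d: "d > 0" "\<And>h. h \<in> E \<Longrightarrow> norm h < d \<Longrightarrow> norm (f (?p t + h) - f (?p t) - L (?p t) h) \<le> \<epsilon>' * norm h"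
        using Lt \<epsilon>'(1) unfolding has_derivative_in_iff by blast
      have "norm (f (?p s) - f (?p t) - (s - t) *\<^sub>R L (?p t) ?w) \<le> \<epsilon> * norm (s - t)"
        if s: "norm (s - t) < d / (norm ?w + 1)" for s
      proof -
        have h: "(s - t) *\<^sub>R ?w \<in> E" using E w by (rule subspace_scale)
        have "norm ((s - t) *\<^sub>R ?w) \<le> norm (s - t) * (norm ?w + 1)" by (simp add: mult_left_mono)
        also have "\<dots> < d" using s by (simp add: pos_less_divide_eq add_nonneg_pos)
        finally have "norm (f (?p t + (s - t) *\<^sub>R ?w) - f (?p t) - L (?p t) ((s - t) *\<^sub>R ?w)) \<le> \<epsilon>' * norm ((s - t) *\<^sub>R ?w)"
          by (rule d(2)[OF h])
        moreover have "?p t + (s - t) *\<^sub>R ?w = ?p s" by (simp add: algebra_simps)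
        moreover have "L (?p t) ((s - t) *\<^sub>R ?w) = (s - t) *\<^sub>R L (?p t) ?w"
          using Lt w by (intro bounded_linear_on_scale) (auto simp: has_derivative_in_def)
        moreover have "\<epsilon>' * norm ((s - t) *\<^sub>R ?w) \<le> \<epsilon> * norm (s - t)"
          using mult_left_mono[OF \<epsilon>'(2), of "norm (s - t)"] by (simp add: mult_ac)
        ultimately show ?thesis by simp
      qed
      moreover have "d / (norm ?w + 1) > 0" using d(1) by (simp add: add_nonneg_pos)
      ultimately show "\<exists>d>0. \<forall>s\<in>{0..1}. norm (s - t) < d \<longrightarrow> norm (f (?p s) - f (?p t) - (s - t) *\<^sub>R L (?p t) ?w) \<le> \<epsilon> * norm (s - t)"
        by blast
    qed
    have "norm (f (?p 1) - f (?p 0) - (1 - 0) *\<^sub>R L (?p 0) ?w) \<le> norm (1 - 0 :: real) * (2 * (e / 3) * norm ?w)"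
    proof (rule vector_differentiable_bound_linearization[OF der])
      show "closed_segment 0 1 \<subseteq> {0..1::real}" by (simp add: closed_segment_eq_real_ivl)
      fix t :: real assume t: "t \<in> {0..1}"
      have "norm (L (?p t) ?w - L x ?w) \<le> e / 3 * norm ?w" "norm (L (?p 0) ?w - L x ?w) \<le> e / 3 * norm ?w"
        using near[OF _ _ w] p[OF t] p[of 0] by auto
      then show "norm (L (?p t) ?w - L (?p 0) ?w) \<le> 2 * (e / 3) * norm ?w"
        using norm_triangle_ineq4[of "L (?p t) ?w - L x ?w" "L (?p 0) ?w - L x ?w"] by simp
    qed auto
    then have "norm (f y - f z - L z ?w) \<le> 2 * (e / 3) * norm ?w" by simp
    moreover have "norm (L z ?w - L x ?w) \<le> e / 3 * norm ?w" using near[OF yz(2) _ w] yz by (simp add: dist_norm)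
    ultimately show ?thesis
      using norm_triangle_ineq[of "f y - f z - L z ?w" "L z ?w - L x ?w"] by simp
  qed
  then show ?thesis using d0(1) d1(1) by (intro exI[of _ "min d0 d1"]) auto
qed

section \<open>The open mapping theorem and level sets\<close>

text \<open>
  Newton's method with approximate corrections. As the errors are halved, the corrections are
  dominated by a geometric series with sum \<open>2 * C * norm (y - f 0)\<close>, so the iteration stays in the ball
  and converges. The lemma serves for the linear problem of the open mapping theorem as well as for
  the nonlinear problem on the level set.
\<close>

lemma solve_by_approximate_corrections:
  fixes f :: "'x::banach \<Rightarrow> 'y::real_normed_vector"
  assumes E: "subspace E" "closed E" and cont: "continuous_on (ball 0 r \<inter> E) f" and C: "C \<ge> 0"
    and start: "2 * C * norm (y - f 0) < r"
    and step: "\<And>x. x \<in> E \<Longrightarrow> norm x < r \<Longrightarrow> norm (y - f x) \<le> norm (y - f 0) \<Longrightarrow>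
      \<exists>h\<in>E. norm h \<le> C * norm (y - f x) \<and> (norm (x + h) < r \<longrightarrow> norm (y - f (x + h)) \<le> norm (y - f x) / 2)"
  shows "\<exists>x\<in>E. norm x \<le> 2 * C * norm (y - f 0) \<and> f x = y"
proof -
  define b where "b = norm (y - f 0)"
  have b: "b \<ge> 0" by (simp add: b_def)
  define H where "H x = (SOME h. h \<in> E \<and> norm h \<le> C * norm (y - f x) \<and>
     (norm (x + h) < r \<longrightarrow> norm (y - f (x + h)) \<le> norm (y - f x) / 2))" for x
  have H: "H x \<in> E \<and> norm (H x) \<le> C * norm (y - f x) \<and>
     (norm (x + H x) < r \<longrightarrow> norm (y - f (x + H x)) \<le> norm (y - f x) / 2)"
    if "x \<in> E" "norm x < r" "norm (y - f x) \<le> b" for x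
    unfolding H_def by (rule someI_ex) (use step[OF that(1,2)] that(3) b_def in blast)
  define X where "X = rec_nat 0 (\<lambda>n x. x + H x)"
  have X0: "X 0 = 0" and XSuc: "X (Suc n) = X n + H (X n)" for n by (simp_all add: X_def)
  have inv: "X n \<in> E \<and> norm (X n) \<le> 2 * C * b * (1 - (1 / 2) ^ n) \<and> norm (y - f (X n)) \<le> b * (1 / 2) ^ n" for n
  proof (induction n)
    case 0
    then show ?case using E by (simp add: X0 b_def subspace_0)
  next
    case (Suc n)
    have le: "2 * C * b * (1 - (1 / 2) ^ m) \<le> 2 * C * b" for m :: nat
      using C b by (intro mult_left_le) auto
    have "b * (1 / 2) ^ n \<le> b" using b by (intro mult_left_le power_le_one) auto
    then have Hn: "H (X n) \<in> E" "norm (H (X n)) \<le> C * norm (y - f (X n))"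
       "norm (X n + H (X n)) < r \<Longrightarrow> norm (y - f (X n + H (X n))) \<le> norm (y - f (X n)) / 2"
      using H[of "X n"] Suc.IH le[of n] start unfolding b_def[symmetric] by auto
    have "norm (H (X n)) \<le> C * (b * (1 / 2) ^ n)"
      using Hn(2) Suc.IH C by (meson mult_left_mono order_trans)
    then have n1: "norm (X n + H (X n)) \<le> 2 * C * b * (1 - (1 / 2) ^ Suc n)"
      using Suc.IH norm_triangle_ineq[of "X n" "H (X n)"] by (simp add: algebra_simps)
    then have "norm (X n + H (X n)) < r" using le[of "Suc n"] start unfolding b_def[symmetric] by linarith
    then have "norm (y - f (X n + H (X n))) \<le> b * (1 / 2) ^ Suc n" using Hn(3) Suc.IH by simp
    then show ?case using n1 Suc.IH Hn(1) E(1) by (simp add: XSuc subspace_add)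
  qed
  have inball: "norm (X n) < r" "norm (X n) \<le> 2 * C * b" for n
  proof -
    have "2 * C * b * (1 - (1 / 2) ^ n) \<le> 2 * C * b" using C b by (intro mult_left_le) auto
    then show "norm (X n) < r" "norm (X n) \<le> 2 * C * b" using inv[of n] start unfolding b_def[symmetric] by linarith+
  qed
  have Xsum: "X n = (\<Sum>i<n. H (X i))" for n by (induction n) (simp_all add: X0 XSuc)
  have "summable (\<lambda>i. H (X i))"
  proof (rule summable_comparison_test')
    show "summable (\<lambda>i. C * b * (1 / 2) ^ i)" by (intro summable_mult summable_geometric) simp
    fix i :: nat
    have "b * (1 / 2) ^ i \<le> b" using b by (intro mult_left_le power_le_one) auto
    then have "norm (H (X i)) \<le> C * norm (y - f (X i))" using H[of "X i"] inv[of i] inball[of i] by auto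
    also have "\<dots> \<le> C * (b * (1 / 2) ^ i)" using inv[of i] C by (intro mult_left_mono) auto
    finally show "norm (H (X i)) \<le> C * b * (1 / 2) ^ i" by (simp add: mult.assoc)
  qed
  then have "(\<lambda>n. \<Sum>i<n. H (X i)) \<longlonglongrightarrow> (\<Sum>i. H (X i))" by (rule summable_LIMSEQ)
  then have lim: "X \<longlonglongrightarrow> (\<Sum>i. H (X i))" by (simp flip: Xsum)
  define x where "x = (\<Sum>i. H (X i))"
  have xE: "x \<in> E" unfolding x_def using closed_sequentially[OF E(2) _ lim] inv by blast
  have xb: "norm x \<le> 2 * C * b"
    using LIMSEQ_le_const2[OF tendsto_norm[OF lim]] inball(2) unfolding x_def by blast
  have "(\<lambda>n. f (X n)) \<longlonglongrightarrow> f x"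
  proof (rule continuous_on_tendsto_compose[OF cont])
    show "X \<longlonglongrightarrow> x" using lim by (simp add: x_def)
    show "x \<in> ball 0 r \<inter> E" using xE xb start by (simp add: b_def)
    show "\<forall>\<^sub>F n in sequentially. X n \<in> ball 0 r \<inter> E" using inv inball by simp
  qed
  moreover have "(\<lambda>n. f (X n)) \<longlonglongrightarrow> y"
  proof -
    have "(\<lambda>n. (1 / 2 :: real) ^ n) \<longlonglongrightarrow> 0" by (rule LIMSEQ_power_zero) simp
    then have "(\<lambda>n. b * (1 / 2) ^ n) \<longlonglongrightarrow> 0" by (rule tendsto_mult_right_zero)
    moreover have "\<forall>\<^sub>F n in sequentially. norm (y - f (X n)) \<le> b * (1 / 2) ^ n" using inv by simp
    ultimately have "(\<lambda>n. y - f (X n)) \<longlonglongrightarrow> 0" by (rule Lim_null_comparison[rotated])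
    then have "(\<lambda>n. y - (y - f (X n))) \<longlonglongrightarrow> y - 0" by (rule tendsto_diff[OF tendsto_const])
    then show ?thesis by simp
  qed
  ultimately have "f x = y" by (rule LIMSEQ_unique)
  then show ?thesis using xE xb b_def by blast
qed

lemma bounded_linear_on_continuous:
  assumes E: "subspace E" and T: "bounded_linear_on E T" shows "continuous_on E T"
proof -
  obtain K where K: "K > 0" "\<forall>v\<in>E. norm (T v) \<le> K * norm v" by (rule bounded_linear_on_bound[OF T])
  have "K-lipschitz_on E T"
  proof (rule lipschitz_onI)
    fix u v assume "u \<in> E" "v \<in> E"
    then show "dist (T u) (T v) \<le> K * dist u v"
      using K(2)[rule_format, of "u - v"] subspace_diff[OF E, of u v] bounded_linear_on_diff[OF T, of u v] by (simp add: dist_norm)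
  qed (use K in simp)
  then show ?thesis by (rule lipschitz_on_continuous_on)
qed

text \<open>
  By Baire's theorem the closure of the image of some ball of \<open>E\<close> contains a ball of \<open>F\<close>. Therefore
  each \<open>w\<close> in \<open>F\<close> is matched up to an error of \<open>norm w / 2\<close> by an \<open>h\<close> with \<open>norm h \<le> M * norm w\<close>, and
  iteration removes the error.
\<close>

lemma open_mapping:
  fixes T :: "'e::banach \<Rightarrow> 'f::banach"
  assumes E: "banach_subspace E" and F: "banach_subspace F" and T: "bounded_linear_on E T" and surj: "T ` E = F"
  obtains C where "C > 0" "\<forall>w\<in>F. \<exists>h\<in>E. T h = w \<and> norm h \<le> C * norm w"
proof -
  have sE: "subspace E" "closed E" and sF: "subspace F" "closed F" using E F by (auto simp: banach_subspace_def)
  define A where "A n = closure (T ` (E \<inter> cball 0 (real n)))" for n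
  have AF: "A n \<subseteq> F" for n unfolding A_def using surj sF(2) by (intro closure_minimal) auto
  have cover: "(\<Union>n. A n) = F"
  proof
    show "F \<subseteq> (\<Union>n. A n)"
    proof
      fix w assume "w \<in> F"
      then obtain h where h: "h \<in> E" "T h = w" using surj by blast
      obtain n where "norm h \<le> real n" using real_arch_simple by blast
      then have "w \<in> A n" using h closure_subset unfolding A_def by fastforce
      then show "w \<in> (\<Union>n. A n)" by blast
    qed
  qed (use AF in blast)
  have "\<exists>n. (top_of_set F) interior_of (A n) \<noteq> {}"
  proof (rule ccontr)
    assume ne: "\<not> (\<exists>n. (top_of_set F) interior_of (A n) \<noteq> {})"
    have "(top_of_set F) interior_of (\<Union>(range A)) = {}"
    proof (intro Baire_category_alt)
      show "completely_metrizable_space (top_of_set F) \<or> locally_compact_space (top_of_set F) \<and> regular_space (top_of_set F)"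
        using completely_metrizable_space_closedin[OF completely_metrizable_space_euclidean, of F] sF(2) by simp
      show "countable (range A)" by simp
      fix S assume "S \<in> range A"
      then show "closedin (top_of_set F) S \<and> (top_of_set F) interior_of S = {}"
        using ne AF by (auto simp: A_def closed_subset)
    qed
    moreover have "(top_of_set F) interior_of F = F" using interior_of_topspace[of "top_of_set F"] by simp
    ultimately show False using cover subspace_0[OF sF(1)] by auto
  qed
  then obtain n w\<^sub>0 where "w\<^sub>0 \<in> (top_of_set F) interior_of (A n)" by blast
  then obtain W where W: "openin (top_of_set F) W" "w\<^sub>0 \<in> W" "W \<subseteq> A n" unfolding interior_of_def by blast
  obtain e where e: "e > 0" "ball w\<^sub>0 e \<inter> F \<subseteq> W" using W by (auto simp: openin_contains_ball)
  have w0F: "w\<^sub>0 \<in> F" using W openin_imp_subset by blast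
  \<comment> \<open>A ball about \<open>w\<^sub>0\<close> is turned into a ball about \<open>0\<close> by subtracting approximate preimages of
      \<open>w\<^sub>0 + w\<close> and \<open>w\<^sub>0\<close>; this doubles the radius \<open>n\<close>.\<close>
  have approx: "\<exists>h\<in>E. norm h \<le> 2 * real n \<and> norm (w - T h) < e / 4" if w: "w \<in> F" "norm w < e" for w
  proof -
    have "w\<^sub>0 + w \<in> A n" "w\<^sub>0 \<in> A n" using W e w w0F sF(1) by (auto simp: dist_norm subspace_add subset_iff)
    then obtain h1 h2 where h: "h1 \<in> E" "norm h1 \<le> real n" "dist (T h1) (w\<^sub>0 + w) < e / 8"
      "h2 \<in> E" "norm h2 \<le> real n" "dist (T h2) w\<^sub>0 < e / 8"
      using e(1) unfolding A_def closure_approachable by (fastforce dest!: spec[of _ "e / 8"])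
    have eq: "w - T (h1 - h2) = (w\<^sub>0 + w - T h1) - (w\<^sub>0 - T h2)"
      using bounded_linear_on_diff[OF T h(1,4)] by simp
    have "norm (w - T (h1 - h2)) \<le> norm (w\<^sub>0 + w - T h1) + norm (w\<^sub>0 - T h2)"
      unfolding eq by (rule norm_triangle_ineq4)
    also have "\<dots> < e / 4" using h(3,6) by (simp add: dist_norm norm_minus_commute)
    finally have "norm (w - T (h1 - h2)) < e / 4" .
    moreover have "norm (h1 - h2) \<le> 2 * real n" using norm_triangle_ineq4[of h1 h2] h(2,5) by simp
    ultimately show ?thesis using subspace_diff[OF sE(1) h(1,4)] by blast
  qed
  \<comment> \<open>Rescaling a vector to norm \<open>e / 2\<close> costs the factor \<open>4 * n / e\<close>; the summand \<open>1\<close> makes \<open>M\<close>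
      positive also for \<open>n = 0\<close>.\<close>
  define M where "M = 4 * real n / e + 1"
  have M: "M > 0" using e(1) by (simp add: M_def add_nonneg_pos)
  have half: "\<exists>h\<in>E. norm h \<le> M * norm w \<and> norm (w - T h) \<le> norm w / 2" if w: "w \<in> F" for w
  proof (cases "w = 0")
    case True
    have "T 0 = 0" using bounded_linear_on_diff[OF T, of 0 0] subspace_0[OF sE(1)] by simp
    then show ?thesis using True subspace_0[OF sE(1)] by (intro bexI[of _ 0]) auto
  next
    case False
    define s where "s = e / (2 * norm w)"
    have s: "s > 0" using False e(1) by (simp add: s_def)
    have "norm (s *\<^sub>R w) < e" "s *\<^sub>R w \<in> F" using False e(1) sF(1) w by (auto simp: s_def subspace_scale)
    then obtain h where h: "h \<in> E" "norm h \<le> 2 * real n" "norm (s *\<^sub>R w - T h) < e / 4" using approx by blast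
    have hE: "(1 / s) *\<^sub>R h \<in> E" using sE(1) h(1) by (rule subspace_scale)
    have "w - T ((1 / s) *\<^sub>R h) = (1 / s) *\<^sub>R (s *\<^sub>R w - T h)"
      using s by (simp add: bounded_linear_on_scale[OF T h(1)] algebra_simps)
    then have "norm (w - T ((1 / s) *\<^sub>R h)) = (1 / s) * norm (s *\<^sub>R w - T h)" using s by simp
    also have "\<dots> \<le> (1 / s) * (e / 4)" using h(3) s by (intro mult_left_mono) auto
    also have "\<dots> = norm w / 2" using e(1) False by (simp add: s_def)
    finally have 1: "norm (w - T ((1 / s) *\<^sub>R h)) \<le> norm w / 2" .
    have "norm ((1 / s) *\<^sub>R h) \<le> (1 / s) * (2 * real n)" using h(2) s by (simp add: divide_right_mono)
    also have "\<dots> = 4 * real n / e * norm w" using e(1) False by (simp add: s_def)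
    also have "\<dots> \<le> M * norm w" by (intro mult_right_mono) (simp_all add: M_def)
    finally show ?thesis using 1 hE by blast
  qed
  have T0: "T 0 = 0" using bounded_linear_on_diff[OF T, of 0 0] subspace_0[OF sE(1)] by simp
  have "\<exists>h\<in>E. T h = w \<and> norm h \<le> 2 * M * norm w" if w: "w \<in> F" for w
  proof -
    have "\<exists>x\<in>E. norm x \<le> 2 * M * norm (w - T 0) \<and> T x = w"
    proof (rule solve_by_approximate_corrections[OF sE, where r = "2 * M * norm w + 1"])
      show "continuous_on (ball 0 (2 * M * norm w + 1) \<inter> E) T"
        using bounded_linear_on_continuous[OF sE(1) T] continuous_on_subset by blast
      fix x assume x: "x \<in> E"
      have "w - T x \<in> F" using w x surj sF(1) by (auto intro: subspace_diff)
      then obtain h where h: "h \<in> E" "norm h \<le> M * norm (w - T x)" "norm (w - T x - T h) \<le> norm (w - T x) / 2"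
        using half by blast
      have "T (x + h) = T x + T h"
        using T x h(1) unfolding bounded_linear_on_def by (metis scaleR_one)
      then show "\<exists>h\<in>E. norm h \<le> M * norm (w - T x) \<and> (norm (x + h) < 2 * M * norm w + 1 \<longrightarrow> norm (w - T (x + h)) \<le> norm (w - T x) / 2)"
        using h by (intro bexI[of _ h]) (auto simp: algebra_simps)
    qed (use M T0 in auto)
    then show ?thesis using T0 by auto
  qed
  then show thesis using that[of "2 * M"] M by simp
qed

text \<open>
  \<open>Z\<close> stands for a level set of a map with derivative \<open>A\<close> at \<open>f 0\<close>; this enters only through the
  hypothesis that \<open>A (y - z) = o(y - z)\<close> for \<open>y\<close>, \<open>z\<close> in \<open>Z\<close>. For \<open>y\<close> in \<open>Z\<close> and \<open>w = y - f x\<close> choose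
  \<open>z\<close> with \<open>A z = A w\<close>, which is small compared to \<open>w\<close>, and then \<open>h\<close> with \<open>T h = w - z\<close>. The new error
  \<open>y - f (x + h)\<close> is the difference of \<open>z\<close> and \<open>f (x + h) - f x - T h\<close>, both small compared to \<open>w\<close>.
\<close>

lemma level_set_parametrized:
  fixes f :: "'x::banach \<Rightarrow> 'e::banach" and A :: "'e \<Rightarrow> 'f::banach"
  assumes E: "banach_subspace E" and F: "banach_subspace F"
    and A: "bounded_linear_on E A" "A ` E = F"
    and T: "bounded_linear T" "inj T" "range T = {v \<in> E. A v = 0}"
    and f: "\<And>e. e > 0 \<Longrightarrow> \<exists>d>0. \<forall>x y. norm x < d \<longrightarrow> norm y < d \<longrightarrow> norm (f x - f y - T (x - y)) \<le> e * norm (x - y)"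
    and Z: "Z \<subseteq> E" "\<And>e. e > 0 \<Longrightarrow> \<exists>d>0. \<forall>y\<in>Z. \<forall>z\<in>Z. norm (y - f 0) < d \<longrightarrow> norm (z - f 0) < d \<longrightarrow> norm (A (y - z)) \<le> e * norm (y - z)"
    and r0: "r\<^sub>0 > 0" "f ` ball 0 r\<^sub>0 \<subseteq> Z"
  obtains r c d where "0 < r" "r \<le> r\<^sub>0" "c > 0" "continuous_on (ball 0 r) f"
    "\<forall>x y. norm x < r \<longrightarrow> norm y < r \<longrightarrow> c * norm (x - y) \<le> norm (f x - f y)"
    "d > 0" "\<forall>y\<in>Z. norm (y - f 0) < d \<longrightarrow> (\<exists>x. norm x < r \<and> f x = y)"
proof -
  interpret T: bounded_linear T by fact
  have sE: "subspace E" "closed E" using E by (auto simp: banach_subspace_def)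
  obtain C\<^sub>1 where C1: "C\<^sub>1 > 0" "\<forall>w\<in>F. \<exists>z\<in>E. A z = w \<and> norm z \<le> C\<^sub>1 * norm w"
    by (rule open_mapping[OF E F A])
  let ?K = "{v \<in> E. A v = 0}"
  have K: "banach_subspace ?K"
    unfolding banach_subspace_def
  proof
    show "subspace ?K"
      by (metis T(1,3) bounded_linear.linear linear_subspace_image subspace_UNIV)
    have "?K = E \<inter> A -` {0}" by auto
    then show "closed ?K"
      using continuous_closed_preimage[OF bounded_linear_on_continuous[OF sE(1) A(1)] sE(2) closed_singleton] by simp
  qed
  have UNIV: "banach_subspace (UNIV :: 'x set)" by (simp add: banach_subspace_def)
  obtain C\<^sub>2 where C2: "C\<^sub>2 > 0" "\<forall>w\<in>?K. \<exists>h\<in>UNIV. T h = w \<and> norm h \<le> C\<^sub>2 * norm w"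
    by (rule open_mapping[OF UNIV K _ T(3)]) (simp add: bounded_linear_on_UNIV T(1))
  have below: "norm h \<le> C\<^sub>2 * norm (T h)" for h
    using C2(2) T(2,3) by (metis (no_types, lifting) inj_eq rangeI)
  \<comment> \<open>The constants \<open>1 / (8 * C\<^sub>2)\<close> and \<open>\<epsilon>\<close> make each of the two contributions to the new error at most a
      quarter of the old error.\<close>
  obtain d1 where d1: "d1 > 0" "\<And>x y. norm x < d1 \<Longrightarrow> norm y < d1 \<Longrightarrow> norm (f x - f y - T (x - y)) \<le> 1 / (8 * C\<^sub>2) * norm (x - y)"
    using f[of "1 / (8 * C\<^sub>2)"] C2(1) by auto
  define \<epsilon> where "\<epsilon> = 1 / (4 * C\<^sub>1)"
  have \<epsilon>: "\<epsilon> > 0" "C\<^sub>1 * \<epsilon> = 1 / 4" using C1(1) by (simp_all add: \<epsilon>_def)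
  obtain d2 where d2: "d2 > 0" "\<And>y z. y \<in> Z \<Longrightarrow> z \<in> Z \<Longrightarrow> norm (y - f 0) < d2 \<Longrightarrow> norm (z - f 0) < d2 \<Longrightarrow> norm (A (y - z)) \<le> \<epsilon> * norm (y - z)"
    using Z(2)[OF \<epsilon>(1)] by blast
  define r where "r = min r\<^sub>0 d1"
  have r: "0 < r" "r \<le> r\<^sub>0" "r \<le> d1" using r0(1) d1(1) by (auto simp: r_def)
  define c where "c = 1 / (2 * C\<^sub>2)"
  have lower: "c * norm (x - y) \<le> norm (f x - f y)" if "norm x < r" "norm y < r" for x y :: 'x
  proof -
    have "norm (x - y) / C\<^sub>2 \<le> norm (T (x - y))" using below[of "x - y"] C2(1) by (simp add: field_simps)
    also have "\<dots> \<le> norm (f x - f y) + norm (f x - f y - T (x - y))"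
      using norm_triangle_ineq4[of "f x - f y" "f x - f y - T (x - y)"] by simp
    also have "\<dots> \<le> norm (f x - f y) + 1 / (8 * C\<^sub>2) * norm (x - y)" using d1(2)[of x y] that r by simp
    finally have "7 / 8 * (norm (x - y) / C\<^sub>2) \<le> norm (f x - f y)" by (simp add: field_simps)
    moreover have "1 / 2 * (norm (x - y) / C\<^sub>2) \<le> 7 / 8 * (norm (x - y) / C\<^sub>2)" using C2(1) by (intro mult_right_mono) auto
    ultimately show ?thesis by (simp add: c_def)
  qed
  \<comment> \<open>The iterates \<open>f x\<close> stay within \<open>2 * d\<close> of \<open>f 0\<close>, and \<open>x\<close> stays within \<open>4 * C\<^sub>2 * d\<close> of \<open>0\<close>.\<close>
  define d where "d = min (d2 / 2) (r / (8 * C\<^sub>2))"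
  have d: "d > 0" "2 * d \<le> d2" "8 * C\<^sub>2 * d \<le> r" using d2(1) r(1) C2(1) by (auto simp: d_def min_def field_simps)
  have cont: "continuous_on (ball 0 r \<inter> UNIV) f"
  proof -
    obtain B where B: "B > 0" "\<And>v. norm (T v) \<le> norm v * B" using T.pos_bounded by blast
    have "(B + 1 / (8 * C\<^sub>2))-lipschitz_on (ball 0 r \<inter> UNIV) f"
    proof (rule lipschitz_onI)
      fix x y :: 'x assume "x \<in> ball 0 r \<inter> UNIV" "y \<in> ball 0 r \<inter> UNIV"
      then have "norm (f x - f y - T (x - y)) \<le> 1 / (8 * C\<^sub>2) * norm (x - y)" using d1(2) r by simp
      then have "norm (f x - f y) \<le> 1 / (8 * C\<^sub>2) * norm (x - y) + norm (x - y) * B"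
        using norm_triangle_ineq[of "f x - f y - T (x - y)" "T (x - y)"] B(2)[of "x - y"] by simp
      then show "dist (f x) (f y) \<le> (B + 1 / (8 * C\<^sub>2)) * dist x y" by (simp add: dist_norm algebra_simps)
    qed (use B(1) C2(1) in simp)
    then show ?thesis by (rule lipschitz_on_continuous_on)
  qed
  have onto: "\<exists>x. norm x < r \<and> f x = y" if y: "y \<in> Z" "norm (y - f 0) < d" for y
  proof -
    have "\<exists>x\<in>UNIV. norm x \<le> 2 * (2 * C\<^sub>2) * norm (y - f 0) \<and> f x = y"
    proof (rule solve_by_approximate_corrections[OF subspace_UNIV closed_UNIV cont])
      show "2 * C\<^sub>2 \<ge> 0" using C2(1) by simp
      have "8 * C\<^sub>2 * norm (y - f 0) < 8 * C\<^sub>2 * d" using y(2) C2(1) by (intro mult_strict_left_mono) auto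
      then have "8 * (C\<^sub>2 * norm (y - f 0)) < r" using d(3) by (simp add: mult.assoc)
      moreover have "0 \<le> C\<^sub>2 * norm (y - f 0)" using C2(1) by simp
      ultimately show "2 * (2 * C\<^sub>2) * norm (y - f 0) < r" by (simp add: mult.assoc)
      fix x assume x: "norm x < r" "norm (y - f x) \<le> norm (y - f 0)"
      let ?w = "y - f x"
      have fx: "f x \<in> Z" using r0(2) x(1) r(2) by auto
      have "f x - f 0 = (y - f 0) - ?w" by simp
      then have "norm (f x - f 0) \<le> norm (y - f 0) + norm ?w" by (metis norm_triangle_ineq4)
      then have near: "norm (f x - f 0) < d2" "norm (y - f 0) < d2" using x(2) y(2) d(1,2) by linarith+
      have wE: "?w \<in> E" using y(1) fx Z(1) sE(1) by (auto intro: subspace_diff)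
      have Aw: "norm (A ?w) \<le> \<epsilon> * norm ?w" by (rule d2(2)[OF y(1) fx near(2,1)])
      obtain z where z: "z \<in> E" "A z = A ?w" "norm z \<le> C\<^sub>1 * norm (A ?w)" using C1(2) A(2) wE by blast
      have "C\<^sub>1 * norm (A ?w) \<le> C\<^sub>1 * (\<epsilon> * norm ?w)" using Aw C1(1) by (intro mult_left_mono) auto
      then have z1: "norm z \<le> norm ?w / 4" using z(3) \<epsilon>(2) by (simp flip: mult.assoc)
      have "?w - z \<in> ?K" using wE z sE(1) by (simp add: subspace_diff bounded_linear_on_diff[OF A(1)])
      then obtain h where h: "T h = ?w - z" "norm h \<le> C\<^sub>2 * norm (?w - z)" using C2(2) by blast
      have "norm (?w - z) \<le> 2 * norm ?w" using norm_triangle_ineq4[of ?w z] z1 norm_ge_zero[of ?w] by linarith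
      then have "C\<^sub>2 * norm (?w - z) \<le> C\<^sub>2 * (2 * norm ?w)" using C2(1) by (intro mult_left_mono) auto
      then have h1: "norm h \<le> 2 * C\<^sub>2 * norm ?w" using h(2) by simp
      have "norm (y - f (x + h)) \<le> norm ?w / 2" if "norm (x + h) < r"
      proof -
        have "norm (f (x + h) - f x - T h) \<le> 1 / (8 * C\<^sub>2) * norm h"
          using d1(2)[of "x + h" x] that x(1) r(3) by simp
        also have "\<dots> \<le> 1 / (8 * C\<^sub>2) * (2 * C\<^sub>2 * norm ?w)" using h1 C2(1) by (intro mult_left_mono) auto
        also have "\<dots> = norm ?w / 4" using C2(1) by simp
        finally have 1: "norm (f (x + h) - f x - T h) \<le> norm ?w / 4" .
        have eq: "y - f (x + h) = z - (f (x + h) - f x - T h)" by (simp add: h(1))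
        have "norm (y - f (x + h)) \<le> norm z + norm (f (x + h) - f x - T h)"
          unfolding eq by (rule norm_triangle_ineq4)
        then show ?thesis using z1 1 by linarith
      qed
      then show "\<exists>h\<in>UNIV. norm h \<le> 2 * C\<^sub>2 * norm (y - f x) \<and> (norm (x + h) < r \<longrightarrow> norm (y - f (x + h)) \<le> norm (y - f x) / 2)"
        using h1 by blast
    qed
    then obtain x where x: "norm x \<le> 4 * C\<^sub>2 * norm (y - f 0)" "f x = y" by auto
    have "8 * C\<^sub>2 * norm (y - f 0) < 8 * C\<^sub>2 * d" using y(2) C2(1) by (intro mult_strict_left_mono) auto
    moreover have "0 \<le> C\<^sub>2 * norm (y - f 0)" using C2(1) by simp
    ultimately have "norm x < r" using x(1) d(3) by (simp add: mult.assoc)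
    then show ?thesis using x(2) by blast
  qed
  show thesis
    by (rule that[of r c d]) (use r lower d(1) onto C2(1) cont in \<open>auto simp: c_def\<close>)
qed

section \<open>Charts\<close>

lemma chart_dom_subset: "chart_on M c \<Longrightarrow> cdom c \<subseteq> topspace M"
  unfolding chart_on_def using openin_subset by blast

lemma chart_inj: assumes "chart_on M c" shows "inj_on (cmap c) (cdom c)"
proof -
  have "inj_on (cmap c) (topspace (subtopology M (cdom c)))"
    using assms unfolding chart_on_def by (intro homeomorphic_imp_injective_map) auto
  then show ?thesis using chart_dom_subset[OF assms] by (simp add: inf_absorb2)
qed

lemma cinv_cmap: "chart_on M c \<Longrightarrow> p \<in> cdom c \<Longrightarrow> cinv c (cmap c p) = p"
  unfolding cinv_def by (rule inv_into_f_f[OF chart_inj])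

lemma chart_subspace: "chart_on M c \<Longrightarrow> subspace (cmodel c)"
  and chart_closed: "chart_on M c \<Longrightarrow> closed (cmodel c)"
  by (simp_all add: chart_on_def banach_subspace_def)

lemma chart_open_image:
  assumes c: "chart_on M c" and W: "openin M W"
  shows "openin (top_of_set (cmodel c)) (cmap c ` (cdom c \<inter> W))"
proof -
  have "openin (subtopology M (cdom c)) (cdom c \<inter> W)" using W by (auto simp: openin_subtopology)
  then have "openin (top_of_set (cmap c ` cdom c)) (cmap c ` (cdom c \<inter> W))"
    using c homeomorphic_imp_open_map unfolding chart_on_def open_map_def by blast
  moreover have "openin (top_of_set (cmodel c)) (cmap c ` cdom c)" using c by (simp add: chart_on_def)
  ultimately show ?thesis by (rule openin_trans)
qed

lemma chart_image_subset: "chart_on M c \<Longrightarrow> cmap c ` cdom c \<subseteq> cmodel c"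
  unfolding chart_on_def using openin_imp_subset by blast

lemma chart_continuous:
  "chart_on M c \<Longrightarrow> continuous_map (subtopology M (cdom c)) (top_of_set (cmap c ` cdom c)) (cmap c)"
  unfolding chart_on_def using homeomorphic_imp_continuous_map by blast

lemma chart_open_preimage:
  assumes c: "chart_on M c" and Y: "open Y"
  shows "openin M {p \<in> cdom c. cmap c p \<in> Y}"
proof -
  have "continuous_map (subtopology M (cdom c)) euclidean (cmap c)"
    using chart_continuous[OF c] by (simp add: continuous_map_in_subtopology)
  then have "openin (subtopology M (cdom c)) {p \<in> topspace (subtopology M (cdom c)). cmap c p \<in> Y}"
    using Y by (intro openin_continuous_map_preimage) auto
  moreover have "{p \<in> topspace (subtopology M (cdom c)). cmap c p \<in> Y} = {p \<in> cdom c. cmap c p \<in> Y}"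
    using chart_dom_subset[OF c] by auto
  ultimately show ?thesis using c by (simp add: chart_on_def openin_open_subtopology)
qed

lemma manifold_chart: "banach_manifold k M A \<Longrightarrow> c \<in> A \<Longrightarrow> chart_on M c"
  by (simp add: banach_manifold_def)

lemma manifold_chart_exists:
  assumes "banach_manifold k M A" "p \<in> topspace M" obtains c where "c \<in> A" "p \<in> cdom c"
  using assms unfolding banach_manifold_def by blast

lemma manifold_id: "banach_manifold k M A \<Longrightarrow> Ck_map k M A M A id"
  unfolding banach_manifold_def Ck_map_def by simp

section \<open>Differentials in charts\<close>

definition local_diff ::
  "('m, 'e::banach) chart \<Rightarrow> ('n, 'f::banach) chart \<Rightarrow> ('m \<Rightarrow> 'n) \<Rightarrow> 'm \<Rightarrow> 'e \<Rightarrow> 'f" where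
  "local_diff c d f p = derivative_in (cmodel c) (cmap d \<circ> f \<circ> cinv c) (cmap c p)"

lemma representative_domain_open:
  assumes "chart_on M c" "chart_on N d" "continuous_map M N f"
  shows "openin (top_of_set (cmodel c)) (cmap c ` (cdom c \<inter> f -` cdom d))"
proof -
  have "openin M {x \<in> topspace M. f x \<in> cdom d}"
    using assms(2,3) by (intro openin_continuous_map_preimage) (auto simp: chart_on_def)
  from chart_open_image[OF assms(1) this]
  moreover have "cdom c \<inter> {x \<in> topspace M. f x \<in> cdom d} = cdom c \<inter> f -` cdom d"
    using chart_dom_subset[OF assms(1)] by auto
  ultimately show ?thesis by simp
qed

lemma local_diff_derivative:
  assumes k: "1 \<le> k" and M: "banach_manifold k M A" and N: "banach_manifold k N B" and f: "Ck_map k M A N B f"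
    and c: "c \<in> A" "p \<in> cdom c" and d: "d \<in> B" "f p \<in> cdom d"
  obtains L where "has_derivative_in (cmodel c) (cmap d \<circ> f \<circ> cinv c) L (cmap c p)"
    "\<forall>v\<in>cmodel c. local_diff c d f p v = L v"
proof -
  note cc = manifold_chart[OF M c(1)] and dd = manifold_chart[OF N d(1)]
  let ?U = "cmap c ` (cdom c \<inter> f -` cdom d)"
  have U: "openin (top_of_set (cmodel c)) ?U"
    using representative_domain_open[OF cc dd] f by (simp add: Ck_map_def)
  have Ck: "Ck_on k (cmodel c) ?U (cmap d \<circ> f \<circ> cinv c)" using f c d by (simp add: Ck_map_def)
  obtain L where L: "\<forall>x\<in>?U. has_derivative_in (cmodel c) (cmap d \<circ> f \<circ> cinv c) (L x) x"
    "\<forall>x\<in>?U. \<forall>e>0. \<forall>\<^sub>F y in at x within cmodel c. \<forall>v\<in>cmodel c. norm (L y v - L x v) \<le> e * norm v"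
    by (rule Ck_on_derivative[OF Ck k chart_subspace[OF cc] U])
  have "cmap c p \<in> ?U" using c d by auto
  then have "has_derivative_in (cmodel c) (cmap d \<circ> f \<circ> cinv c) (L (cmap c p)) (cmap c p)" using L by blast
  then show thesis using that derivative_in_eq[OF chart_subspace[OF cc]] unfolding local_diff_def by blast
qed

lemma local_diff_0:
  assumes k: "1 \<le> k" and M: "banach_manifold k M A" and N: "banach_manifold k N B" and f: "Ck_map k M A N B f"
    and c: "c \<in> A" "p \<in> cdom c" and d: "d \<in> B" "f p \<in> cdom d"
  shows "local_diff c d f p 0 = 0"
proof -
  note E = chart_subspace[OF manifold_chart[OF M c(1)]]
  obtain L where L: "has_derivative_in (cmodel c) (cmap d \<circ> f \<circ> cinv c) L (cmap c p)"
    "\<forall>v\<in>cmodel c. local_diff c d f p v = L v" by (rule local_diff_derivative[OF assms])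
  then show ?thesis
    using bounded_linear_on_diff[of "cmodel c" L 0 0] subspace_0[OF E] by (simp add: has_derivative_in_def)
qed

lemma local_diff_chain:
  assumes k: "1 \<le> k" and M: "banach_manifold k M A" and N: "banach_manifold k N B" and P: "banach_manifold k P C"
    and f: "Ck_map k M A N B f" and g: "Ck_map k N B P C g"
    and c: "c \<in> A" "p \<in> cdom c" and d: "d \<in> B" "f p \<in> cdom d" and e: "e \<in> C" "g (f p) \<in> cdom e"
    and v: "v \<in> cmodel c"
  shows "local_diff d e g (f p) (local_diff c d f p v) = local_diff c e (g \<circ> f) p v"
    and "local_diff c d f p v \<in> cmodel d"
proof -
  note cc = manifold_chart[OF M c(1)] and dd = manifold_chart[OF N d(1)] and ee = manifold_chart[OF P e(1)]
  obtain L where L: "has_derivative_in (cmodel c) (cmap d \<circ> f \<circ> cinv c) L (cmap c p)"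
    "\<forall>v\<in>cmodel c. local_diff c d f p v = L v" by (rule local_diff_derivative[OF k M N f c d])
  obtain L' where L': "has_derivative_in (cmodel d) (cmap e \<circ> g \<circ> cinv d) L' (cmap d (f p))"
    "\<forall>v\<in>cmodel d. local_diff d e g (f p) v = L' v" by (rule local_diff_derivative[OF k N P g d e])
  let ?U = "cmap c ` (cdom c \<inter> f -` cdom d)"
  have U: "openin (top_of_set (cmodel c)) ?U"
    using representative_domain_open[OF cc dd] f by (simp add: Ck_map_def)
  have pU: "cmap c p \<in> ?U" using c d by auto
  have im: "(cmap d \<circ> f \<circ> cinv c) ` ?U \<subseteq> cmodel d"
    using chart_image_subset[OF dd] by (auto simp: cinv_cmap[OF cc])
  have pt: "(cmap d \<circ> f \<circ> cinv c) (cmap c p) = cmap d (f p)" using cinv_cmap[OF cc] c by simp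
  note chain = has_derivative_in_chain[OF chart_subspace[OF cc] chart_subspace[OF dd] chart_closed[OF dd] U pU im L(1), unfolded pt, OF L'(1)]
  show dv: "local_diff c d f p v \<in> cmodel d" using chain(2) L(2) v by auto
  have "has_derivative_in (cmodel c) (cmap e \<circ> (g \<circ> f) \<circ> cinv c) (L' \<circ> L) (cmap c p)"
    by (rule has_derivative_in_transform[OF chart_subspace[OF cc] U pU _ chain(1)])
      (auto simp: cinv_cmap[OF cc] cinv_cmap[OF dd])
  then have "local_diff c e (g \<circ> f) p v = (L' \<circ> L) v"
    unfolding local_diff_def by (rule derivative_in_eq[OF chart_subspace[OF cc] _ v])
  then show "local_diff d e g (f p) (local_diff c d f p v) = local_diff c e (g \<circ> f) p v"
    using L(2) L'(2) v dv by simp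
qed

lemma local_diff_id:
  assumes c: "chart_on M c" "p \<in> cdom c" and v: "v \<in> cmodel c"
  shows "local_diff c c id p v = v"
proof -
  let ?U = "cmap c ` (cdom c \<inter> cdom c)"
  have U: "openin (top_of_set (cmodel c)) ?U" using chart_open_image[OF c(1)] c(1) unfolding chart_on_def by blast
  have "has_derivative_in (cmodel c) (\<lambda>y. y) (\<lambda>v. v) (cmap c p)"
    unfolding has_derivative_in_iff bounded_linear_on_def by (auto intro!: exI[of _ 1])
  then have "has_derivative_in (cmodel c) (cmap c \<circ> id \<circ> cinv c) (\<lambda>v. v) (cmap c p)"
    by (rule has_derivative_in_transform[OF chart_subspace[OF c(1)] U, rotated -1])
      (use c in \<open>auto simp: cinv_cmap\<close>)
  then show ?thesis unfolding local_diff_def by (rule derivative_in_eq[OF chart_subspace[OF c(1)] _ v])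
qed

lemma tangent_vector_local_diff:
  "tangent_vector A p c v = {(d, local_diff c d id p v) | d. d \<in> A \<and> p \<in> cdom d}"
  by (simp add: tangent_vector_def local_diff_def)

lemma tangent_vector_change_chart:
  assumes k: "1 \<le> k" and M: "banach_manifold k M A" and c: "c \<in> A" "p \<in> cdom c" and c': "c' \<in> A" "p \<in> cdom c'"
    and v: "v \<in> cmodel c"
  shows "tangent_vector A p c' (local_diff c c' id p v) = tangent_vector A p c v"
proof -
  have *: "local_diff c' d id p (local_diff c c' id p v) = local_diff c d id p v" if "d \<in> A" "p \<in> cdom d" for d
    using local_diff_chain(1)[OF k M M M manifold_id[OF M] manifold_id[OF M] c c'(1) _ that(1) _ v] c' that by simp
  show ?thesis unfolding tangent_vector_local_diff by (auto simp: *)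
qed

lemma tangent_space_chart:
  assumes k: "1 \<le> k" and M: "banach_manifold k M A" and c: "c \<in> A" "p \<in> cdom c"
  shows "tangent_space A p = tangent_vector A p c ` cmodel c"
proof
  show "tangent_space A p \<subseteq> tangent_vector A p c ` cmodel c"
  proof
    fix \<xi> assume "\<xi> \<in> tangent_space A p"
    then obtain c' v where \<xi>: "\<xi> = tangent_vector A p c' v" "c' \<in> A" "p \<in> cdom c'" "v \<in> cmodel c'"
      unfolding tangent_space_def by blast
    have "local_diff c' c id p v \<in> cmodel c"
      using local_diff_chain(2)[OF k M M M manifold_id[OF M] manifold_id[OF M] \<xi>(2,3) c(1) _ c(1) _ \<xi>(4)] c by simp
    moreover have "\<xi> = tangent_vector A p c (local_diff c' c id p v)"
      using tangent_vector_change_chart[OF k M \<xi>(2,3) c \<xi>(4)] \<xi>(1) by simp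
    ultimately show "\<xi> \<in> tangent_vector A p c ` cmodel c" by blast
  qed
qed (use c in \<open>auto simp: tangent_space_def\<close>)

lemma tangent_vector_inj:
  assumes c: "chart_on M c" "c \<in> A" "p \<in> cdom c"
  shows "inj_on (tangent_vector A p c) (cmodel c)"
proof (rule inj_onI)
  fix v w assume vw: "v \<in> cmodel c" "w \<in> cmodel c" "tangent_vector A p c v = tangent_vector A p c w"
  have "(c, local_diff c c id p v) \<in> tangent_vector A p c w"
    unfolding vw(3)[symmetric] using c by (simp add: tangent_vector_local_diff)
  then have "local_diff c c id p v = local_diff c c id p w" by (simp add: tangent_vector_local_diff)
  then show "v = w" using local_diff_id[OF c(1,3)] vw by simp
qed

lemma tangent_zero_chart:
  assumes k: "1 \<le> k" and M: "banach_manifold k M A" and c: "c \<in> A" "p \<in> cdom c"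
  shows "tangent_zero A p = tangent_vector A p c 0"
  unfolding tangent_zero_def tangent_vector_local_diff
  by (auto simp: local_diff_0[OF k M M manifold_id[OF M] c])

text \<open>
  By the chain rule, the representative of the tangent vector in any other chart contributes the
  same pairs as \<open>(c, v)\<close>.
\<close>

lemma differential_chart:
  assumes k: "1 \<le> k" and M: "banach_manifold k M A" and N: "banach_manifold k N B" and f: "Ck_map k M A N B f"
    and c: "c \<in> A" "p \<in> cdom c" and d: "d \<in> B" "f p \<in> cdom d" and v: "v \<in> cmodel c"
  shows "differential A B f p (tangent_vector A p c v) = tangent_vector B (f p) d (local_diff c d f p v)"
proof -
  have 1: "local_diff c' d' f p (local_diff c c' id p v) = local_diff c d' f p v"
    if "c' \<in> A" "p \<in> cdom c'" "d' \<in> B" "f p \<in> cdom d'" for c' d'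
    using local_diff_chain(1)[OF k M M N manifold_id[OF M] f c that(1) _ that(3) _ v] that by simp
  have 2: "local_diff d d' id (f p) (local_diff c d f p v) = local_diff c d' f p v"
    if "d' \<in> B" "f p \<in> cdom d'" for d'
    using local_diff_chain(1)[OF k M N N f manifold_id[OF N] c d that(1) _ v] that by simp
  have "differential A B f p (tangent_vector A p c v) =
    {(d', local_diff c' d' f p (local_diff c c' id p v)) | c' d'. c' \<in> A \<and> p \<in> cdom c' \<and> d' \<in> B \<and> f p \<in> cdom d'}"
    unfolding differential_def tangent_vector_local_diff by (auto simp: local_diff_def)
  also have "\<dots> = {(d', local_diff c d' f p v) | d'. d' \<in> B \<and> f p \<in> cdom d'}" using c by (auto simp: 1 intro!: exI[of _ c])
  also have "\<dots> = tangent_vector B (f p) d (local_diff c d f p v)"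
    unfolding tangent_vector_local_diff by (auto simp: 2)
  finally show ?thesis .
qed

lemma differential_image_chart:
  assumes k: "1 \<le> k" and M: "banach_manifold k M A" and N: "banach_manifold k N B" and f: "Ck_map k M A N B f"
    and c: "c \<in> A" "p \<in> cdom c" and d: "d \<in> B" "f p \<in> cdom d"
  shows "differential A B f p ` tangent_space A p = tangent_vector B (f p) d ` (local_diff c d f p ` cmodel c)"
  unfolding tangent_space_chart[OF k M c] image_image using differential_chart[OF assms] by (intro image_cong) auto

lemma differential_inj_chart:
  assumes k: "1 \<le> k" and M: "banach_manifold k M A" and N: "banach_manifold k N B" and f: "Ck_map k M A N B f"
    and c: "c \<in> A" "p \<in> cdom c" and d: "d \<in> B" "f p \<in> cdom d"
  shows "inj_on (differential A B f p) (tangent_space A p) \<longleftrightarrow> inj_on (local_diff c d f p) (cmodel c)"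
proof -
  let ?t = "tangent_vector A p c" and ?s = "tangent_vector B (f p) d"
  have t: "inj_on ?t (cmodel c)" using tangent_vector_inj[OF manifold_chart[OF M c(1)] c] .
  have s: "inj_on ?s (cmodel d)" using tangent_vector_inj[OF manifold_chart[OF N d(1)] d] .
  have im: "local_diff c d f p ` cmodel c \<subseteq> cmodel d"
    using local_diff_chain(2)[OF k M N N f manifold_id[OF N] c d d(1)] d by auto
  have "inj_on (differential A B f p) (tangent_space A p) \<longleftrightarrow> inj_on (differential A B f p \<circ> ?t) (cmodel c)"
    unfolding tangent_space_chart[OF k M c] using comp_inj_on_iff[OF t] by blast
  also have "\<dots> \<longleftrightarrow> inj_on (?s \<circ> local_diff c d f p) (cmodel c)"
    by (rule inj_on_cong) (simp add: differential_chart[OF assms])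
  also have "\<dots> \<longleftrightarrow> inj_on (local_diff c d f p) (cmodel c)"
    using inj_on_imageI2 comp_inj_on inj_on_subset[OF s im] by blast
  finally show ?thesis .
qed

lemma differential_kernel_chart:
  assumes k: "1 \<le> k" and M: "banach_manifold k M A" and N: "banach_manifold k N B" and f: "Ck_map k M A N B f"
    and c: "c \<in> A" "p \<in> cdom c" and d: "d \<in> B" "f p \<in> cdom d"
  shows "differential_kernel A B f p = tangent_vector A p c ` {v \<in> cmodel c. local_diff c d f p v = 0}"
proof -
  have s: "inj_on (tangent_vector B (f p) d) (cmodel d)" using tangent_vector_inj[OF manifold_chart[OF N d(1)] d] .
  have "differential A B f p (tangent_vector A p c v) = tangent_zero B (f p) \<longleftrightarrow> local_diff c d f p v = 0"
    if v: "v \<in> cmodel c" for v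
    unfolding differential_chart[OF assms v] tangent_zero_chart[OF k N d]
    by (rule inj_on_eq_iff[OF s])
      (use local_diff_chain(2)[OF k M N N f manifold_id[OF N] c d d(1) _ v] d
         subspace_0[OF chart_subspace[OF manifold_chart[OF N d(1)]]] in auto)
  then show ?thesis unfolding differential_kernel_def tangent_space_chart[OF k M c] by auto
qed

section \<open>Charts of the level set\<close>

lemma cinv_open_set_atlas: "x \<in> U \<Longrightarrow> cinv (Chart U id E) x = x"
  using inv_into_f_f[of id U x] by (simp add: cinv_def)

lemma open_set_manifold:
  assumes "open U" shows "banach_manifold k (top_of_set U) (open_set_atlas U)"
  unfolding banach_manifold_def open_set_atlas_def
proof (intro conjI ballI)
  fix c d assume "c \<in> {Chart U id (UNIV :: 'a set)}" "d \<in> {Chart U id (UNIV :: 'a set)}"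
  then show "Ck_on k (cmodel c) (cmap c ` (cdom c \<inter> cdom d)) (cmap d \<circ> cinv c)"
    using Ck_on_subset_cong[OF Ck_on_ident[of k U], of U "id \<circ> cinv (Chart U id (UNIV :: 'a set))"]
    by (simp add: cinv_open_set_atlas)
next
  fix c assume "c \<in> {Chart U id (UNIV :: 'a set)}"
  then show "chart_on (top_of_set U) c"
    using assms by (simp add: chart_on_def banach_subspace_def homeomorphic_map_id subtopology_subtopology)
qed simp

text \<open>
  What is needed to change from or to the chart \<open>s\<close>: its inverse is \<open>C\<^sup>k\<close> in all charts of \<open>M\<close>,
  and bounded from below in one chart of \<open>M\<close> that contains its domain.
\<close>

definition adapted_chart ::
  "enat \<Rightarrow> 'm topology \<Rightarrow> ('m, 'e::banach) chart set \<Rightarrow> 'm set \<Rightarrow> ('m, 'x::banach) chart \<Rightarrow> bool" where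
  "adapted_chart k M A S s \<longleftrightarrow> chart_on (subtopology M S) s \<and> cmodel s = UNIV \<and>
     (\<forall>a\<in>A. Ck_on k UNIV (cmap s ` (cdom s \<inter> cdom a)) (cmap a \<circ> cinv s)) \<and>
     (\<exists>a\<in>A. cdom s \<subseteq> cdom a \<and> (\<exists>K>0. \<forall>x\<in>cmap s ` cdom s. \<forall>y\<in>cmap s ` cdom s.
        K * norm (x - y) \<le> norm (cmap a (cinv s x) - cmap a (cinv s y))))"

text \<open>
  The chart is a local inverse of \<open>\<phi>\<close>, which exists by \<open>level_set_parametrized\<close>. Its domain is the part
  of \<open>S\<close> over a ball in the chart \<open>c\<close>. As \<open>\<phi>\<close> is the inverse of this chart, the inclusion of \<open>S\<close> has
  at \<open>p\<close> the same differential as \<open>\<phi>\<close> at \<open>0\<close>.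
\<close>

lemma level_set_chart:
  fixes M :: "'m topology" and A :: "('m, 'e::banach) chart set"
    and N :: "'n topology" and B :: "('n, 'f::banach) chart set" and \<phi> :: "'x::banach \<Rightarrow> 'm"
  assumes k: "1 \<le> k" and M: "banach_manifold k M A" and N: "banach_manifold k N B"
    and psi: "Ck_map k M A N B \<psi>" and S: "S = {p \<in> topspace M. \<psi> p = q}" and p: "p \<in> S"
    and regular: "differential A B \<psi> p ` tangent_space A p = tangent_space B q"
    and U: "open U" "0 \<in> U" and phi: "Ck_map k (top_of_set U) (open_set_atlas U) M A \<phi>"
      "\<phi> ` U \<subseteq> S" "\<phi> 0 = p"
    and inj: "inj_on (differential (open_set_atlas U) A \<phi> 0) (tangent_space (open_set_atlas U) 0)"
    and ker: "differential (open_set_atlas U) A \<phi> 0 ` tangent_space (open_set_atlas U) 0 = differential_kernel A B \<psi> p"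
    and c: "c \<in> A" "p \<in> cdom c" and d: "d \<in> B" "q \<in> cdom d"
  shows "\<exists>s :: ('m, 'x) chart. adapted_chart k M A S s \<and> p \<in> cdom s \<and>
    inj (local_diff s c id p) \<and> range (local_diff s c id p) = {v \<in> cmodel c. local_diff c d \<psi> p v = 0}"
proof -
  note cc = manifold_chart[OF M c(1)] and dd = manifold_chart[OF N d(1)]
  define E where "E = cmodel c"
  have sE: "subspace E" and bE: "banach_subspace E" and bF: "banach_subspace (cmodel d)"
    using cc dd by (simp_all add: E_def chart_on_def banach_subspace_def)
  have \<psi>p: "\<psi> p = q" and ST: "S \<subseteq> topspace M" using S p by auto
  let ?o = "Chart U id (UNIV :: 'x set)"
  have oA: "?o \<in> open_set_atlas U" "0 \<in> cdom ?o" using U by (auto simp: open_set_atlas_def)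
  note OM = open_set_manifold[OF U(1), of k]
  \<comment> \<open>In the charts, \<open>\<phi>\<close> is \<open>f\<close> with derivative \<open>T\<close> at \<open>0\<close>, and \<open>\<psi>\<close> is \<open>R\<close> with derivative \<open>Q\<close> at the
      image of \<open>p\<close>.\<close>
  define f where "f = cmap c \<circ> \<phi>"
  define U' where "U' = {x \<in> U. \<phi> x \<in> cdom c}"
  have phic: "continuous_map (top_of_set U) M \<phi>" using phi by (simp add: Ck_map_def)
  have U': "open U'" "0 \<in> U'" "U' \<subseteq> U"
  proof -
    have "openin (top_of_set U) {x \<in> topspace (top_of_set U). \<phi> x \<in> cdom c}"
      using cc by (intro openin_continuous_map_preimage[OF phic]) (simp add: chart_on_def)
    then show "open U'" using U(1) by (simp add: U'_def openin_open_eq)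
  qed (use U c phi(3) in \<open>auto simp: U'_def\<close>)
  have phiCk: "Ck_on k UNIV (U \<inter> \<phi> -` cdom a) (cmap a \<circ> \<phi>)" if "a \<in> A" for a
  proof -
    have "Ck_on k UNIV (U \<inter> \<phi> -` cdom a) (cmap a \<circ> \<phi> \<circ> cinv ?o)"
      using phi(1) that by (simp add: Ck_map_def open_set_atlas_def)
    then show ?thesis by (rule Ck_on_subset_cong) (auto simp: cinv_open_set_atlas)
  qed
  have fCk: "Ck_on k UNIV U' f"
    unfolding f_def U'_def by (rule Ck_on_subset_cong[OF phiCk[OF c(1)]]) auto
  have openU': "openin (top_of_set UNIV) U'" using U'(1) by simp
  obtain L where L: "\<forall>x\<in>U'. has_derivative_in UNIV f (L x) x"
    "\<forall>x\<in>U'. \<forall>e>0. \<forall>\<^sub>F y in at x within UNIV. \<forall>v\<in>UNIV. norm (L y v - L x v) \<le> e * norm v"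
    by (rule Ck_on_derivative[OF fCk k subspace_UNIV openU'])
  define T where "T = L 0"
  have T: "has_derivative_in UNIV f T 0" unfolding T_def using L(1) U'(2) by blast
  have Tlin: "bounded_linear T" using T by (simp add: has_derivative_in_def bounded_linear_on_UNIV)
  have Tloc: "local_diff ?o c \<phi> 0 v = T v" for v
  proof -
    have "has_derivative_in UNIV (cmap c \<circ> \<phi> \<circ> cinv ?o) T 0"
      by (rule has_derivative_in_transform[OF subspace_UNIV openU' U'(2) _ T])
        (use U'(3) in \<open>auto simp: f_def cinv_open_set_atlas subset_iff\<close>)
    then show ?thesis unfolding local_diff_def by (simp add: derivative_in_eq)
  qed
  define R where "R = cmap d \<circ> \<psi> \<circ> cinv c"
  define UR where "UR = cmap c ` (cdom c \<inter> \<psi> -` cdom d)"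
  have UR: "openin (top_of_set E) UR" "cmap c p \<in> UR"
    using representative_domain_open[OF cc dd] psi c d \<psi>p by (auto simp: UR_def E_def Ck_map_def)
  have RCk: "Ck_on k E UR R" using psi c d by (simp add: Ck_map_def R_def UR_def E_def)
  obtain L' where L': "\<forall>x\<in>UR. has_derivative_in E R (L' x) x"
    "\<forall>x\<in>UR. \<forall>e>0. \<forall>\<^sub>F y in at x within E. \<forall>v\<in>E. norm (L' y v - L' x v) \<le> e * norm v"
    by (rule Ck_on_derivative[OF RCk k sE UR(1)])
  define Q where "Q = L' (cmap c p)"
  have Q: "has_derivative_in E R Q (cmap c p)" unfolding Q_def using L'(1) UR(2) by blast
  have Qloc: "local_diff c d \<psi> p v = Q v" if "v \<in> E" for v
    using derivative_in_eq[OF sE Q that] by (simp add: local_diff_def R_def E_def)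
  \<comment> \<open>The assumptions on the differentials compare images of vectors under \<open>tangent_vector\<close>, which
      is injective on the model space of each chart.\<close>
  have Qsurj: "Q ` E = cmodel d"
  proof -
    have \<psi>d: "\<psi> p \<in> cdom d" using d \<psi>p by simp
    have e1: "tangent_vector B q d ` (local_diff c d \<psi> p ` E) = tangent_vector B q d ` cmodel d"
      using differential_image_chart[OF k M N psi c d(1) \<psi>d] regular tangent_space_chart[OF k N d] by (simp add: \<psi>p E_def)
    have e2: "local_diff c d \<psi> p ` E \<subseteq> cmodel d"
      using local_diff_chain(2)[OF k M N N psi manifold_id[OF N] c d(1) \<psi>d d(1)] \<psi>d by (auto simp: E_def)
    have "local_diff c d \<psi> p ` E = cmodel d"
      by (rule iffD1[OF inj_on_image_eq_iff[OF tangent_vector_inj[OF dd d] e2 subset_refl] e1])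
    moreover have "local_diff c d \<psi> p ` E = Q ` E" by (rule image_cong) (simp_all add: Qloc)
    ultimately show ?thesis by simp
  qed
  have \<phi>c: "\<phi> 0 \<in> cdom c" using c phi(3) by simp
  have Tinj: "inj T"
  proof -
    have "local_diff ?o c \<phi> 0 = T" by (rule ext) (rule Tloc)
    then show ?thesis using inj differential_inj_chart[OF k OM M phi(1) oA c(1) \<phi>c] by simp
  qed
  have Trange: "range T = {v \<in> E. Q v = 0}"
  proof -
    have \<psi>d: "\<psi> p \<in> cdom d" using d \<psi>p by simp
    have e1: "tangent_vector A p c ` (range T) = tangent_vector A p c ` {v \<in> E. Q v = 0}"
      using ker differential_image_chart[OF k OM M phi(1) oA c(1) \<phi>c]
        differential_kernel_chart[OF k M N psi c d(1) \<psi>d] Tloc Qloc phi(3)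
      by (simp add: E_def cong: conj_cong)
    have e2: "range T \<subseteq> E"
      using local_diff_chain(2)[OF k OM M M phi(1) manifold_id[OF M] oA c(1) \<phi>c c(1)] \<phi>c Tloc by (auto simp: E_def)
    have e3: "{v \<in> E. Q v = 0} \<subseteq> E" by blast
    show ?thesis
      by (rule iffD1[OF inj_on_image_eq_iff[OF tangent_vector_inj[OF cc c] e2[unfolded E_def] e3[unfolded E_def]] e1[unfolded E_def], folded E_def])
  qed
  define Z where "Z = cmap c ` (S \<inter> cdom c)"
  have f0: "f 0 = cmap c p" using phi(3) by (simp add: f_def)
  have ZE: "Z \<subseteq> E" using chart_image_subset[OF cc] by (auto simp: Z_def E_def)
  have fZ: "f x \<in> Z" if "x \<in> U'" for x using that phi(2) by (auto simp: Z_def f_def U'_def)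
  have fstrict: "\<exists>d>0. \<forall>x y. norm x < d \<longrightarrow> norm y < d \<longrightarrow> norm (f x - f y - T (x - y)) \<le> e * norm (x - y)" if "e > 0" for e
    using strict_derivative[OF subspace_UNIV openU' U'(2) L(1) bspec[OF L(2) U'(2)] that] by (simp add: T_def)
  have Zstrict: "\<exists>d>0. \<forall>y\<in>Z. \<forall>z\<in>Z. norm (y - f 0) < d \<longrightarrow> norm (z - f 0) < d \<longrightarrow> norm (Q (y - z)) \<le> e * norm (y - z)"
    if e: "e > 0" for e
  proof -
    obtain d' where d': "d' > 0" "\<And>y z. y \<in> E \<Longrightarrow> z \<in> E \<Longrightarrow> norm (y - cmap c p) < d' \<Longrightarrow> norm (z - cmap c p) < d' \<Longrightarrow>
      norm (R y - R z - Q (y - z)) \<le> e * norm (y - z)"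
      using strict_derivative[OF sE UR L'(1) bspec[OF L'(2) UR(2)] e] unfolding Q_def by blast
    have "R y = cmap d q" if "y \<in> Z" for y using that S by (auto simp: Z_def R_def cinv_cmap[OF cc])
    then have "norm (Q (y - z)) \<le> e * norm (y - z)"
      if "y \<in> Z" "z \<in> Z" "norm (y - f 0) < d'" "norm (z - f 0) < d'" for y z
      using d'(2)[of y z] that ZE by (auto simp: f0)
    then show ?thesis using d'(1) by blast
  qed
  obtain r\<^sub>0 where r0: "r\<^sub>0 > 0" "ball 0 r\<^sub>0 \<subseteq> U'" using U' open_contains_ball by blast
  have fball: "f ` ball 0 r\<^sub>0 \<subseteq> Z" using r0(2) fZ by blast
  have Qlin: "bounded_linear_on E Q" using Q by (simp add: has_derivative_in_def)
  obtain r K \<delta> where r: "0 < r" "r \<le> r\<^sub>0" and K: "K > 0" and fcont: "continuous_on (ball 0 r) f"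
    and lower: "\<forall>x y. norm x < r \<longrightarrow> norm y < r \<longrightarrow> K * norm (x - y) \<le> norm (f x - f y)"
    and \<delta>: "\<delta> > 0" and onto: "\<forall>y\<in>Z. norm (y - f 0) < \<delta> \<longrightarrow> (\<exists>x. norm x < r \<and> f x = y)"
    by (rule level_set_parametrized[OF bE bF Qlin Qsurj Tlin Tinj Trange fstrict ZE Zstrict r0(1) fball])
  \<comment> \<open>\<open>f\<close> covers the points of \<open>Z\<close> in the \<open>\<delta>\<close>-ball, but \<open>f\<close> may leave this ball inside the \<open>r\<close>-ball;
      cutting down to its preimage makes \<open>\<phi>\<close> a bijection onto a relatively open set.\<close>
  define V where "V = {x \<in> ball 0 r. f x \<in> ball (cmap c p) \<delta>}"
  define D where "D = {m \<in> S \<inter> cdom c. cmap c m \<in> ball (cmap c p) \<delta>}"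
  have V: "open V" "0 \<in> V" "V \<subseteq> U'"
  proof -
    have "V = ball 0 r \<inter> f -` ball (cmap c p) \<delta>" by (auto simp: V_def)
    then show "open V" using continuous_open_preimage[OF fcont open_ball open_ball] by simp
    show "0 \<in> V" using r(1) \<delta> by (simp add: V_def f0)
    show "V \<subseteq> U'" using r(2) r0(2) by (auto simp: V_def)
  qed
  have VK: "K * norm (x - y) \<le> norm (f x - f y)" if "x \<in> V" "y \<in> V" for x y
    using lower that by (simp add: V_def)
  have finj: "inj_on f V"
  proof (rule inj_onI)
    fix x y assume "x \<in> V" "y \<in> V" "f x = f y"
    then have "K * norm (x - y) \<le> 0" using VK[of x y] by simp
    then show "x = y" using K by (simp add: mult_le_0_iff)
  qed
  have \<phi>inj: "inj_on \<phi> V" using finj unfolding f_def by (rule inj_on_imageI2)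
  have \<phi>V: "\<phi> ` V = D"
  proof
    show "\<phi> ` V \<subseteq> D" using V(3) phi(2) by (auto simp: V_def D_def U'_def f_def)
    show "D \<subseteq> \<phi> ` V"
    proof
      fix m assume m: "m \<in> D"
      then have "cmap c m \<in> Z" "norm (cmap c m - f 0) < \<delta>" by (auto simp: D_def Z_def f0 dist_norm norm_minus_commute)
      then obtain x where x: "norm x < r" "f x = cmap c m" using onto by blast
      then have xV: "x \<in> V" using m by (simp add: V_def D_def)
      then have "\<phi> x \<in> cdom c" using V(3) by (auto simp: U'_def)
      then have "\<phi> x = m" using x(2) m chart_inj[OF cc] by (auto simp: f_def D_def dest: inj_onD)
      then show "m \<in> \<phi> ` V" using xV by blast
    qed
  qed
  define h where "h = inv_into V \<phi>"
  have h\<phi>: "h (\<phi> x) = x" if "x \<in> V" for x unfolding h_def by (rule inv_into_f_f[OF \<phi>inj that])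
  have hD: "h ` D = V" unfolding \<phi>V[symmetric] image_image by (simp add: h\<phi>)
  have \<phi>h: "\<phi> (h m) = m" if "m \<in> D" for m using that unfolding \<phi>V[symmetric] by (auto simp: h\<phi>)
  define s where "s = Chart D h (UNIV :: 'x set)"
  have s: "cdom s = D" "cmap s = h" "cmodel s = UNIV" by (simp_all add: s_def)
  have hinj: "inj_on h D" by (rule inj_on_inverseI[of _ \<phi>]) (rule \<phi>h)
  have sinv: "cinv s x = \<phi> x" if "x \<in> V" for x
    using inv_into_f_f[OF hinj, of "\<phi> x"] that \<phi>V by (auto simp: cinv_def s h\<phi>)
  have DS: "D \<subseteq> S" "D \<subseteq> cdom c" by (auto simp: D_def)
  have sub: "subtopology (subtopology M S) D = subtopology M D"
    using DS by (simp add: subtopology_subtopology inf_absorb2)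
  have chart: "chart_on (subtopology M S) s"
    unfolding chart_on_def s hD sub
  proof (intro conjI)
    have "openin M {m \<in> cdom c. cmap c m \<in> ball (cmap c p) \<delta>}" by (rule chart_open_preimage[OF cc open_ball])
    moreover have "D = S \<inter> {m \<in> cdom c. cmap c m \<in> ball (cmap c p) \<delta>}" by (auto simp: D_def)
    ultimately show "openin (subtopology M S) D" by (auto simp: openin_subtopology)
    show "banach_subspace (UNIV :: 'x set)" by (simp add: banach_subspace_def)
    show "openin (top_of_set UNIV) V" using V(1) by simp
    have 1: "continuous_map (top_of_set V) (subtopology M D) \<phi>"
      using continuous_map_from_subtopology[OF phic, of V] V(3) U'(3) \<phi>V
      by (auto simp: continuous_map_in_subtopology subtopology_subtopology inf_absorb2 image_subset_iff)
    \<comment> \<open>On \<open>D\<close> the chart \<open>h\<close> is the chart \<open>c\<close> followed by the Lipschitz inverse of \<open>f\<close>.\<close>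
    define g where "g = inv_into V f"
    have gf: "g (f x) = x" if "x \<in> V" for x unfolding g_def by (rule inv_into_f_f[OF finj that])
    have "(1 / K)-lipschitz_on (f ` V) g"
    proof (rule lipschitz_onI)
      fix y z assume "y \<in> f ` V" "z \<in> f ` V"
      then obtain x x' where x: "x \<in> V" "y = f x" "x' \<in> V" "z = f x'" by blast
      then show "dist (g y) (g z) \<le> 1 / K * dist y z"
        using VK[of x x'] K by (simp add: gf dist_norm field_simps)
    qed (use K in simp)
    then have "continuous_map (top_of_set (f ` V)) euclidean g"
      using lipschitz_on_continuous_on by (simp add: continuous_map_iff_continuous)
    moreover have "continuous_map (subtopology M D) (top_of_set (f ` V)) (cmap c)"
    proof -
      have "continuous_map (subtopology M (cdom c)) euclidean (cmap c)"
        using chart_continuous[OF cc] by (simp add: continuous_map_in_subtopology)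
      then have "continuous_map (subtopology (subtopology M (cdom c)) D) euclidean (cmap c)"
        by (rule continuous_map_from_subtopology)
      moreover have "cmap c ` D = f ` V" unfolding \<phi>V[symmetric] by (simp add: f_def image_image)
      ultimately show ?thesis
        using DS ST by (auto simp: continuous_map_in_subtopology subtopology_subtopology inf_absorb2)
    qed
    ultimately have "continuous_map (subtopology M D) euclidean (g \<circ> cmap c)" using continuous_map_compose by blast
    moreover have "(g \<circ> cmap c) m = h m" if "m \<in> D" for m
      using that unfolding \<phi>V[symmetric] by (auto simp: h\<phi> gf simp flip: f_def[THEN fun_cong, unfolded o_def])
    ultimately have "continuous_map (subtopology M D) euclidean h"
      by (rule_tac continuous_map_eq[of _ _ "g \<circ> cmap c"]) auto
    then have 2: "continuous_map (subtopology M D) (top_of_set V) h"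
      using hD by (auto simp: continuous_map_in_subtopology)
    have "homeomorphic_maps (subtopology M D) (top_of_set V) h \<phi>"
      using 1 2 h\<phi> \<phi>h by (auto simp: homeomorphic_maps_def)
    then show "homeomorphic_map (subtopology M D) (top_of_set V) h" by (rule homeomorphic_maps_imp_map)
  qed
  have pD: "p \<in> D" using p c \<delta> by (simp add: D_def)
  have hp: "h p = 0" using h\<phi>[OF V(2)] phi(3) by simp
  have sCk: "Ck_on k UNIV (cmap s ` (cdom s \<inter> cdom a)) (cmap a \<circ> cinv s)" if "a \<in> A" for a
  proof (rule Ck_on_subset_cong[OF phiCk[OF that]])
    have *: "h m \<in> V \<and> \<phi> (h m) = m" if "m \<in> D" for m using that hD \<phi>h by blast
    show "cmap s ` (cdom s \<inter> cdom a) \<subseteq> U \<inter> \<phi> -` cdom a"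
      using * V(3) U'(3) by (auto simp: s)
    show "(cmap a \<circ> \<phi>) x = (cmap a \<circ> cinv s) x" if "x \<in> cmap s ` (cdom s \<inter> cdom a)" for x
      using that * by (auto simp: s sinv)
  qed
  have "K * norm (x - y) \<le> norm (cmap c (cinv s x) - cmap c (cinv s y))"
    if "x \<in> cmap s ` cdom s" "y \<in> cmap s ` cdom s" for x y
    using VK[of x y] that by (simp add: s hD sinv f_def)
  then have sK: "\<exists>a\<in>A. cdom s \<subseteq> cdom a \<and> (\<exists>K>0. \<forall>x\<in>cmap s ` cdom s. \<forall>y\<in>cmap s ` cdom s.
        K * norm (x - y) \<le> norm (cmap a (cinv s x) - cmap a (cinv s y)))"
    using c(1) K DS(2) s(1) by blast
  have sdiff: "local_diff s c id p = T"
  proof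
    fix v
    have "openin (top_of_set UNIV) V" using V(1) by simp
    then have "has_derivative_in UNIV (cmap c \<circ> id \<circ> cinv s) T 0"
      by (rule has_derivative_in_transform[OF subspace_UNIV _ V(2) _ T]) (simp add: f_def sinv)
    then show "local_diff s c id p v = T v"
      unfolding local_diff_def s hp by (simp add: derivative_in_eq)
  qed
  have "{v \<in> cmodel c. local_diff c d \<psi> p v = 0} = {v \<in> E. Q v = 0}"
    using Qloc by (auto simp: E_def)
  then show ?thesis
    using chart s(3) pD s(1) sCk sK Tinj Trange sdiff unfolding adapted_chart_def by (intro exI[of _ s]) simp
qed

text \<open>
  A chart change \<open>g\<close> to \<open>u\<close> satisfies \<open>f\<^sub>2 \<circ> g = f\<^sub>1\<close> for the inverses of the two charts, read in a
  chart of \<open>M\<close> in which that of \<open>u\<close> is bounded from below. So \<open>Ck_on_lift_immersion\<close> applies to \<open>g\<close>.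
\<close>

lemma adapted_atlas:
  assumes k: "1 \<le> k" and S: "S \<subseteq> topspace M" and adapted: "\<And>t. t \<in> C \<Longrightarrow> adapted_chart k M A S t"
    and cover: "S \<subseteq> (\<Union>t\<in>C. cdom t)"
  shows "banach_manifold k (subtopology M S) C" "Ck_map k (subtopology M S) C M A id"
proof -
  have C: "chart_on (subtopology M S) t" "cmodel t = UNIV"
    "a \<in> A \<Longrightarrow> Ck_on k UNIV (cmap t ` (cdom t \<inter> cdom a)) (cmap a \<circ> cinv t)"
    "\<exists>a\<in>A. cdom t \<subseteq> cdom a \<and> (\<exists>K>0. \<forall>x\<in>cmap t ` cdom t. \<forall>y\<in>cmap t ` cdom t.
        K * norm (x - y) \<le> norm (cmap a (cinv t x) - cmap a (cinv t y)))" if "t \<in> C" for t a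
    using adapted[OF that] unfolding adapted_chart_def by simp_all
  show "banach_manifold k (subtopology M S) C"
    unfolding banach_manifold_def
  proof (intro conjI ballI)
    show "chart_on (subtopology M S) t" if "t \<in> C" for t by (rule C(1)[OF that])
  next
    have "cdom t \<subseteq> S" if "t \<in> C" for t using chart_dom_subset[OF C(1)[OF that]] by simp
    then show "\<Union> (cdom ` C) = topspace (subtopology M S)" using S cover by auto
  next
    fix t u assume t: "t \<in> C" and u: "u \<in> C"
    note tc = C(1)[OF t] and uc = C(1)[OF u]
    note tm = C(2)[OF t] and um = C(2)[OF u]
    obtain a K where a: "a \<in> A" "cdom u \<subseteq> cdom a" "K > 0"
      "\<forall>x\<in>cmap u ` cdom u. \<forall>y\<in>cmap u ` cdom u. K * norm (x - y) \<le> norm (cmap a (cinv u x) - cmap a (cinv u y))"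
      using C(4)[OF u] by (elim conjE bexE exE) (rule that)
    let ?W = "cmap t ` (cdom t \<inter> cdom u)" and ?V = "cmap u ` cdom u"
    have "openin (top_of_set (cmodel t)) ?W"
      using uc by (intro chart_open_image[OF tc]) (simp add: chart_on_def)
    then have W: "open ?W" by (simp add: tm)
    have V: "open ?V" using uc by (simp add: chart_on_def um)
    have "Ck_on k UNIV ?W (cmap u \<circ> cinv t)"
    proof (rule Ck_on_lift_immersion[OF k W V _ a(3), where f\<^sub>2 = "cmap a \<circ> cinv u"])
      show "(cmap u \<circ> cinv t) ` ?W \<subseteq> ?V" by (auto simp: cinv_cmap[OF tc])
      show "K * norm (x - y) \<le> norm ((cmap a \<circ> cinv u) x - (cmap a \<circ> cinv u) y)" if "x \<in> ?V" "y \<in> ?V" for x y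
        using a(4)[rule_format, OF that] by simp
      show "Ck_on k UNIV ?V (cmap a \<circ> cinv u)"
        using C(3)[OF u a(1)] a(2) by (simp add: inf_absorb1)
      have "Ck_on k UNIV (cmap t ` (cdom t \<inter> cdom a)) (cmap a \<circ> cinv t)" using C(3)[OF t a(1)] .
      then show "Ck_on k UNIV ?W (\<lambda>x. (cmap a \<circ> cinv u) ((cmap u \<circ> cinv t) x))"
        by (rule Ck_on_subset_cong) (use a(2) in \<open>auto simp: cinv_cmap[OF tc] cinv_cmap[OF uc]\<close>)
    qed
    then show "Ck_on k (cmodel t) ?W (cmap u \<circ> cinv t)" by (simp add: tm)
  qed
  show "Ck_map k (subtopology M S) C M A id"
    unfolding Ck_map_def
  proof (intro conjI ballI)
    show "continuous_map (subtopology M S) M id" by (rule continuous_map_from_subtopology) simp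
    fix t a assume "t \<in> C" "a \<in> A"
    then show "Ck_on k (cmodel t) (cmap t ` (cdom t \<inter> id -` cdom a)) (cmap a \<circ> id \<circ> cinv t)"
      using C(2)[of t] C(3)[of t a] by simp
  qed
qed

theorem theorem3p6:
  fixes k :: enat
    and M :: "'m topology" and A :: "('m, 'e::banach) chart set"
    and N :: "'n topology" and B :: "('n, 'f::banach) chart set"
    and \<psi> :: "'m \<Rightarrow> 'n" and q :: 'n and S :: "'m set"
  assumes k: "1 \<le> k"
    and M: "banach_manifold k M A"
    and N: "banach_manifold k N B"
    and psi: "Ck_map k M A N B \<psi>"
    and q: "q \<in> topspace N"
    and S: "S = {p \<in> topspace M. \<psi> p = q}"
    and regular: "\<And>p. p \<in> S \<Longrightarrow>
      differential A B \<psi> p ` tangent_space A p = tangent_space B q"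
    and param: "\<And>p. p \<in> S \<Longrightarrow>
      \<exists>(U :: 'x::banach set) (\<phi> :: 'x \<Rightarrow> 'm).
        open U \<and> 0 \<in> U \<and>
        Ck_map k (top_of_set U) (open_set_atlas U) M A \<phi> \<and> \<phi> ` U \<subseteq> S \<and>
        \<phi> 0 = p \<and>
        inj_on (differential (open_set_atlas U) A \<phi> 0) (tangent_space (open_set_atlas U) 0) \<and>
        differential (open_set_atlas U) A \<phi> 0 ` tangent_space (open_set_atlas U) 0
          = differential_kernel A B \<psi> p"
  shows "\<exists>C :: ('m, 'x) chart set.
      banach_manifold k (subtopology M S) C \<and>
      modeled_on C UNIV \<and>
      Ck_map k (subtopology M S) C M A id \<and>
      (\<forall>p\<in>S. inj_on (differential C A id p) (tangent_space C p) \<and>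
             differential C A id p ` tangent_space C p = differential_kernel A B \<psi> p)"
proof -
  define good :: "'m \<Rightarrow> ('m, 'x) chart \<Rightarrow> bool" where
    "good p s \<longleftrightarrow> adapted_chart k M A S s \<and> p \<in> cdom s \<and>
      (\<exists>c\<in>A. p \<in> cdom c \<and> (\<exists>d\<in>B. q \<in> cdom d \<and> inj (local_diff s c id p) \<and>
         range (local_diff s c id p) = {v \<in> cmodel c. local_diff c d \<psi> p v = 0}))" for p s
  have "\<exists>s. good p s" if p: "p \<in> S" for p
  proof -
    obtain c where c: "c \<in> A" "p \<in> cdom c" using manifold_chart_exists[OF M] p S by blast
    obtain d where d: "d \<in> B" "q \<in> cdom d" using manifold_chart_exists[OF N q] by blast
    obtain U :: "'x set" and \<phi> where U: "open U" "0 \<in> U"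
      "Ck_map k (top_of_set U) (open_set_atlas U) M A \<phi>" "\<phi> ` U \<subseteq> S" "\<phi> 0 = p"
      "inj_on (differential (open_set_atlas U) A \<phi> 0) (tangent_space (open_set_atlas U) 0)"
      "differential (open_set_atlas U) A \<phi> 0 ` tangent_space (open_set_atlas U) 0 = differential_kernel A B \<psi> p"
      using param[OF p] by blast
    show ?thesis
      using level_set_chart[OF k M N psi S p regular[OF p] U c d] c d unfolding good_def by blast
  qed
  then obtain s where good: "\<And>p. p \<in> S \<Longrightarrow> good p (s p)" by metis
  then have s: "adapted_chart k M A S (s p)" "p \<in> cdom (s p)" if "p \<in> S" for p
    using that by (simp_all add: good_def)
  define C where "C = s ` S"
  have ST: "S \<subseteq> topspace M" using S by blast
  have cover: "S \<subseteq> (\<Union>t\<in>C. cdom t)" using s(2) by (auto simp: C_def)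
  have adapted: "adapted_chart k M A S t" if "t \<in> C" for t using that s(1) by (auto simp: C_def)
  have man: "banach_manifold k (subtopology M S) C"
    by (rule adapted_atlas(1)[OF k ST _ cover]) (rule adapted)
  have incl: "Ck_map k (subtopology M S) C M A id"
    by (rule adapted_atlas(2)[OF k ST _ cover]) (rule adapted)
  have "inj_on (differential C A id p) (tangent_space C p) \<and>
      differential C A id p ` tangent_space C p = differential_kernel A B \<psi> p" if p: "p \<in> S" for p
  proof -
    have sp: "s p \<in> C" "p \<in> cdom (s p)" "cmodel (s p) = UNIV" using s[OF p] p by (auto simp: C_def adapted_chart_def)
    obtain c d where c: "c \<in> A" "p \<in> cdom c" and d: "d \<in> B" "q \<in> cdom d"
      and inj: "inj (local_diff (s p) c id p)"
      and range: "range (local_diff (s p) c id p) = {v \<in> cmodel c. local_diff c d \<psi> p v = 0}"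
      using good[OF p] unfolding good_def by (elim conjE bexE) (rule that)
    have \<psi>d: "\<psi> p \<in> cdom d" using d p S by simp
    have idp: "id p \<in> cdom c" using c by simp
    show ?thesis
    proof
      show "inj_on (differential C A id p) (tangent_space C p)"
        unfolding differential_inj_chart[OF k man M incl sp(1,2) c(1) idp] sp(3) by (rule inj)
      show "differential C A id p ` tangent_space C p = differential_kernel A B \<psi> p"
        unfolding differential_image_chart[OF k man M incl sp(1,2) c(1) idp]
          differential_kernel_chart[OF k M N psi c d(1) \<psi>d] sp(3) range by simp
    qed
  qed
  moreover have "modeled_on C UNIV" using adapted by (simp add: modeled_on_def adapted_chart_def)
  ultimately show ?thesis using man incl by blast
qed

end
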